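(* Let $d\ge 2$, let $M$ be a closed connected PL $d$-manifold, and let $R$ be a triangulation of $M$ with $n_0$ vertices. For every $n\ge n_0$, the graph $\mathcal M_R(n)$ is exactly one connected component of $G(n)$. This component is the $(n-n_0)$-fold stabilization of the component of $G(n_0)$ containing $R$.
   Context: Let $M$ be a closed connected PL $d$-manifold with $d\ge 2$. A triangulation of $M$ is a finite simplicial complex whose geometric realization is PL-homeomorphic to $M$; isomorphic triangulations are identified. A facet is a $d$-simplex. For a simplex $\alpha\in T$, $\operatorname{lk}_T(\alpha)=\{\gamma\in T:\gamma\cap\alpha=\varnothing,\ \gamma\cup\alpha\in T\}$; $\partial\alpha$ is the boundary complex of $\alpha$, $A*B$ is the simplicial join, and $|\alpha|$ is the number of vertices of $\alpha$. Bistellar moves: let $\alpha,\beta$ be disjoint simplices with $|\alpha|+|\beta|=d+2$, $\alpha\in T$, $\beta\notin T$ and $\operatorname{lk}_T(\alpha)=\partial\beta$. The bistellar move replaces the ball $\alpha*\partial\beta$ by $\partial\alpha*\beta$. If $|\beta|=p$ and $|\alpha|=q$ it is called a $p$--$q$ move. The $1$--$(d+1)$ move is stellar subdivision of a facet $\alpha$ with a new vertex $\beta$ (a facet subdivision); its inverse is the $(d+1)$--$1$ move, which deletes a vertex. The other moves ($2\le p,q\le d$) are called proper, or vertex-preserving. $G(n)$ is the graph whose vertices are the triangulations of $M$ with $n$ vertices (up to isomorphism), with an edge for each proper bistellar move (loops are allowed). $C(n)=\pi_0(G(n))$ is its set of connected components. Stabilization: for each $U\in C(n)$, all facet subdivisions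 of all triangulations in $U$ lie in a single component of $G(n+1)$, denoted $s_n(U)$. The $k$-fold stabilization of $U\in C(n)$ is $s_{n+k-1}\cdots s_{n+1}s_n(U)\in C(n+k)$ (equal to $U$ for $k=0$). Monotone closure: for a triangulation $R$ of $M$ with $n_0$ vertices, $\mathcal M(R)$ is the set of triangulations reachable from $R$ by proper bistellar moves and $1$--$(d+1)$ facet subdivisions, without using a $(d+1)$--$1$ move. For $n\ge n_0$, $\mathcal M_R(n)=G(n)\bigl[\mathcal M(R)\cap V(G(n))\bigr]$ is the induced subgraph of $G(n)$ on the $n$-vertex triangulations in $\mathcal M(R)$. *)

theory Defs
  imports "HOL-Analysis.Analysis" "HOL-Analysis.Finite_Function_Topology"
    "Graph_Theory.Graph_Theory"
begin

section \<open>Piecewise linear maps and manifolds\<close>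

definition affine_map_on :: "'a::real_vector set \<Rightarrow> ('a \<Rightarrow> 'b::real_vector) \<Rightarrow> bool" where
  "affine_map_on P f \<longleftrightarrow>
    (\<forall>x\<in>P. \<forall>y\<in>P. \<forall>t\<in>{0..1}. f ((1 - t) *\<^sub>R x + t *\<^sub>R y) = (1 - t) *\<^sub>R f x + t *\<^sub>R f y)"

text \<open>
  \<open>X\<close> is meant to be a (not necessarily compact) polyhedron, e.g. a finite union of polytopes, an
  open subset of such a union, or an open subset of a Euclidean space. Every point is required to
  have a neighbourhood in \<open>X\<close> that is a finite union of polytopes on each of which \<open>f\<close> is affine;
  this entails that \<open>X\<close> is a polyhedron and that \<open>f\<close> is continuous on \<open>X\<close>.
\<close>

definition PL_on :: "'a::real_normed_vector set \<Rightarrow> ('a \<Rightarrow> 'b::real_normed_vector) \<Rightarrow> bool" where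
  "PL_on X f \<longleftrightarrow>
    (\<forall>x\<in>X. \<exists>\<P> N. finite \<P> \<and> (\<forall>P\<in>\<P>. polytope P \<and> P \<subseteq> X \<and> affine_map_on P f) \<and>
       openin (top_of_set X) N \<and> x \<in> N \<and> N \<subseteq> \<Union>\<P>)"

record ('m, 'e) charted_space =
  underlying :: "'m topology"
  charts :: "('m set \<times> ('m \<Rightarrow> 'e)) set"

text \<open>
  The model space of the charts is the Euclidean space \<open>'e\<close> of dimension \<open>d\<close>, so there is no
  boundary. The atlas need not be maximal.
\<close>

definition PL_manifold :: "nat \<Rightarrow> ('m, 'e::euclidean_space) charted_space \<Rightarrow> bool" where
  "PL_manifold d M \<longleftrightarrow>
    DIM('e) = d \<and>
    Hausdorff_space (underlying M) \<and> second_countable (underlying M) \<and>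
    (\<forall>(U, \<phi>)\<in>charts M. openin (underlying M) U \<and> open (\<phi> ` U) \<and>
       homeomorphic_map (subtopology (underlying M) U) (top_of_set (\<phi> ` U)) \<phi>) \<and>
    \<Union>(fst ` charts M) = topspace (underlying M) \<and>
    (\<forall>(U, \<phi>)\<in>charts M. \<forall>(V, \<psi>)\<in>charts M. PL_on (\<phi> ` (U \<inter> V)) (\<psi> \<circ> inv_into U \<phi>))"

text \<open>The library counts the empty space as connected, so nonemptiness is required separately.\<close>

definition closed_connected_PL_manifold ::
  "nat \<Rightarrow> ('m, 'e::euclidean_space) charted_space \<Rightarrow> bool" where
  "closed_connected_PL_manifold d M \<longleftrightarrow>
    PL_manifold d M \<and> compact_space (underlying M) \<and>
    connected_space (underlying M) \<and> topspace (underlying M) \<noteq> {}"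

definition PL_homeomorphism ::
  "'a::real_normed_vector set \<Rightarrow> ('m, 'e::euclidean_space) charted_space \<Rightarrow> ('a \<Rightarrow> 'm) \<Rightarrow> bool" where
  "PL_homeomorphism P M h \<longleftrightarrow>
    homeomorphic_map (top_of_set P) (underlying M) h \<and>
    (\<forall>(U, \<phi>)\<in>charts M.
       PL_on {x \<in> P. h x \<in> U} (\<phi> \<circ> h) \<and>
       PL_on (\<phi> ` U) (inv_into P h \<circ> inv_into U \<phi>))"


section \<open>Simplicial complexes and triangulations\<close>

text \<open>
  Simplices are identified with their vertex sets, and a complex always contains the empty simplex,
  as is needed for links and joins. Labelling vertices by natural numbers is no restriction for
  finite complexes up to isomorphism.
\<close>

type_synonym scomplex = "nat set set"

definition simplicial_complex :: "scomplex \<Rightarrow> bool" where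
  "simplicial_complex T \<longleftrightarrow>
    finite T \<and> {} \<in> T \<and> (\<forall>\<sigma>\<in>T. finite \<sigma> \<and> (\<forall>\<tau>. \<tau> \<subseteq> \<sigma> \<longrightarrow> \<tau> \<in> T))"

abbreviation vertices :: "scomplex \<Rightarrow> nat set" where
  "vertices T \<equiv> \<Union>T"

text \<open>The vertex \<open>v\<close> is realized as the \<open>v\<close>-th standard basis vector.\<close>

definition geometric_realization :: "scomplex \<Rightarrow> (nat \<Rightarrow>\<^sub>0 real) set" where
  "geometric_realization T = (\<Union>\<sigma>\<in>T. convex hull ((\<lambda>v. Poly_Mapping.single v 1) ` \<sigma>))"

definition triangulates :: "('m, 'e::euclidean_space) charted_space \<Rightarrow> scomplex \<Rightarrow> bool" where
  "triangulates M T \<longleftrightarrow>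
    simplicial_complex T \<and> (\<exists>h. PL_homeomorphism (geometric_realization T) M h)"

definition isomorphic :: "scomplex \<Rightarrow> scomplex \<Rightarrow> bool" where
  "isomorphic S T \<longleftrightarrow> (\<exists>f. bij_betw f (vertices S) (vertices T) \<and> T = (`) f ` S)"

definition iso_class :: "scomplex \<Rightarrow> scomplex set" where
  "iso_class T = {S. isomorphic T S}"


section \<open>Bistellar moves\<close>

definition link :: "scomplex \<Rightarrow> nat set \<Rightarrow> scomplex" where
  "link T \<alpha> = {\<gamma>\<in>T. \<gamma> \<inter> \<alpha> = {} \<and> \<gamma> \<union> \<alpha> \<in> T}"

definition boundary :: "nat set \<Rightarrow> scomplex" where
  "boundary \<alpha> = {\<tau>. \<tau> \<subset> \<alpha>}"

definition join :: "scomplex \<Rightarrow> scomplex \<Rightarrow> scomplex" where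
  "join A B = {\<sigma> \<union> \<tau> |\<sigma> \<tau>. \<sigma> \<in> A \<and> \<tau> \<in> B}"

text \<open>
  \<open>bistellar_move d p q\<close> is the \<open>p\<close>--\<open>q\<close> move. Removing all of \<open>join (Pow \<alpha>) (boundary \<beta>)\<close>
  also removes the common boundary \<open>join (boundary \<alpha>) (boundary \<beta>)\<close> of the two balls, but that is
  contained in \<open>join (boundary \<alpha>) (Pow \<beta>)\<close> and hence put back.
\<close>

definition bistellar_move :: "nat \<Rightarrow> nat \<Rightarrow> nat \<Rightarrow> scomplex \<Rightarrow> scomplex \<Rightarrow> bool" where
  "bistellar_move d p q S T \<longleftrightarrow>
    (\<exists>\<alpha> \<beta>. \<alpha> \<in> S \<and> \<beta> \<notin> S \<and> \<alpha> \<noteq> {} \<and> \<beta> \<noteq> {} \<and> \<alpha> \<inter> \<beta> = {} \<and>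
       card \<beta> = p \<and> card \<alpha> = q \<and> p + q = d + 2 \<and>
       link S \<alpha> = boundary \<beta> \<and>
       T = (S - join (Pow \<alpha>) (boundary \<beta>)) \<union> join (boundary \<alpha>) (Pow \<beta>))"

definition proper_move :: "nat \<Rightarrow> scomplex \<Rightarrow> scomplex \<Rightarrow> bool" where
  "proper_move d S T \<longleftrightarrow> (\<exists>p\<in>{2..d}. \<exists>q\<in>{2..d}. bistellar_move d p q S T)"

definition facet_subdivision :: "nat \<Rightarrow> scomplex \<Rightarrow> scomplex \<Rightarrow> bool" where
  "facet_subdivision d S T \<longleftrightarrow> bistellar_move d 1 (d + 1) S T"


section \<open>The flip graph, its components and stabilization\<close>

text \<open>
  An undirected graph is represented by the symmetric digraph with both orientations of every edge.
  Its connected components are then its strongly connected components. Parallel edges are not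
  recorded.
\<close>

type_synonym flip_graph = "(scomplex set, scomplex set \<times> scomplex set) pre_digraph"

definition flip_graph ::
  "nat \<Rightarrow> ('m, 'e::euclidean_space) charted_space \<Rightarrow> nat \<Rightarrow> flip_graph" where
  "flip_graph d M n =
    (let V = {iso_class T |T. triangulates M T \<and> card (vertices T) = n}
     in with_proj \<lparr> pverts = V,
          parcs = {(A, B) \<in> V \<times> V. \<exists>S\<in>A. \<exists>T\<in>B. proper_move d S T \<or> proper_move d T S} \<rparr>)"

definition flip_components ::
  "nat \<Rightarrow> ('m, 'e::euclidean_space) charted_space \<Rightarrow> nat \<Rightarrow> flip_graph set" where
  "flip_components d M n = pre_digraph.sccs (flip_graph d M n)"

definition flip_component_of ::
  "nat \<Rightarrow> ('m, 'e::euclidean_space) charted_space \<Rightarrow> nat \<Rightarrow> scomplex \<Rightarrow> flip_graph" where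
  "flip_component_of d M n T =
    flip_graph d M n \<restriction> pre_digraph.scc_of (flip_graph d M n) (iso_class T)"

definition stabilization ::
  "nat \<Rightarrow> ('m, 'e::euclidean_space) charted_space \<Rightarrow> nat \<Rightarrow> flip_graph \<Rightarrow> flip_graph" where
  "stabilization d M n U =
    (THE W. W \<in> flip_components d M (n + 1) \<and>
       (\<forall>S T. iso_class S \<in> verts U \<longrightarrow> facet_subdivision d S T \<longrightarrow> iso_class T \<in> verts W))"

fun iterated_stabilization ::
  "nat \<Rightarrow> ('m, 'e::euclidean_space) charted_space \<Rightarrow> nat \<Rightarrow> nat \<Rightarrow> flip_graph \<Rightarrow> flip_graph" where
  "iterated_stabilization d M n 0 U = U"
| "iterated_stabilization d M n (Suc k) U =
     stabilization d M (n + k) (iterated_stabilization d M n k U)"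


section \<open>Monotone closure\<close>

definition monotone_closure :: "nat \<Rightarrow> scomplex \<Rightarrow> scomplex set set" where
  "monotone_closure d R =
    {A. (iso_class R, A) \<in>
      {(iso_class S, iso_class T) |S T. proper_move d S T \<or> facet_subdivision d S T}\<^sup>*}"

definition monotone_graph ::
  "nat \<Rightarrow> ('m, 'e::euclidean_space) charted_space \<Rightarrow> scomplex \<Rightarrow> nat \<Rightarrow> flip_graph" where
  "monotone_graph d M R n =
    flip_graph d M n \<restriction> (monotone_closure d R \<inter> verts (flip_graph d M n))"

end

theory Submission
  imports Defs
begin

text \<open>
  Bistellar moves preserve the PL homeomorphism type because the two balls exchanged by a move are
  the two halves of the boundary of a simplex. Hence \<open>monotone_closure\<close> consists of triangulations
  of \<open>M\<close>, and since proper moves are reversible, its part with \<open>n\<close> vertices is a union of components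
  of the flip graph. There is only one component, because all facet subdivisions of all
  triangulations in a component are connected to each other by proper moves: subdivisions of two
  facets sharing a ridge differ by two proper moves, any two facets are joined by a chain of such
  pairs, and a proper move commutes with the subdivision of a facet outside its support.
  The combinatorial properties used here (purity, two facets at each ridge, chains of facets) follow
  from invariance of domain and from the fact that finitely many affine subspaces of codimension at
  least 2 do not disconnect a ball.
\<close>

section \<open>Piecewise linear maps\<close>

text \<open>Three features of the definitions shape the proof. \<open>PL_on\<close> asks for
  polytopes, and realizations lie in the infinite-dimensional space of finitely supported functions;
  composing PL maps there rests on affine preimages of polytopes being polytopes. Secondly, nothing
  about links is given, only charts. Links of small simplices are never computed: cofaces are
  counted by writing down explicit maps between stars and Euclidean space and using that injective
  continuous ones are open. Thirdly, arcs of the flip graph and steps of the monotone closure refer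
  to arbitrary members of isomorphism classes, so every move has to be transported to a chosen
  representative, by a bijection of all labels since a subdivision introduces a new one. The
  hypothesis \<open>2 \<le> d\<close> enters where adjacent facets are compared: a ridge then has at
  least two vertices, so the move at it is proper. Levels of the monotone closure are told apart by
  the number of vertices, and each level is compared with one base triangulation obtained by
  repeated subdivision of \<open>R\<close>.\<close>

lemma affine_map_onI:
  assumes "\<And>x y t. x \<in> P \<Longrightarrow> y \<in> P \<Longrightarrow> 0 \<le> t \<Longrightarrow> t \<le> 1 \<Longrightarrow>
    f ((1 - t) *\<^sub>R x + t *\<^sub>R y) = (1 - t) *\<^sub>R f x + t *\<^sub>R f y"
  shows "affine_map_on P f"
  using assms by (auto simp: affine_map_on_def)

lemma affine_map_onD:
  assumes "affine_map_on P f" "x \<in> P" "y \<in> P" "0 \<le> t" "t \<le> 1"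
  shows "f ((1 - t) *\<^sub>R x + t *\<^sub>R y) = (1 - t) *\<^sub>R f x + t *\<^sub>R f y"
  using assms by (auto simp: affine_map_on_def)

lemma affine_map_on_subset: "affine_map_on P f \<Longrightarrow> Q \<subseteq> P \<Longrightarrow> affine_map_on Q f"
  by (auto simp: affine_map_on_def)

lemma affine_map_on_linear: "linear f \<Longrightarrow> affine_map_on P f"
  by (simp add: affine_map_on_def linear_add linear_scale)

lemma affine_map_on_add:
  "affine_map_on P f \<Longrightarrow> affine_map_on P g \<Longrightarrow> affine_map_on P (\<lambda>x. f x + g x)"
  by (simp add: affine_map_on_def scaleR_add_right)

lemma affine_map_on_diff:
  "affine_map_on P f \<Longrightarrow> affine_map_on P g \<Longrightarrow> affine_map_on P (\<lambda>x. f x - g x)"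
  by (simp add: affine_map_on_def scaleR_diff_right)

lemma affine_map_on_scaleR_right:
  assumes "affine_map_on P f" shows "affine_map_on P (\<lambda>x. f x *\<^sub>R a)"
  using assms by (simp add: affine_map_on_def scaleR_add_left)

lemma affine_map_on_cong:
  assumes "convex P" "\<And>x. x \<in> P \<Longrightarrow> f x = g x" "affine_map_on P f"
  shows "affine_map_on P g"
proof (rule affine_map_onI)
  fix x y and t :: real assume *: "x \<in> P" "y \<in> P" "0 \<le> t" "t \<le> 1"
  then have "(1 - t) *\<^sub>R x + t *\<^sub>R y \<in> P"
    using assms(1) by (simp add: convexD)
  then show "g ((1 - t) *\<^sub>R x + t *\<^sub>R y) = (1 - t) *\<^sub>R g x + t *\<^sub>R g y"
    using affine_map_onD[OF assms(3) *] assms(2) * by simp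
qed

lemma affine_map_on_compose:
  assumes "affine_map_on P f" "affine_map_on Q g" "f ` P \<subseteq> Q"
  shows "affine_map_on P (g \<circ> f)"
proof (rule affine_map_onI)
  fix x y and t :: real assume *: "x \<in> P" "y \<in> P" "0 \<le> t" "t \<le> 1"
  then show "(g \<circ> f) ((1 - t) *\<^sub>R x + t *\<^sub>R y) = (1 - t) *\<^sub>R (g \<circ> f) x + t *\<^sub>R (g \<circ> f) y"
    using affine_map_onD[OF assms(1) *] affine_map_onD[OF assms(2), of "f x" "f y" t] assms(3)
    by auto
qed

text \<open>The graph of \<open>f\<close> over \<open>K\<close> is convex, so it contains the convex
  combination of its points \<open>(y i, f (y i))\<close>.\<close>

lemma affine_map_on_sum:
  assumes K: "convex K" "affine_map_on K f"
    and "finite I" "\<And>i. i \<in> I \<Longrightarrow> 0 \<le> u i" "sum u I = 1" "\<And>i. i \<in> I \<Longrightarrow> y i \<in> K"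
  shows "f (\<Sum>i\<in>I. u i *\<^sub>R y i) = (\<Sum>i\<in>I. u i *\<^sub>R f (y i))"
proof -
  let ?G = "(\<lambda>x. (x, f x)) ` K"
  have "convex ?G"
    unfolding convex_alt
  proof (intro ballI allI impI)
    fix p q and t :: real assume "p \<in> ?G" "q \<in> ?G" "0 \<le> t \<and> t \<le> 1"
    then obtain x y where "x \<in> K" "y \<in> K" "p = (x, f x)" "q = (y, f y)" "0 \<le> t" "t \<le> 1" by auto
    then show "(1 - t) *\<^sub>R p + t *\<^sub>R q \<in> ?G"
      using affine_map_onD[OF K(2), of x y t] K(1) by (auto simp: convex_alt intro!: image_eqI)
  qed
  then have "(\<Sum>i\<in>I. u i *\<^sub>R (y i, f (y i))) \<in> ?G"
    using assms by (intro convex_sum) auto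
  then obtain x where "(\<Sum>i\<in>I. u i *\<^sub>R (y i, f (y i))) = (x, f x)" by auto
  then have "(\<Sum>i\<in>I. u i *\<^sub>R y i) = x" "(\<Sum>i\<in>I. u i *\<^sub>R f (y i)) = f x"
    by (metis (no_types, lifting) fst_conv fst_scaleR fst_sum sum.cong,
        metis (no_types, lifting) snd_conv snd_scaleR snd_sum sum.cong)
  then show ?thesis by simp
qed

text \<open>
  The library proves that intersections with half-spaces of polytopes are polytopes only in
  Euclidean spaces, but geometric realizations live in an infinite-dimensional space. A half-space
  cut through the cone from \<open>p\<close> over \<open>convex hull W\<close> is generated by \<open>W\<close> and the
  points where the segments from \<open>p\<close> to \<open>W\<close> meet the hyperplane.
\<close>

lemma halfspace_cone_subset:
  fixes L :: "'a::real_vector \<Rightarrow> real"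
  defines "k \<equiv> \<lambda>p w. - L w / L p"
  assumes K: "convex K" "affine_map_on K L" "p \<in> K" "W \<subseteq> K" "finite W"
    and L: "L p > 0" "\<And>w. w \<in> W \<Longrightarrow> L w \<le> 0"
    and y: "y \<in> convex hull W" and uv: "0 \<le> u" "0 \<le> v" "u + v = 1"
    and x: "L (u *\<^sub>R p + v *\<^sub>R y) \<le> 0"
  shows "u *\<^sub>R p + v *\<^sub>R y \<in>
    convex hull (W \<union> (\<lambda>w. (1 / (1 + k p w)) *\<^sub>R (w + k p w *\<^sub>R p)) ` W)"
proof -
  let ?c = "\<lambda>w. (1 / (1 + k p w)) *\<^sub>R (w + k p w *\<^sub>R p)"
  let ?H = "convex hull (W \<union> ?c ` W)"
  obtain l where l: "\<And>w. w \<in> W \<Longrightarrow> 0 \<le> l w" "sum l W = 1" "y = (\<Sum>w\<in>W. l w *\<^sub>R w)"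
    using y K(5) by (auto simp: convex_hull_finite)
  have k: "k p w \<ge> 0" if "w \<in> W" for w
    using that L by (simp add: k_def divide_nonpos_pos)
  have yK: "y \<in> K"
    using y K by (meson hull_minimal subsetD)
  \<comment> \<open>\<open>B\<close> is the amount of \<open>p\<close> that balances
    \<open>y\<close> on the hyperplane: \<open>v * L y + B * L p = 0\<close>. The given combination
    lies on the nonpositive side, so its amount \<open>u\<close> of \<open>p\<close> is at most
    \<open>B\<close>.\<close>
  define B where "B = (\<Sum>w\<in>W. (v * l w) * k p w)"
  have "L y = (\<Sum>w\<in>W. l w * L w)"
    using affine_map_on_sum[OF K(1,2), of W l "\<lambda>w. w"] l K by auto
  then have Ly: "v * L y = - L p * B"
    using L(1) by (simp add: B_def k_def sum_distrib_left flip: sum_negf) (auto intro: sum.cong)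
  have u: "1 - v = u" "v \<le> 1" using uv by auto
  have "L (u *\<^sub>R p + v *\<^sub>R y) = u * L p + v * L y"
    using affine_map_onD[OF K(2,3) yK uv(2) u(2)] by (simp add: u(1))
  then have "L p * (u - B) \<le> 0"
    using x Ly by (simp add: algebra_simps)
  then have uB: "u \<le> B"
    using L(1) by (simp add: mult_le_0_iff)
  \<comment> \<open>Each \<open>w\<close> receives the same fraction \<open>r\<close> of the share
    \<open>k p w\<close> of \<open>p\<close> that would take it to the hyperplane. Thus
    \<open>z w\<close> lies between \<open>w\<close> and \<open>?c w\<close>, and the
    \<open>a w\<close> are the resulting convex weights. If \<open>B = 0\<close>, then
    \<open>u = 0\<close> as well, and division by zero gives the right value 0.\<close>
  define r where "r = u / B"
  have r: "0 \<le> r" "r \<le> 1" "r * B = u"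
    using uB uv by (auto simp: r_def divide_le_eq)
  define a where "a w = v * l w * (1 + r * k p w)" for w
  define z where "z w = (1 / (1 + r * k p w)) *\<^sub>R (w + (r * k p w) *\<^sub>R p)" for w
  have pos: "1 + r * k p w > 0" "1 + k p w > 0" if "w \<in> W" for w
    using k[OF that] r by (simp_all add: add_pos_nonneg)
  have z: "z w \<in> ?H" if w: "w \<in> W" for w
  proof -
    let ?s = "1 + r * k p w"
    have "((1 - r) / ?s) *\<^sub>R w + (r * (1 + k p w) / ?s) *\<^sub>R ?c w \<in> ?H"
    proof (rule convexD)
      show "(1 - r) / ?s + r * (1 + k p w) / ?s = 1"
      proof -
        have "(1 - r) + r * (1 + k p w) = ?s" by (simp add: algebra_simps)
        then show ?thesis using pos[OF w] by (simp flip: add_divide_distrib)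
      qed
    qed (use r k[OF w] pos[OF w] w in \<open>auto intro!: hull_inc divide_nonneg_pos mult_nonneg_nonneg\<close>)
    also have "((1 - r) / ?s) *\<^sub>R w + (r * (1 + k p w) / ?s) *\<^sub>R ?c w
        = ((1 - r) / ?s + r / ?s) *\<^sub>R w + (r * k p w / ?s) *\<^sub>R p"
      using pos[OF w] by (simp add: scaleR_add_right scaleR_add_left)
    also have "\<dots> = z w"
      by (simp add: z_def scaleR_add_right flip: add_divide_distrib)
    finally show ?thesis .
  qed
  have "sum a W = v * sum l W + r * B"
    by (simp add: a_def B_def algebra_simps sum.distrib sum_distrib_left)
  then have a1: "sum a W = 1"
    using l r uv by simp
  have "(\<Sum>w\<in>W. a w *\<^sub>R z w) \<in> ?H"
    by (rule convex_sum) (use a1 z pos l k r uv K(5) in \<open>auto simp: a_def less_imp_le\<close>)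
  also have "(\<Sum>w\<in>W. a w *\<^sub>R z w) = (\<Sum>w\<in>W. (v * l w) *\<^sub>R w + (v * l w * (r * k p w)) *\<^sub>R p)"
    by (intro sum.cong) (use pos in \<open>auto simp: a_def z_def scaleR_add_right less_imp_neq[symmetric]\<close>)
  also have "\<dots> = v *\<^sub>R y + (r * B) *\<^sub>R p"
    by (simp add: sum.distrib l(3) scaleR_sum_right B_def sum_distrib_left
        scaleR_sum_left algebra_simps)
  finally show ?thesis
    using r by (simp add: add.commute)
qed

text \<open>The vertices with \<open>L > 0\<close> are added one at a time to those with
  \<open>L \<le> 0\<close>. The induction maintains a finite set \<open>W\<close> in the half-space
  that generates the part of the current hull lying there; each new vertex \<open>p\<close> is the
  apex of a cone over that hull.\<close>

lemma polytope_halfspace: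
  fixes L :: "'a::real_vector \<Rightarrow> real"
  assumes "polytope K" and L: "affine_map_on K L"
  shows "polytope {x \<in> K. L x \<le> 0}"
proof -
  obtain V where V: "finite V" "K = convex hull V"
    using assms(1) by (auto simp: polytope_def)
  have K: "convex K" "V \<subseteq> K"
    using V by (auto simp: hull_subset)
  define N where "N = {v \<in> V. L v \<le> 0}"
  define P where "P = {v \<in> V. L v > 0}"
  have "finite P" "finite N" using V by (auto simp: P_def N_def)
  have "\<exists>W. finite W \<and> W \<subseteq> K \<and> (\<forall>w\<in>W. L w \<le> 0) \<and> {x \<in> convex hull (N \<union> P'). L x \<le> 0} \<subseteq> convex hull W"
    if "P' \<subseteq> P" for P'
    using finite_subset[OF that \<open>finite P\<close>] that
  proof (induction P' rule: finite_induct)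
    case empty
    then show ?case
      using K \<open>finite N\<close> by (intro exI[of _ N]) (auto simp: N_def)
  next
    case (insert p P')
    then obtain W where W: "finite W" "W \<subseteq> K" "\<And>w. w \<in> W \<Longrightarrow> L w \<le> 0"
      "{x \<in> convex hull (N \<union> P'). L x \<le> 0} \<subseteq> convex hull W" by auto
    have p: "p \<in> K" "L p > 0"
      using insert.prems K by (auto simp: P_def)
    let ?k = "\<lambda>p w. - L w / L p"
    let ?W = "W \<union> (\<lambda>w. (1 / (1 + ?k p w)) *\<^sub>R (w + ?k p w *\<^sub>R p)) ` W"
    have k: "?k p w \<ge> 0" if "w \<in> W" for w
      using W(3)[OF that] p by (simp add: divide_nonpos_pos)
    have "?W \<subseteq> {x \<in> K. L x \<le> 0}"
    proof (clarsimp simp only: Un_subset_iff, intro conjI)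
      show "W \<subseteq> {x \<in> K. L x \<le> 0}" using W by auto
      show "(\<lambda>w. (1 / (1 + ?k p w)) *\<^sub>R (w + ?k p w *\<^sub>R p)) ` W \<subseteq> {x \<in> K. L x \<le> 0}"
      proof clarify
        fix w assume w: "w \<in> W"
        \<comment> \<open>The parameter at which the segment from \<open>w\<close> to
          \<open>p\<close> meets \<open>L = 0\<close>.\<close>
        define t where "t = ?k p w / (1 + ?k p w)"
        have pos: "1 + ?k p w > 0" using k[OF w] by linarith
        have "0 \<le> c / (1 + c)" "c / (1 + c) \<le> 1" "1 - c / (1 + c) = 1 / (1 + c)"
          if "0 \<le> c" for c :: real
          using that by (auto simp: divide_simps)
        from this[OF k[OF w]] have t: "0 \<le> t" "t \<le> 1" "1 - t = 1 / (1 + ?k p w)"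
          by (simp_all only: t_def)
        have wp: "w \<in> K" using w W by auto
        have eq: "(1 / (1 + ?k p w)) *\<^sub>R (w + ?k p w *\<^sub>R p) = (1 - t) *\<^sub>R w + t *\<^sub>R p"
          unfolding t(3) by (simp add: t_def scaleR_diff_right mult.commute)
        have "L ((1 - t) *\<^sub>R w + t *\<^sub>R p) = (1 - t) * L w + t * L p"
          using affine_map_onD[OF L wp p(1) t(1,2)] by simp
        also have "\<dots> = (L w + ?k p w * L p) / (1 + ?k p w)"
          unfolding t(3) by (simp add: t_def add_divide_distrib)
        also have "\<dots> = 0" using p by simp
        finally show "(1 / (1 + ?k p w)) *\<^sub>R (w + ?k p w *\<^sub>R p) \<in> K \<and>
            L ((1 / (1 + ?k p w)) *\<^sub>R (w + ?k p w *\<^sub>R p)) \<le> 0"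
          unfolding eq using convexD_alt[OF K(1) wp p(1) t(1,2)] by simp
      qed
    qed
    moreover have "x \<in> convex hull ?W"
      if x: "x \<in> convex hull (N \<union> insert p P')" "L x \<le> 0" for x
    proof (cases "N \<union> P' = {}")
      case True
      then show ?thesis using x p by simp
    next
      case False
      have "x \<in> convex hull (insert p (N \<union> P'))" using x by simp
      then obtain u v y where uv: "0 \<le> u" "0 \<le> v" "u + v = 1" and y: "y \<in> convex hull (N \<union> P')"
        and xy: "x = u *\<^sub>R p + v *\<^sub>R y"
        unfolding convex_hull_insert[OF False] by auto
      have "N \<union> P' \<subseteq> V" using insert.prems by (auto simp: N_def P_def)
      then have yK: "y \<in> K" using y V hull_mono by blast
      have u: "1 - v = u" "v \<le> 1" using uv by auto
      have "L x = u * L p + v * L y"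
        using affine_map_onD[OF L p(1) yK uv(2) u(2)] by (simp add: u(1) xy)
      \<comment> \<open>Otherwise \<open>L x\<close> would be positive, being a convex combination
        of \<open>L p > 0\<close> and \<open>L y\<close>. Hence \<open>y\<close> lies in the part
        already generated by \<open>W\<close>.\<close>
      then have "L y \<le> 0"
        using x p uv
        by (smt (verit, best) mult_nonneg_nonneg mult_pos_pos)
      then have "y \<in> convex hull W" using W y by auto
      then show ?thesis
        using halfspace_cone_subset[OF K(1) L p(1) W(2,1) p(2) W(3) _ uv, of y] x xy by simp
    qed
    ultimately show ?case
      using W(1) by (intro exI[of _ ?W]) blast
  qed
  from this[OF subset_refl] obtain W where "finite W \<and> W \<subseteq> K \<and> (\<forall>w\<in>W. L w \<le> 0) \<and>
      {x \<in> convex hull (N \<union> P). L x \<le> 0} \<subseteq> convex hull W"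
    by (elim exE)
  then have W: "finite W" "W \<subseteq> K" "\<And>w. w \<in> W \<Longrightarrow> L w \<le> 0"
    "{x \<in> convex hull (N \<union> P). L x \<le> 0} \<subseteq> convex hull W" by auto
  have "N \<union> P = V" by (auto simp: N_def P_def)
  have "convex {x \<in> K. L x \<le> 0}"
    unfolding convex_alt
  proof (intro ballI allI impI)
    fix x y and t :: real
    assume *: "x \<in> {x \<in> K. L x \<le> 0}" "y \<in> {x \<in> K. L x \<le> 0}" "0 \<le> t \<and> t \<le> 1"
    then have "L ((1 - t) *\<^sub>R x + t *\<^sub>R y) = (1 - t) * L x + t * L y"
      using affine_map_onD[OF L, of x y t] by simp
    also have "\<dots> \<le> 0" using * by (simp add: add_nonpos_nonpos mult_nonneg_nonpos)
    finally show "(1 - t) *\<^sub>R x + t *\<^sub>R y \<in> {x \<in> K. L x \<le> 0}"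
      using * K(1) by (simp add: convexD_alt)
  qed
  then have "convex hull W \<subseteq> {x \<in> K. L x \<le> 0}"
    using W by (intro hull_minimal) auto
  then have "{x \<in> K. L x \<le> 0} = convex hull W"
    using W(4) V \<open>N \<union> P = V\<close> by auto
  then show ?thesis using W(1) by (auto simp: polytope_def)
qed

lemma polytope_halfspaces:
  fixes L :: "'i \<Rightarrow> 'a::real_vector \<Rightarrow> real"
  assumes "finite I" "polytope K" "\<And>i. i \<in> I \<Longrightarrow> affine_map_on K (L i)"
  shows "polytope {x \<in> K. \<forall>i\<in>I. L i x \<le> 0}"
  using assms
proof (induction I rule: finite_induct)
  case (insert j J)
  have "polytope {x \<in> {x \<in> K. \<forall>i\<in>J. L i x \<le> 0}. L j x \<le> 0}"
    using insert by (intro polytope_halfspace) (auto intro: affine_map_on_subset)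
  also have "{x \<in> {x \<in> K. \<forall>i\<in>J. L i x \<le> 0}. L j x \<le> 0} = {x \<in> K. \<forall>i\<in>insert j J. L i x \<le> 0}"
    by auto
  finally show ?case .
qed auto

section \<open>Coordinates, affine preimages of polytopes and composition of PL maps\<close>

lemma lookup_scaleR [simp]:
  fixes x :: "'k \<Rightarrow>\<^sub>0 'b::real_vector"
  shows "Poly_Mapping.lookup (r *\<^sub>R x) i = r *\<^sub>R Poly_Mapping.lookup x i"
proof -
  have "finite {i. r *\<^sub>R Poly_Mapping.lookup x i \<noteq> 0}"
    by (rule finite_subset[OF _ finite_lookup[of x]]) auto
  then show ?thesis
    by (simp add: scaleR_poly_mapping_def Abs_poly_mapping_inverse)
qed

lemma linear_lookup: "linear (\<lambda>x :: 'k \<Rightarrow>\<^sub>0 'b::real_vector. Poly_Mapping.lookup x i)"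
  by (rule linearI) (simp_all add: lookup_add)

lemma convex_keys_subset: "convex {x :: 'k \<Rightarrow>\<^sub>0 'b::real_vector. Poly_Mapping.keys x \<subseteq> I}"
  by (auto simp: convex_def in_keys_iff lookup_add subset_iff) (metis add_0 scaleR_zero_right)

text \<open>The preimage is the projection to \<open>P\<close> of the pairs \<open>(x, y)\<close> in
  \<open>P \<times> Q\<close> with \<open>f x = y\<close>. Finitely many coordinates
  \<open>I\<close> support both \<open>Q\<close> and the image of \<open>P\<close>, so this equation
  amounts to finitely many pairs of opposite half-spaces.\<close>

lemma polytope_vimage:
  fixes f :: "'a::real_vector \<Rightarrow> 'k \<Rightarrow>\<^sub>0 real"
  assumes P: "polytope P" and f: "affine_map_on P f" and Q: "polytope Q"
  shows "polytope {x \<in> P. f x \<in> Q}"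
proof -
  obtain V where V: "finite V" "P = convex hull V" using P by (auto simp: polytope_def)
  obtain W where W: "finite W" "Q = convex hull W" using Q by (auto simp: polytope_def)
  define I where "I = (\<Union>v\<in>V. Poly_Mapping.keys (f v)) \<union> (\<Union>w\<in>W. Poly_Mapping.keys w)"
  have "finite I" using V W by (simp add: I_def)
  have keysQ: "Poly_Mapping.keys y \<subseteq> I" if "y \<in> Q" for y
    using that hull_minimal[of W "{x. Poly_Mapping.keys x \<subseteq> I}" convex] convex_keys_subset[of I] W by (auto simp: I_def)
  have keysP: "Poly_Mapping.keys (f x) \<subseteq> I" if x: "x \<in> P" for x
  proof -
    obtain u where u: "\<And>v. v \<in> V \<Longrightarrow> 0 \<le> u v" "sum u V = 1" "x = (\<Sum>v\<in>V. u v *\<^sub>R v)"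
      using x V by (auto simp: convex_hull_finite)
    then have "f x = (\<Sum>v\<in>V. u v *\<^sub>R f v)"
      using affine_map_on_sum[of P f V u "\<lambda>v. v"] f V by (simp add: hull_inc)
    moreover have "(\<Sum>v\<in>V. u v *\<^sub>R f v) \<in> {y. Poly_Mapping.keys y \<subseteq> I}"
      by (rule convex_sum) (use u V in \<open>auto simp: I_def intro!: convex_keys_subset\<close>)
    ultimately show ?thesis by simp
  qed
  let ?L = "\<lambda>i z. Poly_Mapping.lookup (f (fst z)) i - Poly_Mapping.lookup (snd z) i"
  have fst: "affine_map_on (P \<times> Q) (\<lambda>z. Poly_Mapping.lookup (f (fst z)) i)" for i
    using affine_map_on_compose[OF
        affine_map_on_compose[OF affine_map_on_linear[OF linear_fst, of "P \<times> Q"] f]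
        affine_map_on_linear[OF linear_lookup, of UNIV i]]
    by (auto simp: o_def)
  have snd: "affine_map_on (P \<times> Q) (\<lambda>z. Poly_Mapping.lookup (snd z) i)" for i
    using affine_map_on_compose[OF affine_map_on_linear[OF linear_snd, of "P \<times> Q"]
        affine_map_on_linear[OF linear_lookup, of UNIV i]]
    by (auto simp: o_def)
  let ?K = "{z \<in> P \<times> Q. \<forall>i\<in>I. ?L i z \<le> 0}"
  have K: "polytope ?K"
    by (intro polytope_halfspaces \<open>finite I\<close> polytope_Times P Q affine_map_on_diff fst snd)
  then have "polytope {z \<in> ?K. \<forall>i\<in>I. - ?L i z \<le> 0}"
    by (intro polytope_halfspaces \<open>finite I\<close> K)
      (auto intro!: affine_map_on_diff affine_map_on_subset[OF fst] affine_map_on_subset[OF snd])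
  then have "polytope (fst ` {z \<in> ?K. \<forall>i\<in>I. - ?L i z \<le> 0})"
    by (intro polytope_linear_image linear_fst)
  also have "fst ` {z \<in> ?K. \<forall>i\<in>I. - ?L i z \<le> 0} = {x \<in> P. f x \<in> Q}"
  proof (intro set_eqI iffI)
    fix x assume "x \<in> fst ` {z \<in> ?K. \<forall>i\<in>I. - ?L i z \<le> 0}"
    then obtain y where y: "x \<in> P" "y \<in> Q" "\<forall>i\<in>I. ?L i (x, y) \<le> 0" "\<forall>i\<in>I. - ?L i (x, y) \<le> 0"
      by auto
    have "Poly_Mapping.lookup (f x) i = Poly_Mapping.lookup y i" for i
    proof (cases "i \<in> I")
      case True
      then show ?thesis using y(3,4) by fastforce
    next
      case False
      then show ?thesis
        using keysP[OF y(1)] keysQ[OF y(2)] by (metis in_keys_iff subsetD)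
    qed
    then have "f x = y" by (simp add: poly_mapping_eqI)
    then show "x \<in> {x \<in> P. f x \<in> Q}" using y by simp
  next
    fix x assume "x \<in> {x \<in> P. f x \<in> Q}"
    then show "x \<in> fst ` {z \<in> ?K. \<forall>i\<in>I. - ?L i z \<le> 0}"
      by (intro image_eqI[of _ _ "(x, f x)"]) auto
  qed
  finally show ?thesis .
qed

lemma PL_onE:
  assumes "PL_on X f" "x \<in> X"
  obtains \<P> N where "finite \<P>" "\<forall>P\<in>\<P>. polytope P \<and> P \<subseteq> X \<and> affine_map_on P f"
    "openin (top_of_set X) N" "x \<in> N" "N \<subseteq> \<Union>\<P>"
proof -
  obtain \<P> N where "finite \<P> \<and> (\<forall>P\<in>\<P>. polytope P \<and> P \<subseteq> X \<and> affine_map_on P f) \<and>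
      openin (top_of_set X) N \<and> x \<in> N \<and> N \<subseteq> \<Union>\<P>"
    using bspec[OF assms(1)[unfolded PL_on_def] assms(2)] by (elim exE)
  then show thesis by (intro that) auto
qed

lemma PL_on_cong:
  assumes "PL_on X f" "\<And>x. x \<in> X \<Longrightarrow> f x = g x"
  shows "PL_on X g"
  unfolding PL_on_def
proof
  fix x assume "x \<in> X"
  from assms(1) this obtain \<P> N where *: "finite \<P>"
    "\<forall>P\<in>\<P>. polytope P \<and> P \<subseteq> X \<and> affine_map_on P f"
    "openin (top_of_set X) N" "x \<in> N" "N \<subseteq> \<Union>\<P>"
    by (rule PL_onE)
  have "\<forall>P\<in>\<P>. affine_map_on P g"
  proof
    fix P assume "P \<in> \<P>"
    with *(2) have P: "polytope P" "P \<subseteq> X" "affine_map_on P f" by simp_all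
    show "affine_map_on P g"
      by (rule affine_map_on_cong[OF polytope_imp_convex[OF P(1)] _ P(3)]) (use P(2) assms(2) in auto)
  qed
  then show "\<exists>\<P> N. finite \<P> \<and> (\<forall>P\<in>\<P>. polytope P \<and> P \<subseteq> X \<and> affine_map_on P g) \<and>
       openin (top_of_set X) N \<and> x \<in> N \<and> N \<subseteq> \<Union>\<P>"
    using * by blast
qed

text \<open>The pieces for \<open>f\<close> are refined by the preimages of the pieces for
  \<open>g\<close>. Continuity of \<open>f\<close> pulls back the neighbourhood that the pieces for
  \<open>g\<close> cover.\<close>

lemma PL_on_compose:
  fixes f :: "'a::real_normed_vector \<Rightarrow> 'k \<Rightarrow>\<^sub>0 real"
  assumes f: "PL_on X f" "continuous_on X f" and g: "PL_on Y g"
  shows "PL_on {x \<in> X. f x \<in> Y} (g \<circ> f)"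
  unfolding PL_on_def
proof
  fix x assume x: "x \<in> {x \<in> X. f x \<in> Y}"
  have x': "x \<in> X" "f x \<in> Y" using x by auto
  from f(1) x'(1) obtain \<P> N where P: "finite \<P>" "\<forall>P\<in>\<P>. polytope P \<and> P \<subseteq> X \<and> affine_map_on P f"
    and N: "openin (top_of_set X) N" "x \<in> N" "N \<subseteq> \<Union>\<P>"
    by (rule PL_onE)
  from g x'(2) obtain \<Q> N' where Q: "finite \<Q>" "\<forall>Q\<in>\<Q>. polytope Q \<and> Q \<subseteq> Y \<and> affine_map_on Q g"
    and N': "openin (top_of_set Y) N'" "f x \<in> N'" "N' \<subseteq> \<Union>\<Q>"
    by (rule PL_onE)
  let ?p = "\<lambda>(P, Q). {x \<in> P. f x \<in> Q}"
  obtain A where A: "open A" "N = X \<inter> A" using N(1) by (meson openin_open)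
  obtain B where B: "open B" "N' = Y \<inter> B" using N'(1) by (meson openin_open)
  obtain C where C: "open C" "X \<inter> f -` B = X \<inter> C"
    using f(2) B(1) by (metis continuous_openin_preimage_gen openin_open)
  show "\<exists>\<P> N. finite \<P> \<and>
      (\<forall>P\<in>\<P>. polytope P \<and> P \<subseteq> {x \<in> X. f x \<in> Y} \<and> affine_map_on P (g \<circ> f)) \<and>
      openin (top_of_set {x \<in> X. f x \<in> Y}) N \<and> x \<in> N \<and> N \<subseteq> \<Union>\<P>"
  proof (intro exI[of _ "?p ` (\<P> \<times> \<Q>)"] exI[of _ "{x \<in> X. f x \<in> Y} \<inter> (A \<inter> C)"] conjI ballI)
    show "finite (?p ` (\<P> \<times> \<Q>))" using P Q by simp
    show "openin (top_of_set {x \<in> X. f x \<in> Y}) ({x \<in> X. f x \<in> Y} \<inter> (A \<inter> C))"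
      using A C by (simp add: openin_open_Int open_Int)
    show "x \<in> {x \<in> X. f x \<in> Y} \<inter> (A \<inter> C)" using x N A C N' B by auto
    show "{x \<in> X. f x \<in> Y} \<inter> (A \<inter> C) \<subseteq> \<Union> (?p ` (\<P> \<times> \<Q>))"
    proof
      fix z assume z: "z \<in> {x \<in> X. f x \<in> Y} \<inter> (A \<inter> C)"
      then have "z \<in> N" "f z \<in> N'" using A B C by auto
      then obtain P Q where "P \<in> \<P>" "z \<in> P" "Q \<in> \<Q>" "f z \<in> Q" using N N' by blast
      then show "z \<in> \<Union> (?p ` (\<P> \<times> \<Q>))" by (auto intro!: bexI[of _ "(P, Q)"])
    qed
  next
    fix R assume "R \<in> ?p ` (\<P> \<times> \<Q>)"
    then obtain P' Q' where R: "R = {x \<in> P'. f x \<in> Q'}" "P' \<in> \<P>" "Q' \<in> \<Q>" by auto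
    show "polytope R" using R P Q polytope_vimage by blast
    show "R \<subseteq> {x \<in> X. f x \<in> Y}" using R P Q by blast
    show "affine_map_on R (g \<circ> f)"
      using R P Q by (intro affine_map_on_compose[of R f Q' g]) (auto intro: affine_map_on_subset)
  qed
qed

section \<open>Geometric realizations\<close>

abbreviation unit_vec :: "nat \<Rightarrow> nat \<Rightarrow>\<^sub>0 real" where
  "unit_vec v \<equiv> Poly_Mapping.single v 1"

abbreviation std_simplex :: "nat set \<Rightarrow> (nat \<Rightarrow>\<^sub>0 real) set" where
  "std_simplex \<sigma> \<equiv> convex hull (unit_vec ` \<sigma>)"

lemma lookup_unit_vec [simp]: "Poly_Mapping.lookup (unit_vec v) i = (if i = v then 1 else 0)"
  by (auto simp: lookup_single)

lemma inj_unit_vec: "inj unit_vec"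
  by (rule injI) (metis lookup_unit_vec zero_neq_one)

lemma mem_simplex_iff:
  assumes "finite \<sigma>"
  shows "x \<in> std_simplex \<sigma> \<longleftrightarrow> Poly_Mapping.keys x \<subseteq> \<sigma> \<and> (\<forall>v. 0 \<le> Poly_Mapping.lookup x v) \<and>
    sum (Poly_Mapping.lookup x) \<sigma> = 1"
proof
  assume "x \<in> std_simplex \<sigma>"
  then obtain u where u: "\<forall>y\<in>unit_vec ` \<sigma>. 0 \<le> u y" "sum u (unit_vec ` \<sigma>) = 1"
    "(\<Sum>y\<in>unit_vec ` \<sigma>. u y *\<^sub>R y) = x"
    using assms by (auto simp: convex_hull_finite)
  have inj: "inj_on unit_vec \<sigma>" using inj_unit_vec by (rule inj_on_subset) simp
  have x: "x = (\<Sum>v\<in>\<sigma>. u (unit_vec v) *\<^sub>R unit_vec v)"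
    unfolding u(3)[symmetric] by (subst sum.reindex[OF inj]) simp
  have c: "Poly_Mapping.lookup x i = (if i \<in> \<sigma> then u (unit_vec i) else 0)" for i
    unfolding x using assms by (simp add: lookup_sum if_distrib cong: if_cong)
  have "sum (Poly_Mapping.lookup x) \<sigma> = sum u (unit_vec ` \<sigma>)"
    by (subst sum.reindex[OF inj]) (simp add: c)
  then show "Poly_Mapping.keys x \<subseteq> \<sigma> \<and> (\<forall>v. 0 \<le> Poly_Mapping.lookup x v) \<and>
      sum (Poly_Mapping.lookup x) \<sigma> = 1"
    using u c by (auto simp: in_keys_iff split: if_splits)
next
  assume *: "Poly_Mapping.keys x \<subseteq> \<sigma> \<and> (\<forall>v. 0 \<le> Poly_Mapping.lookup x v) \<and>
      sum (Poly_Mapping.lookup x) \<sigma> = 1"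
  have "x = (\<Sum>v\<in>\<sigma>. Poly_Mapping.lookup x v *\<^sub>R unit_vec v)"
  proof (rule poly_mapping_eqI)
    fix i
    show "Poly_Mapping.lookup x i = Poly_Mapping.lookup (\<Sum>v\<in>\<sigma>. Poly_Mapping.lookup x v *\<^sub>R unit_vec v) i"
      using assms * by (auto simp: lookup_sum if_distrib in_keys_iff cong: if_cong)
  qed
  moreover have "(\<Sum>v\<in>\<sigma>. Poly_Mapping.lookup x v *\<^sub>R unit_vec v) \<in> std_simplex \<sigma>"
    by (rule convex_sum) (use * assms in \<open>auto intro: hull_inc\<close>)
  ultimately show "x \<in> std_simplex \<sigma>" by simp
qed

lemma simplicial_complexD:
  assumes "simplicial_complex S"
  shows "finite S" "{} \<in> S" "\<sigma> \<in> S \<Longrightarrow> finite \<sigma>" "\<sigma> \<in> S \<Longrightarrow> \<tau> \<subseteq> \<sigma> \<Longrightarrow> \<tau> \<in> S"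
  using assms by (auto simp: simplicial_complex_def)

lemma finite_vertices: "simplicial_complex S \<Longrightarrow> finite (vertices S)"
  by (auto simp: simplicial_complex_def)

lemma vertex_iff: "simplicial_complex S \<Longrightarrow> v \<in> vertices S \<longleftrightarrow> {v} \<in> S"
  using simplicial_complexD(4)[of S _ "{v}"] by auto

text \<open>The support \<open>keys x\<close> is the smallest simplex containing \<open>x\<close>,
  so questions about points of a realization become questions about membership of vertex sets in the
  complex.\<close>

lemma mem_geometric_realization_iff:
  assumes "simplicial_complex S"
  shows "x \<in> geometric_realization S \<longleftrightarrow> Poly_Mapping.keys x \<in> S \<and>
    (\<forall>v. 0 \<le> Poly_Mapping.lookup x v) \<and> sum (Poly_Mapping.lookup x) (Poly_Mapping.keys x) = 1"
proof
  assume "x \<in> geometric_realization S"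
  then obtain \<sigma> where \<sigma>: "\<sigma> \<in> S" "x \<in> std_simplex \<sigma>" by (auto simp: geometric_realization_def)
  have fin: "finite \<sigma>" using assms \<sigma> simplicial_complexD by blast
  have "sum (Poly_Mapping.lookup x) (Poly_Mapping.keys x) = sum (Poly_Mapping.lookup x) \<sigma>"
    by (rule sum.mono_neutral_left) (use \<sigma> fin in \<open>auto simp: mem_simplex_iff in_keys_iff\<close>)
  then show "Poly_Mapping.keys x \<in> S \<and>
    (\<forall>v. 0 \<le> Poly_Mapping.lookup x v) \<and> sum (Poly_Mapping.lookup x) (Poly_Mapping.keys x) = 1"
    using \<sigma> fin simplicial_complexD(4)[OF assms \<sigma>(1)] by (auto simp: mem_simplex_iff)
next
  assume *: "Poly_Mapping.keys x \<in> S \<and>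
    (\<forall>v. 0 \<le> Poly_Mapping.lookup x v) \<and> sum (Poly_Mapping.lookup x) (Poly_Mapping.keys x) = 1"
  then have "x \<in> std_simplex (Poly_Mapping.keys x)" by (simp add: mem_simplex_iff)
  then show "x \<in> geometric_realization S" using * by (auto simp: geometric_realization_def)
qed

lemma simplex_subset_realization: "\<sigma> \<in> S \<Longrightarrow> std_simplex \<sigma> \<subseteq> geometric_realization S"
  by (auto simp: geometric_realization_def)

lemma sum_lookup_superset:
  fixes x :: "nat \<Rightarrow>\<^sub>0 real"
  assumes "finite A" "Poly_Mapping.keys x \<subseteq> A"
  shows "sum (Poly_Mapping.lookup x) (Poly_Mapping.keys x) = sum (Poly_Mapping.lookup x) A"
  by (rule sum.mono_neutral_left) (use assms in \<open>auto simp: in_keys_iff\<close>)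

lemma bounded_linear_lookup:
  "bounded_linear (\<lambda>x :: nat \<Rightarrow>\<^sub>0 real. Poly_Mapping.lookup x i)"
proof (rule bounded_linear_intro[where K = 1])
  fix x :: "nat \<Rightarrow>\<^sub>0 real"
  have "\<bar>Poly_Mapping.lookup x i\<bar> \<le> (\<Sum>n\<in>Poly_Mapping.keys x. \<bar>Poly_Mapping.lookup x n\<bar>)"
  proof (cases "i \<in> Poly_Mapping.keys x")
    case True
    then show ?thesis by (intro member_le_sum) auto
  qed (simp add: in_keys_iff sum_nonneg)
  also have "\<dots> = norm x"
    by (simp add: norm_poly_mapping_def dist_poly_mapping_def)
  finally show "norm (Poly_Mapping.lookup x i) \<le> norm x * 1" by simp
qed (simp_all add: lookup_add)

lemma continuous_on_lookup [continuous_intros]: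
  fixes f :: "'a::topological_space \<Rightarrow> nat \<Rightarrow>\<^sub>0 real"
  assumes "continuous_on X f"
  shows "continuous_on X (\<lambda>x. Poly_Mapping.lookup (f x) i)"
  by (rule bounded_linear.continuous_on[OF bounded_linear_lookup assms])

section \<open>Flips of simplicial complexes\<close>

definition flip :: "nat set \<Rightarrow> nat set \<Rightarrow> scomplex \<Rightarrow> scomplex" where
  "flip \<alpha> \<beta> S = (S - join (Pow \<alpha>) (boundary \<beta>)) \<union> join (boundary \<alpha>) (Pow \<beta>)"

text \<open>The cardinality conditions are left out so that subdivisions, proper moves and their
  inverses are treated alike. Finiteness of \<beta>, which a move gets from a positive
  \<open>card\<close>, is stated in their place.\<close>

definition flippable :: "nat set \<Rightarrow> nat set \<Rightarrow> scomplex \<Rightarrow> bool" where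
  "flippable \<alpha> \<beta> S \<longleftrightarrow> simplicial_complex S \<and> finite \<beta> \<and> \<alpha> \<in> S \<and> \<beta> \<notin> S \<and> \<alpha> \<noteq> {} \<and> \<beta> \<noteq> {} \<and>
    \<alpha> \<inter> \<beta> = {} \<and> link S \<alpha> = boundary \<beta>"

lemma bistellar_move_iff_flip:
  assumes "simplicial_complex S" "0 < p"
  shows "bistellar_move d p q S T \<longleftrightarrow>
    (\<exists>\<alpha> \<beta>. flippable \<alpha> \<beta> S \<and> card \<beta> = p \<and> card \<alpha> = q \<and> p + q = d + 2 \<and> T = flip \<alpha> \<beta> S)"
  unfolding bistellar_move_def flippable_def flip_def using assms
  by (intro ex_cong1) (auto intro: card_ge_0_finite)

lemma join_Pow_boundary:
  assumes "\<alpha> \<inter> \<beta> = {}"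
  shows "join (Pow \<alpha>) (boundary \<beta>) = {\<sigma>. \<sigma> \<subseteq> \<alpha> \<union> \<beta> \<and> \<not> \<beta> \<subseteq> \<sigma>}"
proof (intro equalityI subsetI)
  fix \<sigma> assume "\<sigma> \<in> {\<sigma>. \<sigma> \<subseteq> \<alpha> \<union> \<beta> \<and> \<not> \<beta> \<subseteq> \<sigma>}"
  then have "\<sigma> = (\<sigma> \<inter> \<alpha>) \<union> (\<sigma> \<inter> \<beta>)" "\<sigma> \<inter> \<alpha> \<in> Pow \<alpha>" "\<sigma> \<inter> \<beta> \<in> boundary \<beta>"
    by (auto simp: boundary_def)
  then show "\<sigma> \<in> join (Pow \<alpha>) (boundary \<beta>)"
    unfolding join_def by blast
qed (use assms in \<open>auto simp: join_def boundary_def\<close>)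

lemma join_boundary_Pow:
  assumes "\<alpha> \<inter> \<beta> = {}"
  shows "join (boundary \<alpha>) (Pow \<beta>) = {\<sigma>. \<sigma> \<subseteq> \<alpha> \<union> \<beta> \<and> \<not> \<alpha> \<subseteq> \<sigma>}"
proof -
  have "join (boundary \<alpha>) (Pow \<beta>) = join (Pow \<beta>) (boundary \<alpha>)"
    by (auto simp: join_def)
  then show ?thesis
    using join_Pow_boundary[of \<beta> \<alpha>] assms by (simp add: Un_commute Int_commute)
qed

lemma flippableD:
  assumes "flippable \<alpha> \<beta> S"
  shows "simplicial_complex S" "finite \<alpha>" "finite \<beta>" "\<alpha> \<in> S" "\<beta> \<notin> S" "\<alpha> \<noteq> {}" "\<beta> \<noteq> {}"
    "\<alpha> \<inter> \<beta> = {}" "link S \<alpha> = boundary \<beta>"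
  using assms by (auto simp: flippable_def dest: simplicial_complexD)

lemma flippable_star:
  assumes "flippable \<alpha> \<beta> S" "\<sigma> \<in> S" "\<alpha> \<subseteq> \<sigma>"
  shows "\<sigma> \<subseteq> \<alpha> \<union> \<beta>"
proof -
  note S = flippableD[OF assms(1)]
  have "\<sigma> - \<alpha> \<in> link S \<alpha>"
    using assms simplicial_complexD(4)[OF S(1) assms(2)] by (auto simp: link_def Un_absorb2)
  then show ?thesis by (auto simp: S boundary_def)
qed

lemma flippable_not_subset: "flippable \<alpha> \<beta> S \<Longrightarrow> \<sigma> \<in> S \<Longrightarrow> \<not> \<beta> \<subseteq> \<sigma>"
  by (meson flippableD simplicial_complexD(4))

lemma flippable_ball:
  assumes "flippable \<alpha> \<beta> S" "\<sigma> \<subseteq> \<alpha> \<union> \<beta>" "\<not> \<beta> \<subseteq> \<sigma>"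
  shows "\<sigma> \<in> S"
proof -
  note S = flippableD[OF assms(1)]
  have "\<sigma> \<inter> \<beta> \<in> link S \<alpha>" using assms by (auto simp: S boundary_def)
  then have "\<sigma> \<inter> \<beta> \<union> \<alpha> \<in> S" by (simp add: link_def)
  then show ?thesis using assms(2) by (auto intro: simplicial_complexD(4)[OF S(1)])
qed

text \<open>By the link condition, simplices of \<open>S\<close> above \<alpha> lie in \<alpha>
  \<union> \<beta> and are removed for good, while removed simplices not containing \<alpha> are put
  back. All later computations with flips reduce to this Boolean criterion.\<close>

lemma mem_flip_iff:
  assumes "flippable \<alpha> \<beta> S"
  shows "\<sigma> \<in> flip \<alpha> \<beta> S \<longleftrightarrow> \<not> \<alpha> \<subseteq> \<sigma> \<and> (\<sigma> \<in> S \<or> \<sigma> \<subseteq> \<alpha> \<union> \<beta>)"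
  using flippable_star[OF assms, of \<sigma>] flippable_not_subset[OF assms, of \<sigma>]
  unfolding flip_def join_Pow_boundary[OF flippableD(8)[OF assms]]
    join_boundary_Pow[OF flippableD(8)[OF assms]]
  by blast

lemma simplicial_complex_flip:
  assumes "flippable \<alpha> \<beta> S"
  shows "simplicial_complex (flip \<alpha> \<beta> S)"
proof -
  note S = flippableD[OF assms]
  have "flip \<alpha> \<beta> S \<subseteq> S \<union> Pow (\<alpha> \<union> \<beta>)" by (auto simp: mem_flip_iff[OF assms])
  then have "finite (flip \<alpha> \<beta> S)"
    by (rule finite_subset) (use S(2,3) simplicial_complexD(1)[OF S(1)] in auto)
  moreover have "finite \<sigma>" if "\<sigma> \<in> flip \<alpha> \<beta> S" for \<sigma>
    using that simplicial_complexD(3)[OF S(1), of \<sigma>] S(2,3)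
    by (auto simp: mem_flip_iff[OF assms] intro: finite_subset)
  moreover have "\<tau> \<in> flip \<alpha> \<beta> S" if "\<sigma> \<in> flip \<alpha> \<beta> S" "\<tau> \<subseteq> \<sigma>" for \<sigma> \<tau>
    using that simplicial_complexD(4)[OF S(1), of \<sigma> \<tau>] by (auto simp: mem_flip_iff[OF assms])
  moreover have "{} \<in> flip \<alpha> \<beta> S"
    using S(6) by (auto simp: mem_flip_iff[OF assms])
  ultimately show ?thesis
    unfolding simplicial_complex_def by blast
qed

lemma flippable_flip:
  assumes "flippable \<alpha> \<beta> S"
  shows "flippable \<beta> \<alpha> (flip \<alpha> \<beta> S)"
proof -
  note S = flippableD[OF assms]
  have "\<gamma> \<in> link (flip \<alpha> \<beta> S) \<beta> \<longleftrightarrow> \<gamma> \<subset> \<alpha>" for \<gamma>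
    using flippable_not_subset[OF assms, of "\<gamma> \<union> \<beta>"] S(6-8)
    by (auto simp: link_def mem_flip_iff[OF assms])
  then have "link (flip \<alpha> \<beta> S) \<beta> = boundary \<alpha>" by (auto simp: boundary_def)
  then show ?thesis
    using simplicial_complex_flip[OF assms] S
    by (auto simp: flippable_def mem_flip_iff[OF assms])
qed

lemma flip_flip:
  assumes "flippable \<alpha> \<beta> S"
  shows "flip \<beta> \<alpha> (flip \<alpha> \<beta> S) = S"
proof -
  have "\<sigma> \<in> flip \<beta> \<alpha> (flip \<alpha> \<beta> S) \<longleftrightarrow> \<sigma> \<in> S" for \<sigma>
    using flippable_not_subset[OF assms, of \<sigma>] flippable_ball[OF assms, of \<sigma>]
      flippable_star[OF assms, of \<sigma>]
    by (auto simp: mem_flip_iff[OF assms] mem_flip_iff[OF flippable_flip[OF assms]])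
  then show ?thesis by blast
qed

text \<open>A vertex is lost only if \<alpha> consists of it alone, which
  \<open>2 \<le> card \<alpha>\<close> excludes. The union with \<beta> adds something only if
  \<beta> is a single new vertex.\<close>

lemma vertices_flip:
  assumes "flippable \<alpha> \<beta> S" "2 \<le> card \<alpha>"
  shows "vertices (flip \<alpha> \<beta> S) = vertices S \<union> \<beta>"
proof -
  note S = flippableD[OF assms(1)]
  have "\<not> \<alpha> \<subseteq> {v}" for v
    using assms(2) card_mono[of "{v}" \<alpha>] by auto
  moreover have "{v} \<in> S" if "v \<in> \<alpha>" for v
    using that simplicial_complexD(4)[OF S(1,4)] by simp
  ultimately show ?thesis
    unfolding set_eq_iff vertex_iff[OF simplicial_complex_flip[OF assms(1)]] Un_iff vertex_iff[OF S(1)]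
    by (auto simp: mem_flip_iff[OF assms(1)])
qed

lemma vertices_flip_eq:
  assumes "flippable \<alpha> \<beta> S" "2 \<le> card \<alpha>" "2 \<le> card \<beta>"
  shows "vertices (flip \<alpha> \<beta> S) = vertices S"
proof -
  have "\<beta> \<subseteq> vertices S"
  proof
    fix v assume v: "v \<in> \<beta>"
    have "\<not> \<beta> \<subseteq> {v}" using assms(3) card_mono[of "{v}" \<beta>] by auto
    then have "{v} \<in> S" using v by (intro flippable_ball[OF assms(1)]) auto
    then show "v \<in> vertices S" by auto
  qed
  then show ?thesis using vertices_flip[OF assms(1,2)] by blast
qed

section \<open>Flips as PL homeomorphisms of realizations\<close>

definition min_coord :: "nat set \<Rightarrow> (nat \<Rightarrow>\<^sub>0 real) \<Rightarrow> real" where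
  "min_coord \<alpha> x = Min (Poly_Mapping.lookup x ` \<alpha>)"

text \<open>
  The balls \<open>\<alpha> * \<partial>\<beta>\<close> and \<open>\<partial>\<alpha> * \<beta>\<close> are the two halves of the boundary of the simplex
  spanned by \<open>\<alpha> \<union> \<beta>\<close>. Translating parallel to the line through the barycentres of \<open>\<alpha>\<close> and \<open>\<beta>\<close>
  until the smallest \<open>\<alpha>\<close>-coordinate vanishes moves the first onto the second and fixes the common
  boundary.
\<close>

definition flip_map :: "nat set \<Rightarrow> nat set \<Rightarrow> (nat \<Rightarrow>\<^sub>0 real) \<Rightarrow> nat \<Rightarrow>\<^sub>0 real" where
  "flip_map \<alpha> \<beta> x = x + min_coord \<alpha> x *\<^sub>R
    ((card \<alpha> / card \<beta>) *\<^sub>R (\<Sum>v\<in>\<beta>. unit_vec v) - (\<Sum>v\<in>\<alpha>. unit_vec v))"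

lemma continuous_on_min_coord:
  assumes "finite \<alpha>" "\<alpha> \<noteq> {}"
  shows "continuous_on X (min_coord \<alpha>)"
  using assms
proof (induction \<alpha> rule: finite_ne_induct)
  case (singleton a)
  then show ?case
    using continuous_on_lookup[OF continuous_on_id] by (simp add: min_coord_def[abs_def])
next
  case (insert a \<alpha>)
  then have "min_coord (insert a \<alpha>) = (\<lambda>x. min (Poly_Mapping.lookup x a) (min_coord \<alpha> x))"
    by (auto simp: min_coord_def fun_eq_iff)
  then show ?case
    using insert continuous_on_min[OF continuous_on_lookup[OF continuous_on_id]] by simp
qed

lemma continuous_on_flip_map:
  assumes "finite \<alpha>" "\<alpha> \<noteq> {}"
  shows "continuous_on X (flip_map \<alpha> \<beta>)"
  unfolding flip_map_def[abs_def]
  by (intro continuous_intros continuous_on_min_coord assms)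

lemma lookup_flip_map:
  assumes "finite \<alpha>" "finite \<beta>" "\<alpha> \<inter> \<beta> = {}"
  shows "Poly_Mapping.lookup (flip_map \<alpha> \<beta> x) v =
    Poly_Mapping.lookup x v + min_coord \<alpha> x *
      (if v \<in> \<alpha> then -1 else if v \<in> \<beta> then card \<alpha> / card \<beta> else 0)"
  using assms by (auto simp: flip_map_def lookup_add lookup_minus lookup_sum)

lemma min_coord_le: "finite \<alpha> \<Longrightarrow> v \<in> \<alpha> \<Longrightarrow> min_coord \<alpha> x \<le> Poly_Mapping.lookup x v"
  by (simp add: min_coord_def)

lemma min_coord_attained:
  assumes "finite \<alpha>" "\<alpha> \<noteq> {}"
  obtains v where "v \<in> \<alpha>" "min_coord \<alpha> x = Poly_Mapping.lookup x v"
proof -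
  have "min_coord \<alpha> x \<in> Poly_Mapping.lookup x ` \<alpha>"
    unfolding min_coord_def by (rule Min_in) (use assms in auto)
  then show thesis using that by auto
qed

lemma min_coord_eq_0:
  assumes "finite \<alpha>" "\<not> \<alpha> \<subseteq> Poly_Mapping.keys x" "\<And>v. 0 \<le> Poly_Mapping.lookup x v"
  shows "min_coord \<alpha> x = 0"
proof -
  obtain v where v: "v \<in> \<alpha>" "Poly_Mapping.lookup x v = 0"
    using assms(2) by (auto simp: in_keys_iff)
  moreover obtain w where "min_coord \<alpha> x = Poly_Mapping.lookup x w"
    using min_coord_attained[OF assms(1)] v by blast
  ultimately show ?thesis using min_coord_le[OF assms(1) v(1), of x] assms(3)[of w] by simp
qed

lemma flip_map_in_realization:
  assumes F: "flippable \<alpha> \<beta> S" and x: "x \<in> geometric_realization S"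
  shows "flip_map \<alpha> \<beta> x \<in> geometric_realization (flip \<alpha> \<beta> S)"
proof -
  note S = flippableD[OF F]
  have x: "Poly_Mapping.keys x \<in> S" "\<And>v. 0 \<le> Poly_Mapping.lookup x v"
    "sum (Poly_Mapping.lookup x) (Poly_Mapping.keys x) = 1"
    using x by (auto simp: mem_geometric_realization_iff[OF S(1)])
  let ?y = "flip_map \<alpha> \<beta> x"
  note y = lookup_flip_map[OF S(2,3,8), of x]
  have mem: "?y \<in> geometric_realization (flip \<alpha> \<beta> S) \<longleftrightarrow> Poly_Mapping.keys ?y \<in> flip \<alpha> \<beta> S \<and>
    (\<forall>v. 0 \<le> Poly_Mapping.lookup ?y v) \<and> sum (Poly_Mapping.lookup ?y) (Poly_Mapping.keys ?y) = 1"
    by (rule mem_geometric_realization_iff[OF simplicial_complex_flip[OF F]])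
  show ?thesis
  proof (cases "\<alpha> \<subseteq> Poly_Mapping.keys x")
    case False
    \<comment> \<open>Outside the open star of \<alpha> some \<alpha>-coordinate vanishes, so the
      map is the identity there.\<close>
    then have "min_coord \<alpha> x = 0" using min_coord_eq_0 S(2) x(2) by blast
    then have "?y = x" by (simp add: flip_map_def)
    then show ?thesis unfolding mem using x False by (auto simp: mem_flip_iff[OF F])
  next
    case True
    obtain v where v: "v \<in> \<alpha>" "min_coord \<alpha> x = Poly_Mapping.lookup x v"
      using min_coord_attained S by blast
    have nonneg: "0 \<le> Poly_Mapping.lookup ?y w" for w
      using x(2) min_coord_le[OF S(2), of w x] v(2) by (auto simp: y)
    have "Poly_Mapping.keys x \<subseteq> \<alpha> \<union> \<beta>" using flippable_star[OF F x(1) True] .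
    then have keys: "Poly_Mapping.keys ?y \<subseteq> \<alpha> \<union> \<beta>"
      by (auto simp: in_keys_iff y split: if_splits)
    have "v \<notin> Poly_Mapping.keys ?y" using v by (simp add: in_keys_iff y)
    then have 1: "Poly_Mapping.keys ?y \<in> flip \<alpha> \<beta> S"
      using keys v by (auto simp: mem_flip_iff[OF F])
    have "card \<beta> > 0" using S by (simp add: card_gt_0_iff)
    have fin: "finite (\<alpha> \<union> \<beta>)" using S by simp
    \<comment> \<open>The direction of translation has coordinate sum 0; this is the purpose of the
      factor \<open>card \<alpha> / card \<beta>\<close> in \<open>flip_map\<close>.\<close>
    have eq: "(\<Sum>w\<in>\<alpha> \<union> \<beta>. (if w \<in> \<alpha> then -1 else if w \<in> \<beta> then card \<alpha> / card \<beta> else 0)) = (0::real)"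
    proof -
      have "(\<Sum>w\<in>\<beta>. (if w \<in> \<alpha> then -1 else if w \<in> \<beta> then card \<alpha> / card \<beta> else 0))
          = (\<Sum>w\<in>\<beta>. card \<alpha> / card \<beta> :: real)"
        by (rule sum.cong) (use S in auto)
      then show ?thesis
        using S \<open>card \<beta> > 0\<close> by (subst sum.union_disjoint) auto
    qed
    have "sum (Poly_Mapping.lookup ?y) (Poly_Mapping.keys ?y) = sum (Poly_Mapping.lookup ?y) (\<alpha> \<union> \<beta>)"
      by (rule sum_lookup_superset[OF fin keys])
    also have "\<dots> = sum (Poly_Mapping.lookup x) (\<alpha> \<union> \<beta>)"
      unfolding y sum.distrib by (simp only: flip: sum_distrib_left) (simp only: eq mult_zero_right add_0_right)
    also have "\<dots> = 1"
      using sum_lookup_superset[OF fin \<open>Poly_Mapping.keys x \<subseteq> \<alpha> \<union> \<beta>\<close>] x by simp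
    finally show ?thesis unfolding mem using 1 nonneg by simp
  qed
qed

text \<open>The support of \<open>x\<close> does not contain \<beta>, so some \<beta>-coordinate of
  \<open>x\<close> is zero. All \<beta>-coordinates grow by the same amount
  \<open>min_coord \<alpha> x * (card \<alpha> / card \<beta>)\<close>, which is therefore the new
  minimum, and the reverse map translates by exactly the opposite vector.\<close>

lemma flip_map_inverse:
  assumes F: "flippable \<alpha> \<beta> S" and x: "x \<in> geometric_realization S"
  shows "flip_map \<beta> \<alpha> (flip_map \<alpha> \<beta> x) = x"
proof -
  note S = flippableD[OF F]
  have x: "Poly_Mapping.keys x \<in> S" "\<And>v. 0 \<le> Poly_Mapping.lookup x v"
    using x by (auto simp: mem_geometric_realization_iff[OF S(1)])
  let ?y = "flip_map \<alpha> \<beta> x" and ?m = "min_coord \<alpha> x * (card \<alpha> / card \<beta>)"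
  note y = lookup_flip_map[OF S(2,3,8), of x]
  have pos: "card \<alpha> > 0" "card \<beta> > 0" using S by (simp_all add: card_gt_0_iff)
  have "min_coord \<beta> x = 0"
    by (rule min_coord_eq_0[OF S(3) flippable_not_subset[OF F x(1)] x(2)])
  then obtain w where w: "w \<in> \<beta>" "Poly_Mapping.lookup x w = 0"
    using min_coord_attained[OF S(3,7)] by metis
  have y\<beta>: "Poly_Mapping.lookup ?y v = Poly_Mapping.lookup x v + ?m" if "v \<in> \<beta>" for v
    using that S(8) by (auto simp: y)
  have "min_coord \<beta> ?y = ?m"
  proof (rule antisym)
    show "min_coord \<beta> ?y \<le> ?m"
      using min_coord_le[OF S(3) w(1), of ?y] y\<beta>[OF w(1)] w(2) by simp
    obtain v where "v \<in> \<beta>" "min_coord \<beta> ?y = Poly_Mapping.lookup ?y v"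
      using min_coord_attained[OF S(3,7)] by blast
    then show "?m \<le> min_coord \<beta> ?y" using y\<beta>[of v] x(2)[of v] by simp
  qed
  then have "Poly_Mapping.lookup (flip_map \<beta> \<alpha> ?y) v = Poly_Mapping.lookup x v" for v
    using S(8) pos by (auto simp: lookup_flip_map[OF S(3,2)] y Int_commute field_simps)
  then show ?thesis by (rule poly_mapping_eqI)
qed

lemma PL_on_flip_map:
  assumes S: "simplicial_complex S" and \<alpha>: "finite \<alpha>" "\<alpha> \<noteq> {}"
  shows "PL_on (geometric_realization S) (flip_map \<alpha> \<beta>)"
  unfolding PL_on_def
proof (intro ballI exI conjI)
  \<comment> \<open>The piece of the simplex \<sigma> where the coordinate \<open>a\<close> is
    smallest among those of \<alpha>. There \<open>min_coord \<alpha>\<close> is that coordinate, so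
    \<open>flip_map\<close> is affine.\<close>
  let ?C = "\<lambda>(\<sigma>, a). {x \<in> std_simplex \<sigma>. \<forall>b\<in>\<alpha>. Poly_Mapping.lookup x a - Poly_Mapping.lookup x b \<le> 0}"
  let ?P = "?C ` (S \<times> \<alpha>)"
  let ?X = "geometric_realization S"
  show "finite ?P" using S \<alpha> by (simp add: simplicial_complex_def)
  show "openin (top_of_set ?X) ?X" by simp
  fix x assume x: "x \<in> ?X" then show "x \<in> ?X" .
  show "?X \<subseteq> \<Union>?P"
  proof
    fix y assume "y \<in> ?X"
    then obtain \<sigma> where "\<sigma> \<in> S" "y \<in> std_simplex \<sigma>" by (auto simp: geometric_realization_def)
    moreover obtain a where "a \<in> \<alpha>" "min_coord \<alpha> y = Poly_Mapping.lookup y a"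
      using min_coord_attained[OF \<alpha>] by blast
    ultimately show "y \<in> \<Union>?P"
      using min_coord_le[OF \<alpha>(1), of _ y] by (auto intro!: bexI[of _ "(\<sigma>, a)"])
  qed
  fix P assume "P \<in> ?P"
  then obtain \<sigma> a where P: "P = ?C (\<sigma>, a)" "\<sigma> \<in> S" "a \<in> \<alpha>" by auto
  have "finite \<sigma>" using S P by (simp add: simplicial_complex_def)
  show poly: "polytope P"
    unfolding P(1) prod.case
    by (intro polytope_halfspaces \<alpha> polytope_convex_hull affine_map_on_diff
        affine_map_on_linear[OF linear_lookup]) (simp add: \<open>finite \<sigma>\<close>)
  show "P \<subseteq> ?X" using P simplex_subset_realization by fastforce
  show "affine_map_on P (flip_map \<alpha> \<beta>)"
  proof (rule affine_map_on_cong[OF polytope_imp_convex[OF poly]])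
    fix y assume y: "y \<in> P"
    have "min_coord \<alpha> y = Poly_Mapping.lookup y a"
      using y P \<alpha> unfolding min_coord_def by (intro Min_eqI) auto
    then show "y + Poly_Mapping.lookup y a *\<^sub>R
        ((card \<alpha> / card \<beta>) *\<^sub>R (\<Sum>v\<in>\<beta>. unit_vec v) - (\<Sum>v\<in>\<alpha>. unit_vec v)) = flip_map \<alpha> \<beta> y"
      by (simp add: flip_map_def)
  qed (intro affine_map_on_add affine_map_on_scaleR_right affine_map_on_linear linear_lookup linear_ident)
qed

text \<open>The homeomorphism for \<open>T\<close> is \<open>h \<circ> k\<close>, and its inverse in
  a chart is \<open>l\<close> after the inverse of \<open>h\<close>. As
  \<open>PL_homeomorphism\<close> expresses inverses by \<open>inv_into\<close>, these are first
  identified with the continuous inverses \<open>h'\<close> and \<open>\<psi>\<close>, which gives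
  the continuity that composing PL maps requires.\<close>

lemma triangulates_transfer:
  fixes M :: "('m, 'e::euclidean_space) charted_space"
  assumes M: "PL_manifold d M" and S: "triangulates M S" and T: "simplicial_complex T"
  defines "X \<equiv> geometric_realization S" and "Y \<equiv> geometric_realization T"
  assumes k: "PL_on Y k" "continuous_on Y k" "\<And>y. y \<in> Y \<Longrightarrow> k y \<in> X" "\<And>y. y \<in> Y \<Longrightarrow> l (k y) = y"
    and l: "PL_on X l" "continuous_on X l" "\<And>x. x \<in> X \<Longrightarrow> l x \<in> Y" "\<And>x. x \<in> X \<Longrightarrow> k (l x) = x"
  shows "triangulates M T"
proof -
  obtain h where h: "homeomorphic_map (top_of_set X) (underlying M) h"
    and chart: "\<And>U \<phi>. (U, \<phi>) \<in> charts M \<Longrightarrow> PL_on {x \<in> X. h x \<in> U} (\<phi> \<circ> h) \<and>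
       PL_on (\<phi> ` U) (inv_into X h \<circ> inv_into U \<phi>)"
    using S by (auto simp: triangulates_def PL_homeomorphism_def X_def)
  obtain h' where h': "homeomorphic_maps (top_of_set X) (underlying M) h h'"
    using h by (auto simp: homeomorphic_map_maps)
  have hX: "h ` X = topspace (underlying M)" "inj_on h X"
    using homeomorphic_imp_surjective_map[OF h] homeomorphic_imp_injective_map[OF h] by simp_all
  have "homeomorphic_maps (top_of_set Y) (top_of_set X) k l"
    unfolding homeomorphic_maps_def using k l by (auto simp: continuous_map_iff_continuous2)
  then have "homeomorphic_maps (top_of_set Y) (underlying M) (h \<circ> k) (l \<circ> h')"
    using h' by (blast intro: homeomorphic_maps_compose)
  then have hk: "homeomorphic_map (top_of_set Y) (underlying M) (h \<circ> k)"
    using homeomorphic_map_maps by blast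
  have injk: "inj_on (h \<circ> k) Y"
    using homeomorphic_imp_injective_map[OF hk] by simp
  have "PL_on {y \<in> Y. (h \<circ> k) y \<in> U} (\<phi> \<circ> (h \<circ> k)) \<and>
      PL_on (\<phi> ` U) (inv_into Y (h \<circ> k) \<circ> inv_into U \<phi>)" if U: "(U, \<phi>) \<in> charts M" for U \<phi>
  proof
    have "PL_on {y \<in> Y. k y \<in> {x \<in> X. h x \<in> U}} ((\<phi> \<circ> h) \<circ> k)"
      by (rule PL_on_compose) (use k chart[OF U] in auto)
    moreover have "{y \<in> Y. k y \<in> {x \<in> X. h x \<in> U}} = {y \<in> Y. (h \<circ> k) y \<in> U}"
      using k(3) by auto
    ultimately show "PL_on {y \<in> Y. (h \<circ> k) y \<in> U} (\<phi> \<circ> (h \<circ> k))" by (simp add: o_assoc)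
    have Uo: "openin (underlying M) U"
      "homeomorphic_map (subtopology (underlying M) U) (top_of_set (\<phi> ` U)) \<phi>"
      using M U by (auto simp: PL_manifold_def)
    have UM: "U \<subseteq> topspace (underlying M)" using openin_subset[OF Uo(1)] .
    then have topU: "topspace (subtopology (underlying M) U) = U" by auto
    obtain \<psi> where \<psi>: "homeomorphic_maps (subtopology (underlying M) U) (top_of_set (\<phi> ` U)) \<phi> \<psi>"
      using Uo(2) by (auto simp: homeomorphic_map_maps)
    have inv\<phi>: "inv_into U \<phi> z = \<psi> z" if "z \<in> \<phi> ` U" for z
      using that \<psi> topU inv_into_f_f[of \<phi> U] homeomorphic_imp_injective_map[OF Uo(2)]
      by (auto simp: homeomorphic_maps_def)
    have inU: "\<psi> z \<in> U" if "z \<in> \<phi> ` U" for z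
      using that inv_into_into[of z \<phi> U] inv\<phi> by simp
    have invh: "inv_into X h y = h' y" if "y \<in> topspace (underlying M)" for y
    proof -
      have "y \<in> h ` X" using that by (simp only: hX(1))
      then obtain x where "x \<in> X" "y = h x" by (rule imageE) simp
      moreover have "h' (h x) = x"
        using h' \<open>x \<in> X\<close> unfolding homeomorphic_maps_def topspace_euclidean_subtopology by blast
      ultimately show ?thesis using inv_into_f_f[OF hX(2), of x] by simp
    qed
    have "continuous_map (top_of_set (\<phi> ` U)) (subtopology (underlying M) U) \<psi>"
      "continuous_map (underlying M) (top_of_set X) h'"
      using \<psi> h' by (auto simp: homeomorphic_maps_def)
    then have "continuous_map (top_of_set (\<phi> ` U)) (top_of_set X) (h' \<circ> \<psi>)"
      using continuous_map_compose continuous_map_into_fulltopology by blast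
    then have c': "continuous_on (\<phi> ` U) (h' \<circ> \<psi>)" and into: "(h' \<circ> \<psi>) ` \<phi> ` U \<subseteq> X"
      by (auto simp: continuous_map_iff_continuous2)
    have eq: "(inv_into X h \<circ> inv_into U \<phi>) z = (h' \<circ> \<psi>) z" if "z \<in> \<phi> ` U" for z
      using inv\<phi>[OF that] invh[of "\<psi> z"] inU[OF that] UM by auto
    have cont: "continuous_on (\<phi> ` U) (inv_into X h \<circ> inv_into U \<phi>)"
      by (rule continuous_on_eq[OF c']) (simp only: eq)
    have "PL_on {z \<in> \<phi> ` U. (inv_into X h \<circ> inv_into U \<phi>) z \<in> X} (l \<circ> (inv_into X h \<circ> inv_into U \<phi>))"
      using PL_on_compose[OF conjunct2[OF chart[OF U]] cont l(1)] .
    moreover have "{z \<in> \<phi> ` U. (inv_into X h \<circ> inv_into U \<phi>) z \<in> X} = \<phi> ` U"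
    proof -
      have "(inv_into X h \<circ> inv_into U \<phi>) z \<in> X" if "z \<in> \<phi> ` U" for z
        unfolding eq[OF that] using into that by blast
      then show ?thesis by blast
    qed
    ultimately have "PL_on (\<phi> ` U) (l \<circ> (inv_into X h \<circ> inv_into U \<phi>))" by simp
    then show "PL_on (\<phi> ` U) (inv_into Y (h \<circ> k) \<circ> inv_into U \<phi>)"
    proof (rule PL_on_cong)
      fix z assume z: "z \<in> \<phi> ` U"
      let ?y = "inv_into U \<phi> z"
      have "?y \<in> h ` X" using inv_into_into[OF z] UM hX by auto
      then have "inv_into X h ?y \<in> X" "h (inv_into X h ?y) = ?y"
        by (auto simp: inv_into_into f_inv_into_f)
      then have "inv_into Y (h \<circ> k) ?y = l (inv_into X h ?y)"
        using l by (intro inv_into_f_eq[OF injk]) auto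
      then show "(l \<circ> (inv_into X h \<circ> inv_into U \<phi>)) z = (inv_into Y (h \<circ> k) \<circ> inv_into U \<phi>) z"
        by simp
    qed
  qed
  then show ?thesis
    using T hk unfolding triangulates_def PL_homeomorphism_def Y_def[symmetric] by blast
qed

lemma triangulates_flip:
  fixes M :: "('m, 'e::euclidean_space) charted_space"
  assumes "PL_manifold d M" "triangulates M S" and F: "flippable \<alpha> \<beta> S"
  shows "triangulates M (flip \<alpha> \<beta> S)"
proof (rule triangulates_transfer[OF assms(1,2)])
  let ?T = "flip \<alpha> \<beta> S"
  note S = flippableD[OF F] and F' = flippable_flip[OF F]
  show T: "simplicial_complex ?T" by (rule simplicial_complex_flip[OF F])
  show "PL_on (geometric_realization ?T) (flip_map \<beta> \<alpha>)" "PL_on (geometric_realization S) (flip_map \<alpha> \<beta>)"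
    using S T by (auto intro: PL_on_flip_map)
  show "continuous_on (geometric_realization ?T) (flip_map \<beta> \<alpha>)"
    "continuous_on (geometric_realization S) (flip_map \<alpha> \<beta>)"
    using S by (auto intro: continuous_on_flip_map)
  show "flip_map \<beta> \<alpha> y \<in> geometric_realization S" "flip_map \<alpha> \<beta> (flip_map \<beta> \<alpha> y) = y"
    if "y \<in> geometric_realization ?T" for y
    using flip_map_in_realization[OF F' that] flip_map_inverse[OF F' that] by (simp_all add: flip_flip[OF F])
  show "flip_map \<alpha> \<beta> x \<in> geometric_realization ?T" "flip_map \<beta> \<alpha> (flip_map \<alpha> \<beta> x) = x"
    if "x \<in> geometric_realization S" for x
    using flip_map_in_realization[OF F that] flip_map_inverse[OF F that] by simp_all
qed

section \<open>Triangulated closed manifolds are strongly connected pseudomanifolds\<close>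

text \<open>The last assumption states in the form of an induction rule that any two facets are joined by
  a chain of facets in which consecutive ones share a ridge.\<close>

locale closed_pseudomanifold =
  fixes d :: nat and S :: scomplex
  assumes complex: "simplicial_complex S"
    and extend_to_facet: "\<sigma> \<in> S \<Longrightarrow> \<exists>F\<in>S. \<sigma> \<subseteq> F \<and> card F = d + 1"
    and card_le: "\<sigma> \<in> S \<Longrightarrow> card \<sigma> \<le> d + 1"
    and ridge: "\<tau> \<in> S \<Longrightarrow> card \<tau> = d \<Longrightarrow> \<exists>a b. a \<noteq> b \<and> link S \<tau> = {{}, {a}, {b}}"
    and facet_induct: "F \<in> S \<Longrightarrow> card F = d + 1 \<Longrightarrow> P F \<Longrightarrow>
      (\<And>G H. G \<in> S \<Longrightarrow> card G = d + 1 \<Longrightarrow> H \<in> S \<Longrightarrow> card H = d + 1 \<Longrightarrow>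
        card (G \<inter> H) = d \<Longrightarrow> P G \<Longrightarrow> P H) \<Longrightarrow>
      G \<in> S \<Longrightarrow> card G = d + 1 \<Longrightarrow> P G"

section \<open>Affine subspaces, dimension and barycentres\<close>

lemma open_contains_short_step:
  fixes p q :: "'a::real_normed_vector"
  assumes "open U" "p \<in> U"
  obtains t :: real where "0 < t" "t \<le> 1" "p + t *\<^sub>R q \<in> U"
proof -
  obtain r where r: "r > 0" "ball p r \<subseteq> U" using assms openE by blast
  define t where "t = min 1 (r / (2 * (norm q + 1)))"
  have q: "norm q + 1 > 0" by (simp add: add_nonneg_pos)
  have "t > 0" "t \<le> 1" using r q by (auto simp: t_def)
  moreover have "t * norm q < r"
  proof -
    have "t * norm q \<le> r / (2 * (norm q + 1)) * (norm q + 1)"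
      using q r by (intro mult_mono) (auto simp: t_def)
    also have "\<dots> = r / 2"
    proof -
      have "r / (2 * c) * c = r / 2" if "c > 0" for c using that by simp
      from this[OF q] show ?thesis .
    qed
    finally show ?thesis using r by simp
  qed
  ultimately show thesis using r by (intro that[of t]) (auto simp: dist_norm)
qed

lemma open_Collect_finite_ball:
  assumes "finite A" "\<And>a. open {x. P a x}"
  shows "open {x. \<forall>a\<in>A. P a x}"
proof -
  have "{x. \<forall>a\<in>A. P a x} = (\<Inter>a\<in>A. {x. P a x})" by auto
  then show ?thesis using assms by (simp add: open_INT)
qed

lemma interior_finite_Union_eq_empty:
  assumes "finite \<L>" "\<And>L. L \<in> \<L> \<Longrightarrow> closed L \<and> interior L = {}"
  shows "closed (\<Union>\<L>) \<and> interior (\<Union>\<L>) = {}"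
  using assms
proof (induction rule: finite_induct)
  case (insert L \<L>)
  then show ?case using interior_closed_Un_empty_interior[of L "\<Union>\<L>"] by auto
qed auto

lemma interior_low_aff_dim:
  fixes L :: "'e::euclidean_space set"
  assumes "aff_dim L < DIM('e)" shows "interior L = {}"
  using assms aff_dim_nonempty_interior by fastforce

text \<open>The hulls of \<open>insert x L\<close> and \<open>insert y L\<close> have codimension at
  least 1, so some \<open>z\<close> in the ball avoids all of them. The segments from
  \<open>x\<close> and \<open>y\<close> to \<open>z\<close> then miss every \<open>L\<close>: a
  point of \<open>L\<close> on such a segment would put \<open>z\<close> into one of the
  hulls.\<close>

lemma connected_ball_diff_affine:
  fixes c :: "'e::euclidean_space"
  assumes fin: "finite \<L>" and L: "\<And>L. L \<in> \<L> \<Longrightarrow> affine L \<and> aff_dim L \<le> int DIM('e) - 2"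
  shows "Topological_Spaces.connected (ball c r - \<Union>\<L>)"
  unfolding connected_iff_connected_component
proof (intro ballI)
  fix x y assume xy: "x \<in> ball c r - \<Union>\<L>" "y \<in> ball c r - \<Union>\<L>"
  define H where "H = (\<lambda>(w, L). affine hull (insert w L)) ` ({x, y} \<times> \<L>)"
  have "closed K \<and> interior K = {}" if KH: "K \<in> H" for K
  proof -
    obtain w L where K: "K = affine hull (insert w L)" "L \<in> \<L>" using KH by (auto simp: H_def)
    have "aff_dim K < DIM('e)"
      using L[OF K(2)] by (auto simp: K aff_dim_insert)
    then have "interior K = {}" by (rule interior_low_aff_dim)
    then show ?thesis by (simp add: K(1))
  qed
  moreover have "finite H" using fin by (simp add: H_def)
  ultimately have "interior (\<Union>H) = {}" using interior_finite_Union_eq_empty by blast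
  moreover have "x \<in> ball c r" using xy by simp
  ultimately have "\<not> ball c r \<subseteq> \<Union>H"
    using interior_maximal[OF _ open_ball] by blast
  then obtain z where z: "z \<in> ball c r" "z \<notin> \<Union>H" by blast
  have seg: "closed_segment w z \<subseteq> ball c r - \<Union>\<L>" if w: "w \<in> {x, y}" for w
  proof
    fix p assume p: "p \<in> closed_segment w z"
    have wz: "w \<in> ball c r" "z \<in> ball c r" using w xy z by auto
    then have "p \<in> ball c r"
      using p closed_segment_subset[OF wz convex_ball] by blast
    moreover have "p \<notin> L" if "L \<in> \<L>" for L
    proof
      assume pL: "p \<in> L"
      obtain t where t: "0 \<le> t" "t \<le> 1" "p = (1 - t) *\<^sub>R w + t *\<^sub>R z"
        using p by (auto simp: closed_segment_def)
      have "t \<noteq> 0"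
        using t(3) pL w xy that by auto
      then have "z = (1 - 1 / t) *\<^sub>R w + (1 / t) *\<^sub>R p"
        by (simp add: t(3) algebra_simps)
      moreover have "(1 - 1 / t) *\<^sub>R w + (1 / t) *\<^sub>R p \<in> affine hull (insert w L)"
        using pL by (intro mem_affine[OF affine_affine_hull] hull_inc) auto
      ultimately have "z \<in> \<Union>H"
        using w that by (auto simp: H_def)
      then show False using z by simp
    qed
    ultimately show "p \<in> ball c r - \<Union>\<L>" by auto
  qed
  have "Topological_Spaces.connected (closed_segment x z \<union> closed_segment y z)"
    by (rule connected_Un) auto
  then show "connected_component (ball c r - \<Union>\<L>) x y"
    unfolding connected_component_def using seg by (intro exI[of _ "closed_segment x z \<union> closed_segment y z"]) auto
qed

text \<open>Compare the barycentre of the \<open>y i\<close> with a small perturbation of it by the given relation.\<close>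

lemma affine_map_on_affine_relation:
  assumes K: "convex K" "affine_map_on K f" and I: "finite I" "\<And>i. i \<in> I \<Longrightarrow> y i \<in> K"
    and u: "sum u I = 0" "(\<Sum>i\<in>I. u i *\<^sub>R y i) = 0"
  shows "(\<Sum>i\<in>I. u i *\<^sub>R f (y i)) = 0"
proof (cases "I = {}")
  case False
  define n where "n = real (card I)"
  \<comment> \<open>Small enough for all perturbed weights \<open>1 / n + e * u i\<close> to be
    nonnegative; the summand 1 keeps the denominator positive.\<close>
  define e where "e = 1 / (n * (1 + (\<Sum>i\<in>I. \<bar>u i\<bar>)))"
  have n: "n > 0" using False I by (simp add: n_def card_gt_0_iff)
  have s: "1 + (\<Sum>i\<in>I. \<bar>u i\<bar>) > 0" by (simp add: add_pos_nonneg sum_nonneg)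
  have e: "e > 0" using n s by (simp add: e_def)
  have nonneg: "0 \<le> 1 / n + e * u i" if "i \<in> I" for i
  proof -
    have "\<bar>u i\<bar> \<le> (\<Sum>i\<in>I. \<bar>u i\<bar>)" using that I by (intro member_le_sum) auto
    then have "- u i \<le> 1 + (\<Sum>i\<in>I. \<bar>u i\<bar>)" by linarith
    then have "e * (- u i) \<le> e * (1 + (\<Sum>i\<in>I. \<bar>u i\<bar>))" using e by (intro mult_left_mono) auto
    also have "\<dots> = 1 / n" using s by (simp add: e_def)
    finally show ?thesis by simp
  qed
  have 1: "(\<Sum>i\<in>I. 1 / n + e * u i) = 1" "(\<Sum>i\<in>I. 1 / n) = 1"
    using n u by (simp_all add: sum.distrib n_def flip: sum_distrib_left)
  have "(\<Sum>i\<in>I. (1 / n + e * u i) *\<^sub>R y i) = (\<Sum>i\<in>I. (1 / n) *\<^sub>R y i) + e *\<^sub>R (\<Sum>i\<in>I. u i *\<^sub>R y i)"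
    by (simp add: scaleR_add_left sum.distrib scaleR_sum_right)
  then have eq: "(\<Sum>i\<in>I. (1 / n + e * u i) *\<^sub>R y i) = (\<Sum>i\<in>I. (1 / n) *\<^sub>R y i)" using u by simp
  have "(\<Sum>i\<in>I. (1 / n + e * u i) *\<^sub>R f (y i)) = (\<Sum>i\<in>I. (1 / n) *\<^sub>R f (y i))"
    using affine_map_on_sum[OF K I(1) nonneg 1(1), where y = y] I(2)
      affine_map_on_sum[OF K I(1) _ 1(2), where y = y] n eq by simp
  then have "e *\<^sub>R (\<Sum>i\<in>I. u i *\<^sub>R f (y i)) = 0"
    by (simp add: scaleR_add_left sum.distrib scaleR_sum_right)
  then show ?thesis using e by simp
qed simp

text \<open>More than \<open>card \<rho>\<close> affinely independent image points would have
  linearly dependent preimages, which lie in the span of the unit vectors of \<rho>. All coordinate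
  sums are 1, so the coefficients of the dependence add up to 0; it is an affine relation and is
  preserved by \<open>f\<close>.\<close>

lemma aff_dim_affine_image_le:
  fixes f :: "(nat \<Rightarrow>\<^sub>0 real) \<Rightarrow> 'e::euclidean_space"
  assumes \<rho>: "finite \<rho>" and C: "convex C" "C \<subseteq> std_simplex \<rho>" and f: "affine_map_on C f"
  shows "aff_dim (f ` C) \<le> int (card \<rho>) - 1"
proof -
  obtain B where B: "B \<subseteq> f ` C" "\<not> affine_dependent B" "affine hull (f ` C) = affine hull B"
    using affine_basis_exists by blast
  have finB: "finite B" using aff_independent_finite[OF B(2)] .
  define c where "c = inv_into C f"
  have c: "c x \<in> C" "f (c x) = x" if "x \<in> B" for x
    using that B(1) by (auto simp: c_def intro: inv_into_into f_inv_into_f)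
  have inj: "inj_on c B" by (metis c(2) inj_onI)
  have "card B \<le> card \<rho>"
  proof (rule ccontr)
    assume *: "\<not> card B \<le> card \<rho>"
    have keys: "Poly_Mapping.keys (c x) \<subseteq> \<rho>" "sum (Poly_Mapping.lookup (c x)) \<rho> = 1" if "x \<in> B" for x
      using subsetD[OF C(2) c(1)[OF that]] \<rho> by (simp_all add: mem_simplex_iff)
    have "c x \<in> span (unit_vec ` \<rho>)" if "x \<in> B" for x
      using c(1)[OF that] C(2) convex_hull_subset_span by blast
    then have "c ` B \<subseteq> span (unit_vec ` \<rho>)" by blast
    then have "dependent (c ` B)"
      using independent_span_bound[of "unit_vec ` \<rho>" "c ` B"] \<rho> * card_image[OF inj]
        card_image_le[OF \<rho>, of unit_vec] by auto
    then obtain u where u: "\<exists>v\<in>c ` B. u v \<noteq> 0" "(\<Sum>v\<in>c ` B. u v *\<^sub>R v) = 0"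
      using dependent_finite[of "c ` B"] finB by auto
    define w where "w x = u (c x)" for x
    have w0: "(\<Sum>x\<in>B. w x *\<^sub>R c x) = 0"
      using u(2) by (simp add: sum.reindex[OF inj] w_def)
    have "0 = (\<Sum>i\<in>\<rho>. Poly_Mapping.lookup (\<Sum>x\<in>B. w x *\<^sub>R c x) i)" by (simp add: w0)
    also have "\<dots> = (\<Sum>x\<in>B. w x * sum (Poly_Mapping.lookup (c x)) \<rho>)"
      by (simp add: lookup_sum sum_distrib_left) (rule sum.swap)
    also have "\<dots> = sum w B" using keys by simp
    finally have ws: "sum w B = 0" by simp
    have "(\<Sum>x\<in>B. w x *\<^sub>R f (c x)) = 0"
      by (rule affine_map_on_affine_relation[OF C(1) f finB _ ws w0]) (rule c)
    then have "(\<Sum>x\<in>B. w x *\<^sub>R x) = 0" using c(2) by simp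
    then have "affine_dependent B"
      using affine_dependent_explicit_finite[OF finB] ws u(1) by (auto simp: w_def)
    then show False using B(2) by simp
  qed
  moreover have "aff_dim (f ` C) = int (card B) - 1"
    using aff_dim_affine_independent[OF B(2)] aff_dim_affine_hull[of B]
      aff_dim_affine_hull[of "f ` C"] B(3) by simp
  ultimately show ?thesis by simp
qed

lemma lookup_sum_unit_vec:
  assumes "finite \<sigma>"
  shows "Poly_Mapping.lookup (\<Sum>v\<in>\<sigma>. c v *\<^sub>R unit_vec v) w = (if w \<in> \<sigma> then c w else 0)"
proof -
  have "Poly_Mapping.lookup (\<Sum>v\<in>\<sigma>. c v *\<^sub>R unit_vec v) w = (\<Sum>v\<in>\<sigma>. if w = v then c v else 0)"
    unfolding lookup_sum by (rule sum.cong) auto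
  then show ?thesis using assms by simp
qed

definition barycentre :: "nat set \<Rightarrow> nat \<Rightarrow>\<^sub>0 real" where
  "barycentre \<sigma> = (\<Sum>v\<in>\<sigma>. (1 / card \<sigma>) *\<^sub>R unit_vec v)"

lemma lookup_barycentre:
  "finite \<sigma> \<Longrightarrow> Poly_Mapping.lookup (barycentre \<sigma>) v = (if v \<in> \<sigma> then 1 / card \<sigma> else 0)"
  by (simp add: barycentre_def lookup_sum_unit_vec)

lemma barycentre_in_simplex: "finite \<sigma> \<Longrightarrow> \<sigma> \<noteq> {} \<Longrightarrow> barycentre \<sigma> \<in> std_simplex \<sigma>"
  by (auto simp: mem_simplex_iff lookup_barycentre in_keys_iff split: if_splits)

text \<open>Together with \<open>open_contains_short_step\<close> this yields, in any open set
  around the barycentre of \<tau>, a point whose support is exactly a given simplex \<rho> above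
  \<tau>.\<close>

lemma step_to_barycentre:
  assumes \<rho>: "finite \<rho>" "\<tau> \<subseteq> \<rho>" "\<tau> \<noteq> {}" and t: "0 < t" "t \<le> 1"
  shows "barycentre \<tau> + t *\<^sub>R (barycentre \<rho> - barycentre \<tau>) \<in> std_simplex \<rho>" (is "?y \<in> _")
    and "Poly_Mapping.keys (barycentre \<tau> + t *\<^sub>R (barycentre \<rho> - barycentre \<tau>)) = \<rho>"
proof -
  have fin: "finite \<tau>" using \<rho> finite_subset by blast
  have "std_simplex \<tau> \<subseteq> std_simplex \<rho>" using \<rho> by (intro hull_mono) auto
  then have "barycentre \<tau> \<in> std_simplex \<rho>" "barycentre \<rho> \<in> std_simplex \<rho>"
    using barycentre_in_simplex fin \<rho> by auto
  then have "(1 - t) *\<^sub>R barycentre \<tau> + t *\<^sub>R barycentre \<rho> \<in> std_simplex \<rho>"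
    using t by (intro convexD) auto
  then show 1: "?y \<in> std_simplex \<rho>" by (simp add: algebra_simps)
  have "Poly_Mapping.lookup ?y v > 0" if "v \<in> \<rho>" for v
  proof -
    have "card \<rho> > 0" using that \<rho> by (auto simp: card_gt_0_iff)
    then have "0 < t / card \<rho>" using t by simp
    moreover have "t / card \<tau> \<le> 1 / card \<tau>" using t by (simp add: divide_right_mono)
    ultimately show ?thesis
      using that fin \<rho> by (simp add: lookup_add lookup_minus lookup_barycentre right_diff_distrib)
  qed
  then have "\<rho> \<subseteq> Poly_Mapping.keys ?y" by (metis in_keys_iff less_irrefl subsetI)
  then show "Poly_Mapping.keys ?y = \<rho>" using 1 \<rho> by (auto simp: mem_simplex_iff)
qed

lemma openin_open_star:
  assumes "finite \<tau>"
  shows "openin (top_of_set X) {x \<in> X. \<forall>v\<in>\<tau>. 0 < Poly_Mapping.lookup (x :: nat \<Rightarrow>\<^sub>0 real) v}"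
proof -
  have "open {x :: nat \<Rightarrow>\<^sub>0 real. \<forall>v\<in>\<tau>. 0 < Poly_Mapping.lookup x v}"
    by (intro open_Collect_finite_ball assms open_Collect_less continuous_intros continuous_on_id)
  then show ?thesis by (auto simp: openin_open)
qed

text \<open>What the manifold contributes to the combinatorics, with its charts pulled back to the
  realization. The parameter \<open>E\<close> carries the type of the model space, so that
  \<open>DIM('e)\<close> can be spoken of.\<close>

locale PL_euclidean_complex =
  fixes S :: scomplex and E :: "'e::euclidean_space itself"
  assumes complex: "simplicial_complex S"
    and nonempty: "geometric_realization S \<noteq> {}"
    and connected: "Topological_Spaces.connected (geometric_realization S)"
    and charts: "x \<in> geometric_realization S \<Longrightarrow> \<exists>X (\<theta> :: (nat \<Rightarrow>\<^sub>0 real) \<Rightarrow> 'e) \<psi>. x \<in> X \<and>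
      openin (top_of_set (geometric_realization S)) X \<and> homeomorphism X (\<theta> ` X) \<theta> \<psi> \<and>
      open (\<theta> ` X) \<and> PL_on X \<theta>"
begin

abbreviation (input) "R \<equiv> geometric_realization S"

lemmas finiteS = simplicial_complexD(1)[OF complex]
lemmas finite_simplex = simplicial_complexD(3)[OF complex]
lemmas subset_mem = simplicial_complexD(4)[OF complex]

lemma chartE:
  assumes "x \<in> R"
  obtains X \<theta> \<psi> where "x \<in> X" "openin (top_of_set R) X" "homeomorphism X (\<theta> ` X) \<theta> \<psi>"
    "open ((\<theta> :: _ \<Rightarrow> 'e) ` X)" "PL_on X \<theta>"
proof -
  obtain X and \<theta> :: "(nat \<Rightarrow>\<^sub>0 real) \<Rightarrow> 'e" and \<psi> where "x \<in> X \<and>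
      openin (top_of_set R) X \<and> homeomorphism X (\<theta> ` X) \<theta> \<psi> \<and> open (\<theta> ` X) \<and> PL_on X \<theta>"
    using charts[OF assms] by (elim exE)
  then show thesis by (elim conjE) (rule that)
qed

text \<open>Invariance of domain for maps into the realization, obtained by following
  \<open>B\<close> locally with a chart. It makes explicitly parametrized discs open, which bounds
  the simplices at a ridge from above.\<close>

lemma openin_image_of_open:
  fixes B :: "'e \<Rightarrow> nat \<Rightarrow>\<^sub>0 real"
  assumes Z: "open Z" and B: "continuous_on Z B" "inj_on B Z" "B ` Z \<subseteq> R"
  shows "openin (top_of_set R) (B ` Z)"
proof (subst openin_subopen, intro ballI)
  fix y assume "y \<in> B ` Z"
  then obtain z where z: "z \<in> Z" "y = B z" by auto
  then have "y \<in> R" using B by auto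
  then obtain X and \<theta> :: "(nat \<Rightarrow>\<^sub>0 real) \<Rightarrow> 'e" and \<psi> where X: "y \<in> X" "openin (top_of_set R) X"
    "homeomorphism X (\<theta> ` X) \<theta> \<psi>" "open (\<theta> ` X)" "PL_on X \<theta>"
    by (rule chartE)
  have inv: "\<psi> (\<theta> x) = x" if "x \<in> X" for x using X(3) that by (simp add: homeomorphism_def)
  obtain U where U: "open U" "X = R \<inter> U" using X(2) by (auto simp: openin_open)
  define Z' where "Z' = Z \<inter> B -` U"
  have Z': "open Z'" unfolding Z'_def using continuous_open_preimage[OF B(1) Z U(1)] .
  have BZ': "B ` Z' \<subseteq> X" using U B(3) by (auto simp: Z'_def)
  have "open ((\<theta> \<circ> B) ` Z')"
  proof (rule invariance_of_domain[OF _ Z'])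
    have "continuous_on Z' B" using B(1) by (rule continuous_on_subset) (auto simp: Z'_def)
    moreover have "continuous_on (B ` Z') \<theta>"
      using homeomorphism_cont1[OF X(3)] BZ' continuous_on_subset by blast
    ultimately show "continuous_on Z' (\<theta> \<circ> B)" by (rule continuous_on_compose)
    show "inj_on (\<theta> \<circ> B) Z'"
    proof (rule inj_onI)
      fix p q assume pq: "p \<in> Z'" "q \<in> Z'" "(\<theta> \<circ> B) p = (\<theta> \<circ> B) q"
      have "B p \<in> X" "B q \<in> X" using BZ' pq by blast+
      from inv[OF this(1)] inv[OF this(2)] pq(3) have "B p = B q" by (metis comp_apply)
      then show "p = q" using pq(1,2) B(2) by (auto simp: Z'_def inj_on_def)
    qed
  qed
  then have "openin (top_of_set X) (X \<inter> \<theta> -` ((\<theta> \<circ> B) ` Z'))"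
    by (rule continuous_openin_preimage_gen[OF homeomorphism_cont1[OF X(3)]])
  then have "openin (top_of_set R) (X \<inter> \<theta> -` ((\<theta> \<circ> B) ` Z'))"
    using X(2) openin_trans by blast
  moreover have "y \<in> X \<inter> \<theta> -` ((\<theta> \<circ> B) ` Z')" using X(1) z U by (auto simp: Z'_def)
  moreover have "X \<inter> \<theta> -` ((\<theta> \<circ> B) ` Z') \<subseteq> B ` Z"
  proof
    fix x assume "x \<in> X \<inter> \<theta> -` ((\<theta> \<circ> B) ` Z')"
    then obtain q where q: "x \<in> X" "q \<in> Z'" "\<theta> x = \<theta> (B q)" by auto
    have "B q \<in> X" using BZ' q(2) by blast
    from inv[OF this] inv[OF q(1)] q(3) have "x = B q" by metis
    then show "x \<in> B ` Z" using q by (auto simp: Z'_def)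
  qed
  ultimately show "\<exists>T. openin (top_of_set R) T \<and> y \<in> T \<and> T \<subseteq> B ` Z" by blast
qed

lemma chart_open_image:
  fixes \<theta> :: "(nat \<Rightarrow>\<^sub>0 real) \<Rightarrow> 'e"
  assumes X: "openin (top_of_set R) X" "homeomorphism X (\<theta> ` X) \<theta> \<psi>" "open (\<theta> ` X)"
    and W: "openin (top_of_set R) W" "W \<subseteq> X"
  shows "open (\<theta> ` W)"
proof -
  have "openin (top_of_set X) W" using W X(1) openin_imp_subset openin_subset_trans by metis
  then have "openin (top_of_set (\<theta> ` X)) (\<theta> ` W)"
    using homeomorphism_imp_open_map[OF X(2)] by blast
  then show ?thesis using X(3) openin_open_trans by blast
qed

text \<open>The counterpart for maps out of the realization, obtained by preceding \<open>A\<close>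
  with the inverse of a chart. It forbids boundary points in injective images of open stars, which
  forces cofaces to exist.\<close>

lemma open_image_of_openin:
  fixes A :: "(nat \<Rightarrow>\<^sub>0 real) \<Rightarrow> 'e"
  assumes W: "openin (top_of_set R) W" and A: "continuous_on W A" "inj_on A W"
  shows "open (A ` W)"
proof (subst open_subopen, intro ballI)
  fix y assume "y \<in> A ` W"
  then obtain x where x: "x \<in> W" "y = A x" by auto
  then have "x \<in> R" using openin_imp_subset[OF W] by auto
  then obtain X and \<theta> :: "(nat \<Rightarrow>\<^sub>0 real) \<Rightarrow> 'e" and \<psi> where X: "x \<in> X" "openin (top_of_set R) X"
    "homeomorphism X (\<theta> ` X) \<theta> \<psi>" "open (\<theta> ` X)" "PL_on X \<theta>"
    by (rule chartE)
  let ?W = "W \<inter> X"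
  have inv: "\<psi> (\<theta> x) = x" if "x \<in> X" for x using X(3) that by (simp add: homeomorphism_def)
  have o: "open (\<theta> ` ?W)"
    by (rule chart_open_image[OF X(2-4)]) (use W X(2) in auto)
  have \<psi>: "\<psi> ` \<theta> ` ?W = ?W" using inv by force
  have "open ((A \<circ> \<psi>) ` \<theta> ` ?W)"
  proof (rule invariance_of_domain[OF _ o])
    have "continuous_on (\<theta> ` ?W) \<psi>"
      using homeomorphism_cont2[OF X(3)] by (rule continuous_on_subset) auto
    moreover have "continuous_on (\<psi> ` \<theta> ` ?W) A"
      unfolding \<psi> using A(1) by (rule continuous_on_subset) auto
    ultimately show "continuous_on (\<theta> ` ?W) (A \<circ> \<psi>)" by (rule continuous_on_compose)
    show "inj_on (A \<circ> \<psi>) (\<theta> ` ?W)"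
      using A(2) inv by (auto simp: inj_on_def)
  qed
  then have "open (A ` ?W)" unfolding image_comp[symmetric] \<psi> .
  then show "\<exists>T. open T \<and> y \<in> T \<and> T \<subseteq> A ` W" using x X by blast
qed

text \<open>If all cofaces of \<tau> were contained in \<open>insert a \<tau>\<close>, the
  coordinates at \<tau> would embed the open star of \<tau> into Euclidean space with coordinate
  sums at most 1. The barycentre of \<tau> attains the sum 1, so the image could not be open. A
  vertex \<open>a\<close> of \<tau> gives a first proper coface, a vertex found there gives a second
  one.\<close>

lemma exists_proper_coface:
  assumes \<tau>: "\<tau> \<in> S" "\<tau> \<noteq> {}" "card \<tau> \<le> DIM('e)"
  shows "\<exists>\<rho>\<in>S. \<tau> \<subseteq> \<rho> \<and> \<not> \<rho> \<subseteq> insert a \<tau>"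
proof (rule ccontr)
  assume "\<not> (\<exists>\<rho>\<in>S. \<tau> \<subseteq> \<rho> \<and> \<not> \<rho> \<subseteq> insert a \<tau>)"
  then have star: "\<rho> \<subseteq> insert a \<tau>" if "\<rho> \<in> S" "\<tau> \<subseteq> \<rho>" for \<rho> using that by blast
  have fin: "finite \<tau>" using finite_simplex[OF \<tau>(1)] .
  obtain e where e: "e ` \<tau> \<subseteq> (Basis :: 'e set)" "inj_on e \<tau>"
    using card_le_inj[OF fin finite_Basis \<tau>(3)] by auto
  have inner: "(\<Sum>v\<in>\<tau>. c v *\<^sub>R e v) \<bullet> e w = c w" if "w \<in> \<tau>" for c w
  proof -
    have "(\<Sum>v\<in>\<tau>. c v *\<^sub>R e v) \<bullet> e w = (\<Sum>v\<in>\<tau>. if v = w then c v else 0)"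
      unfolding inner_sum_left
    proof (rule sum.cong)
      fix v assume "v \<in> \<tau>"
      then have "e v \<in> Basis" "e w \<in> Basis" "e v = e w \<longleftrightarrow> v = w"
        using e that by (auto simp: inj_on_def)
      then show "c v *\<^sub>R e v \<bullet> e w = (if v = w then c v else 0)" by (simp add: inner_Basis)
    qed simp
    then show ?thesis using fin that by simp
  qed
  define A where "A x = (\<Sum>v\<in>\<tau>. Poly_Mapping.lookup x v *\<^sub>R e v)" for x
  define W where "W = {x \<in> R. \<forall>v\<in>\<tau>. 0 < Poly_Mapping.lookup x v}"
  have W: "openin (top_of_set R) W" unfolding W_def by (rule openin_open_star[OF fin])
  have WD: "Poly_Mapping.keys x \<subseteq> insert a \<tau>" "\<And>v. 0 \<le> Poly_Mapping.lookup x v"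
    "sum (Poly_Mapping.lookup x) (insert a \<tau>) = 1" if "x \<in> W" for x
  proof -
    have x: "Poly_Mapping.keys x \<in> S" "\<And>v. 0 \<le> Poly_Mapping.lookup x v"
      "sum (Poly_Mapping.lookup x) (Poly_Mapping.keys x) = 1"
      using that by (auto simp: W_def mem_geometric_realization_iff[OF complex])
    have "\<tau> \<subseteq> Poly_Mapping.keys x"
      using that by (auto simp: W_def in_keys_iff dest!: bspec)
    then show "Poly_Mapping.keys x \<subseteq> insert a \<tau>" using star x by blast
    then show "sum (Poly_Mapping.lookup x) (insert a \<tau>) = 1"
      using sum_lookup_superset[of "insert a \<tau>" x] fin x by simp
    show "\<And>v. 0 \<le> Poly_Mapping.lookup x v" by fact
  qed
  have "inj_on A W"
  proof (rule inj_onI)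
    fix x y assume xy: "x \<in> W" "y \<in> W" "A x = A y"
    have \<tau>xy: "Poly_Mapping.lookup x v = Poly_Mapping.lookup y v" if "v \<in> \<tau>" for v
      using inner[OF that, of "Poly_Mapping.lookup x"] inner[OF that, of "Poly_Mapping.lookup y"] xy(3)
      by (simp add: A_def)
    have a: "Poly_Mapping.lookup x a = Poly_Mapping.lookup y a"
    proof (cases "a \<in> \<tau>")
      case False
      have "sum (Poly_Mapping.lookup x) \<tau> = sum (Poly_Mapping.lookup y) \<tau>" using \<tau>xy by simp
      then show ?thesis using WD(3)[OF xy(1)] WD(3)[OF xy(2)] fin False by simp
    qed (rule \<tau>xy)
    show "x = y"
    proof (rule poly_mapping_eqI)
      fix v show "Poly_Mapping.lookup x v = Poly_Mapping.lookup y v"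
      proof (cases "v \<in> insert a \<tau>")
        case False
        then show ?thesis using WD(1)[OF xy(1)] WD(1)[OF xy(2)] by (metis in_keys_iff subsetD)
      qed (use a \<tau>xy in auto)
    qed
  qed
  moreover have "continuous_on W A"
    unfolding A_def by (intro continuous_intros continuous_on_id)
  ultimately have o: "open (A ` W)" using open_image_of_openin[OF W] by blast
  have b: "barycentre \<tau> \<in> W"
  proof -
    have "0 < Poly_Mapping.lookup (barycentre \<tau>) v" if "v \<in> \<tau>" for v
      using that fin by (auto simp: lookup_barycentre card_gt_0_iff)
    then show ?thesis
      using barycentre_in_simplex[OF fin \<tau>(2)] simplex_subset_realization[OF \<tau>(1)]
      unfolding W_def by blast
  qed
  obtain t where t: "0 < t" "t \<le> 1" "A (barycentre \<tau>) + t *\<^sub>R A (barycentre \<tau>) \<in> A ` W"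
    by (rule open_contains_short_step[OF o imageI[OF b]])
  have s: "(\<Sum>v\<in>\<tau>. A x \<bullet> e v) = sum (Poly_Mapping.lookup x) \<tau>" for x
    by (rule sum.cong) (simp_all add: A_def inner)
  obtain x where x: "x \<in> W" "A (barycentre \<tau>) + t *\<^sub>R A (barycentre \<tau>) = A x" using t(3) by (rule imageE) simp
  have "sum (Poly_Mapping.lookup x) \<tau> = (1 + t) * sum (Poly_Mapping.lookup (barycentre \<tau>)) \<tau>"
    unfolding s[symmetric] x(2)[symmetric]
    by (simp add: inner_add_left sum.distrib distrib_right flip: sum_distrib_left)
  also have "sum (Poly_Mapping.lookup (barycentre \<tau>)) \<tau> = 1"
    using fin \<tau>(2) by (simp add: lookup_barycentre card_gt_0_iff)
  finally have "sum (Poly_Mapping.lookup x) \<tau> > 1" using t by simp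
  moreover have "sum (Poly_Mapping.lookup x) \<tau> \<le> sum (Poly_Mapping.lookup x) (insert a \<tau>)"
    by (rule sum_mono2) (use fin WD(2)[OF x(1)] in auto)
  ultimately show False using WD(3)[OF x(1)] by simp
qed

text \<open>
  The disc below is the union of the two simplices \<open>\<tau> \<union> {a}\<close> and \<open>\<tau> \<union> {b}\<close> glued along \<open>\<tau>\<close>, parametrized
  by the positive orthant: \<open>\<tau>\<close> corresponds to the hyperplane where the coordinates sum up to 1.
\<close>

lemma coface_of_ridge:
  assumes \<tau>: "\<tau> \<in> S" "card \<tau> = DIM('e)" and ab: "a \<noteq> b" "a \<notin> \<tau>" "b \<notin> \<tau>"
    and cof: "insert a \<tau> \<in> S" "insert b \<tau> \<in> S" and \<rho>: "\<rho> \<in> S" "\<tau> \<subseteq> \<rho>"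
  shows "\<rho> \<subseteq> insert a \<tau> \<or> \<rho> \<subseteq> insert b \<tau>"
proof -
  have fin: "finite \<tau>" "finite \<rho>" using finite_simplex \<tau> \<rho> by auto
  have ne: "\<tau> \<noteq> {}" using \<tau>(2) by auto
  obtain e where e: "bij_betw e \<tau> (Basis :: 'e set)"
    using finite_same_card_bij[OF fin(1) finite_Basis] \<tau>(2) by auto
  have eB: "e v \<in> Basis" if "v \<in> \<tau>" for v using e that by (auto simp: bij_betw_def)
  define s where "s z = (\<Sum>v\<in>\<tau>. z \<bullet> e v)" for z :: 'e
  define m where "m z = max 1 (s z)" for z
  define Z where "Z = {z. \<forall>v\<in>\<tau>. 0 < z \<bullet> e v}"
  \<comment> \<open>If \<open>s z \<le> 1\<close>, then \<open>m z = 1\<close>: the coordinates of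
    \<open>z\<close> are used at \<tau> and the rest \<open>1 - s z\<close> goes to
    \<open>a\<close>. If \<open>s z > 1\<close>, dividing by the square of \<open>s z\<close> makes
    the coordinates at \<tau> add up to \<open>1 / s z\<close>, and the rest goes to
    \<open>b\<close>. The coordinate at \<open>b\<close> determines \<open>m z\<close>, whence
    injectivity.\<close>
  define B where "B z = (\<Sum>v\<in>\<tau>. ((z \<bullet> e v) / (m z)\<^sup>2) *\<^sub>R unit_vec v) +
    (1 - min 1 (s z)) *\<^sub>R unit_vec a + (1 - 1 / m z) *\<^sub>R unit_vec b" for z
  have m1: "m z \<ge> 1" for z by (simp add: m_def)
  then have m0: "m z \<noteq> 0" for z by (metis not_one_le_zero)
  have lookB: "Poly_Mapping.lookup (B z) w = (if w \<in> \<tau> then (z \<bullet> e w) / (m z)\<^sup>2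
     else if w = a then 1 - min 1 (s z) else if w = b then 1 - 1 / m z else 0)" for z w
    using ab by (auto simp: B_def lookup_add lookup_sum_unit_vec[OF fin(1)])
  have Z: "open Z" unfolding Z_def
    by (intro open_Collect_finite_ball fin open_Collect_less continuous_intros continuous_on_id)
  have cs: "continuous_on Z s" unfolding s_def by (intro continuous_intros)
  then have cm: "continuous_on Z m" unfolding m_def by (intro continuous_intros)
  have "continuous_on Z B" unfolding B_def
    by (intro continuous_intros cs cm) (use m0 in auto)
  moreover have "inj_on B Z"
  proof (rule inj_onI)
    fix y z assume yz: "y \<in> Z" "z \<in> Z" "B y = B z"
    have mb: "1 - 1 / m y = 1 - 1 / m z"
      using lookB[of y b] lookB[of z b] ab unfolding yz(3) by simp
    have "1 / m y = 1 / m z" using mb by linarith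
    then have m: "m y = m z" using m0[of y] m0[of z] by (metis divide_divide_eq_right div_by_1 mult_1)
    have v: "y \<bullet> e v = z \<bullet> e v" if "v \<in> \<tau>" for v
    proof -
      have "(y \<bullet> e v) / (m y)\<^sup>2 = (z \<bullet> e v) / (m z)\<^sup>2"
        using lookB[of y v] lookB[of z v] that unfolding yz(3) by simp
      moreover have "(m z)\<^sup>2 \<noteq> 0" using m0[of z] by simp
      ultimately show ?thesis unfolding m by (metis divide_cancel_right)
    qed
    show "y = z"
    proof (rule euclidean_eqI)
      fix b :: 'e assume "b \<in> Basis"
      then have "b \<in> e ` \<tau>" using e by (simp add: bij_betw_def)
      then show "y \<bullet> b = z \<bullet> b" using v by blast
    qed
  qed
  moreover have BR: "B z \<in> R \<and> (Poly_Mapping.keys (B z) \<subseteq> insert a \<tau> \<or> Poly_Mapping.keys (B z) \<subseteq> insert b \<tau>)"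
    if "z \<in> Z" for z
  proof -
    have zpos: "0 < z \<bullet> e v" if "v \<in> \<tau>" for v using that \<open>z \<in> Z\<close> by (auto simp: Z_def)
    have nonneg: "0 \<le> Poly_Mapping.lookup (B z) v" for v
      using zpos m1[of z] by (auto simp: lookB less_imp_le)
    have s\<tau>: "sum (Poly_Mapping.lookup (B z)) \<tau> = s z / (m z)\<^sup>2"
      by (simp add: lookB s_def sum_divide_distrib)
    show ?thesis
    proof (cases "s z \<le> 1")
      case True
      then have m: "m z = 1" by (simp add: m_def)
      have keys: "Poly_Mapping.keys (B z) \<subseteq> insert a \<tau>"
        by (auto simp: in_keys_iff lookB m split: if_splits)
      have "sum (Poly_Mapping.lookup (B z)) (insert a \<tau>) = 1"
        using fin ab s\<tau> True m by (simp add: lookB[of z a])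
      then have "B z \<in> std_simplex (insert a \<tau>)"
        using keys nonneg fin by (subst mem_simplex_iff) auto
      then show ?thesis using keys simplex_subset_realization[OF cof(1)] by blast
    next
      case False
      then have m: "m z = s z" "s z > 1" by (auto simp: m_def)
      have keys: "Poly_Mapping.keys (B z) \<subseteq> insert b \<tau>"
        using m by (auto simp: in_keys_iff lookB split: if_splits)
      have "sum (Poly_Mapping.lookup (B z)) (insert b \<tau>) = 1"
        using fin ab s\<tau> m by (simp add: lookB[of z b] power2_eq_square)
      then have "B z \<in> std_simplex (insert b \<tau>)"
        using keys nonneg fin by (subst mem_simplex_iff) auto
      then show ?thesis using keys simplex_subset_realization[OF cof(2)] by blast
    qed
  qed
  ultimately have "openin (top_of_set R) (B ` Z)"
    using openin_image_of_open[OF Z] by blast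
  then obtain U where U: "open U" "B ` Z = R \<inter> U" by (auto simp: openin_open)
  have Bb: "barycentre \<tau> \<in> B ` Z"
  proof
    let ?p = "\<Sum>v\<in>\<tau>. (1 / card \<tau>) *\<^sub>R e v"
    have p: "?p \<bullet> e w = 1 / card \<tau>" if "w \<in> \<tau>" for w
    proof -
      have "?p \<bullet> e w = (\<Sum>v\<in>\<tau>. if v = w then 1 / card \<tau> else 0)"
        unfolding inner_sum_left
      proof (rule sum.cong)
        fix v assume "v \<in> \<tau>"
        then have "e v = e w \<longleftrightarrow> v = w" using e that by (auto simp: bij_betw_def inj_on_def)
        then show "(1 / card \<tau>) *\<^sub>R e v \<bullet> e w = (if v = w then 1 / card \<tau> else 0)"
          using eB \<open>v \<in> \<tau>\<close> that by (simp add: inner_Basis)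
      qed simp
      then show ?thesis using fin that by simp
    qed
    have "card \<tau> > 0" using fin ne by (simp add: card_gt_0_iff)
    then have s: "s ?p = 1" using p by (simp add: s_def)
    show "?p \<in> Z" using p \<open>card \<tau> > 0\<close> by (simp add: Z_def)
    show "barycentre \<tau> = B ?p"
      by (rule poly_mapping_eqI) (simp add: lookB lookup_barycentre fin p s m_def)
  qed
  then have "barycentre \<tau> \<in> U" using U by auto
  then obtain t where t: "0 < t" "t \<le> 1" "barycentre \<tau> + t *\<^sub>R (barycentre \<rho> - barycentre \<tau>) \<in> U"
    by (rule open_contains_short_step[OF U(1)])
  \<comment> \<open>The disc is open, so it contains a point whose support is all of \<rho>, whereas
    supports of its points lie in \<open>insert a \<tau>\<close> or
    \<open>insert b \<tau>\<close>.\<close>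
  note y = step_to_barycentre[OF fin(2) \<rho>(2) ne t(1,2)]
  have "barycentre \<tau> + t *\<^sub>R (barycentre \<rho> - barycentre \<tau>) \<in> B ` Z"
    using U(2) t(3) y(1) simplex_subset_realization[OF \<rho>(1)] by auto
  then obtain z where "z \<in> Z" "barycentre \<tau> + t *\<^sub>R (barycentre \<rho> - barycentre \<tau>) = B z"
    by (rule imageE) simp
  then show ?thesis using BR[of z] y(2) by simp
qed

end

context PL_euclidean_complex
begin

text \<open>A larger simplex would have a face consisting of \<open>DIM('e)\<close> vertices \<tau>
  and two more, \<open>a\<close> and \<open>b\<close>. This face is a coface of \<tau> lying in
  neither \<open>insert a \<tau>\<close> nor \<open>insert b \<tau>\<close>.\<close>

lemma card_simplex_le:
  assumes \<sigma>: "\<sigma> \<in> S"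
  shows "card \<sigma> \<le> DIM('e) + 1"
proof (rule ccontr)
  assume "\<not> card \<sigma> \<le> DIM('e) + 1"
  then have "DIM('e) + 2 \<le> card \<sigma>" by linarith
  then obtain \<rho> where \<rho>: "\<rho> \<subseteq> \<sigma>" "card \<rho> = DIM('e) + 2" "finite \<rho>"
    by (rule obtain_subset_with_card_n)
  then obtain a \<rho>' where a: "\<rho> = insert a \<rho>'" "a \<notin> \<rho>'" "card \<rho>' = DIM('e) + 1"
    using card_Suc_eq[of \<rho> "DIM('e) + 1"] by auto
  then obtain b \<tau> where b: "\<rho>' = insert b \<tau>" "b \<notin> \<tau>" "card \<tau> = DIM('e)"
    using card_Suc_eq[of \<rho>' "DIM('e)"] by auto
  have "\<rho> \<subseteq> insert a \<tau> \<or> \<rho> \<subseteq> insert b \<tau>"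
    by (rule coface_of_ridge) (use a b \<rho> in \<open>auto intro: subset_mem[OF \<sigma>]\<close>)
  then show False using a b by auto
qed

lemma exists_two_cofaces:
  assumes \<tau>: "\<tau> \<in> S" "\<tau> \<noteq> {}" "card \<tau> \<le> DIM('e)"
  obtains a b where "a \<noteq> b" "a \<notin> \<tau>" "b \<notin> \<tau>" "insert a \<tau> \<in> S" "insert b \<tau> \<in> S"
proof -
  obtain v where "v \<in> \<tau>" using \<tau>(2) by blast
  \<comment> \<open>With a vertex of \<tau> itself in the role of \<open>a\<close>,
    \<open>exists_proper_coface\<close> yields some proper coface.\<close>
  then have "insert v \<tau> = \<tau>" by blast
  then obtain \<rho> where \<rho>: "\<rho> \<in> S" "\<tau> \<subseteq> \<rho>" "\<not> \<rho> \<subseteq> \<tau>"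
    using exists_proper_coface[OF \<tau>, of v] by auto
  then obtain a where a: "a \<in> \<rho>" "a \<notin> \<tau>" by blast
  obtain \<rho>' where \<rho>': "\<rho>' \<in> S" "\<tau> \<subseteq> \<rho>'" "\<not> \<rho>' \<subseteq> insert a \<tau>"
    using exists_proper_coface[OF \<tau>, of a] by auto
  then obtain b where b: "b \<in> \<rho>'" "b \<notin> insert a \<tau>" by blast
  have "insert a \<tau> \<in> S" "insert b \<tau> \<in> S"
    using \<rho> \<rho>' a b by (auto intro: subset_mem)
  then show thesis using a b that[of a b] by auto
qed

text \<open>A maximal simplex above a nonempty \<sigma> has full size because smaller nonempty
  simplices have proper cofaces. For the empty simplex, the support of a point of the realization is
  the starting point.\<close>

lemma exists_facet:
  assumes \<sigma>: "\<sigma> \<in> S"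
  shows "\<exists>F\<in>S. \<sigma> \<subseteq> F \<and> card F = DIM('e) + 1"
proof -
  have nonempty_case: "\<exists>F\<in>S. \<sigma> \<subseteq> F \<and> card F = DIM('e) + 1" if \<sigma>: "\<sigma> \<in> S" "\<sigma> \<noteq> {}" for \<sigma>
  proof -
    obtain F where F: "F \<in> S" "\<sigma> \<subseteq> F" "\<And>G. G \<in> S \<Longrightarrow> F \<subseteq> G \<Longrightarrow> G = F"
      using finite_has_maximal2[OF finiteS \<sigma>(1)] by metis
    have "\<not> card F \<le> DIM('e)"
    proof
      assume "card F \<le> DIM('e)"
      moreover have "F \<noteq> {}" using F \<sigma> by auto
      ultimately obtain a b where "a \<notin> F" "insert a F \<in> S"
        using exists_two_cofaces[OF F(1)] by metis
      then show False using F(3)[of "insert a F"] by blast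
    qed
    then show ?thesis using F card_simplex_le[OF F(1)] by (intro bexI[of _ F]) auto
  qed
  show ?thesis
  proof (cases "\<sigma> = {}")
    case True
    obtain x where "x \<in> R" using nonempty by blast
    then have x: "Poly_Mapping.keys x \<in> S" "sum (Poly_Mapping.lookup x) (Poly_Mapping.keys x) = 1"
      by (auto simp: mem_geometric_realization_iff[OF complex])
    then have "Poly_Mapping.keys x \<noteq> {}" by auto
    then show ?thesis using nonempty_case[OF x(1)] True by auto
  qed (rule nonempty_case[OF \<sigma>])
qed

lemma link_ridge:
  assumes \<tau>: "\<tau> \<in> S" "card \<tau> = DIM('e)"
  shows "\<exists>a b. a \<noteq> b \<and> link S \<tau> = {{}, {a}, {b}}"
proof -
  have ne: "\<tau> \<noteq> {}" using \<tau>(2) by auto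
  obtain a b where ab: "a \<noteq> b" "a \<notin> \<tau>" "b \<notin> \<tau>" "insert a \<tau> \<in> S" "insert b \<tau> \<in> S"
    using exists_two_cofaces[OF \<tau>(1) ne] \<tau>(2) by auto
  have "\<gamma> \<in> link S \<tau> \<longleftrightarrow> \<gamma> \<in> {{}, {a}, {b}}" for \<gamma>
  proof
    assume "\<gamma> \<in> link S \<tau>"
    then have \<gamma>: "\<gamma> \<inter> \<tau> = {}" "\<gamma> \<union> \<tau> \<in> S" by (auto simp: link_def)
    have "\<gamma> \<union> \<tau> \<subseteq> insert a \<tau> \<or> \<gamma> \<union> \<tau> \<subseteq> insert b \<tau>"
      using coface_of_ridge[OF \<tau> ab \<gamma>(2)] by simp
    then have "\<gamma> \<subseteq> {a} \<or> \<gamma> \<subseteq> {b}" using \<gamma>(1) by blast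
    then show "\<gamma> \<in> {{}, {a}, {b}}" by auto
  next
    assume "\<gamma> \<in> {{}, {a}, {b}}"
    moreover have "{} \<in> S" "{a} \<in> S" "{b} \<in> S"
      using subset_mem[OF \<tau>(1), of "{}"] subset_mem[OF ab(4), of "{a}"] subset_mem[OF ab(5), of "{b}"]
      by auto
    ultimately show "\<gamma> \<in> link S \<tau>" using ab \<tau> by (auto simp: link_def)
  qed
  then show ?thesis using ab(1) by blast
qed

section \<open>Chains of facets across ridges\<close>

lemma closed_carrier:
  assumes "\<F> \<subseteq> S"
  shows "closed (\<Union>F\<in>\<F>. std_simplex F)"
proof (rule closed_UN)
  show "finite \<F>" using assms finiteS finite_subset by blast
  show "\<forall>F\<in>\<F>. closed (std_simplex F)"
  proof
    fix F assume "F \<in> \<F>"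
    then have "finite F" using assms finite_simplex by blast
    then show "closed (std_simplex F)" by (intro polytope_imp_closed polytope_convex_hull) simp
  qed
qed

text \<open>
  If the facets split into two classes without common ridges, then removing from the open star of a
  maximal common face \<open>\<rho>\<close> the simplex \<open>\<rho>\<close>, whose codimension is at least 2, disconnects it.
  In a chart this would mean that finitely many affine subspaces of codimension at least 2
  disconnect a ball.
\<close>

lemma facets_connected:
  assumes cover: "{F \<in> S. card F = DIM('e) + 1} = \<A> \<union> \<B>" and disj: "\<A> \<inter> \<B> = {}"
    and nonempty: "\<A> \<noteq> {}" "\<B> \<noteq> {}"
  shows "\<exists>F\<in>\<A>. \<exists>G\<in>\<B>. card (F \<inter> G) = DIM('e)"
proof (rule ccontr)
  let ?d = "DIM('e)"
  assume no_ridge: "\<not> (\<exists>F\<in>\<A>. \<exists>G\<in>\<B>. card (F \<inter> G) = ?d)"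
  have AS: "\<A> \<subseteq> S" "\<B> \<subseteq> S" and cardA: "\<And>F. F \<in> \<A> \<union> \<B> \<Longrightarrow> card F = ?d + 1"
    using cover by blast+
  have finA: "finite F" if "F \<in> \<A> \<union> \<B>" for F using that AS finite_simplex by blast
  have finAB: "finite \<A>" "finite \<B>" using AS finiteS finite_subset by blast+
  let ?I = "(\<lambda>(F, G). card (F \<inter> G)) ` (\<A> \<times> \<B>)"
  have I: "finite ?I" "?I \<noteq> {}" using finAB nonempty by auto
  from Max_in[OF I] obtain p where p: "Max ?I = (\<lambda>(F, G). card (F \<inter> G)) p" "p \<in> \<A> \<times> \<B>"
    by (rule imageE)
  obtain F G where "p = (F, G)" by (cases p)
  with p have FG: "F \<in> \<A>" "G \<in> \<B>" "card (F \<inter> G) = Max ?I" by simp_all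
  define \<rho> where "\<rho> = F \<inter> G"
  have max: "card (F' \<inter> G') \<le> card \<rho>" if "F' \<in> \<A>" "G' \<in> \<B>" for F' G'
  proof -
    have "(\<lambda>(F, G). card (F \<inter> G)) (F', G') \<in> ?I" by (intro imageI SigmaI that)
    from Max_ge[OF I(1) this] show ?thesis unfolding \<rho>_def FG(3) prod.case .
  qed
  have \<rho>S: "\<rho> \<in> S" unfolding \<rho>_def by (rule subset_mem[OF subsetD[OF AS(1) FG(1)]]) simp
  have fin\<rho>: "finite \<rho>" using finite_simplex[OF \<rho>S] .
  have card_\<rho>: "card \<rho> < ?d"
  proof -
    have "F \<noteq> G" using FG(1,2) disj by auto
    then have "\<not> F \<subseteq> G" using card_subset_eq[of G F] finA cardA FG(1,2) by auto
    then have "\<rho> \<subset> F" by (auto simp: \<rho>_def)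
    then have "card \<rho> < card F" using psubset_card_mono[OF finA] FG(1,2) by auto
    moreover have "card \<rho> \<noteq> ?d" using no_ridge FG(1,2) by (auto simp: \<rho>_def)
    ultimately show ?thesis using cardA FG(1,2) by auto
  qed
  define K where "K \<F> = (\<Union>F\<in>\<F>. std_simplex F)" for \<F>
  have closedK: "closed (K \<A>)" "closed (K \<B>)"
    unfolding K_def using closed_carrier AS by auto
  have RK: "R = K \<A> \<union> K \<B>"
  proof
    show "R \<subseteq> K \<A> \<union> K \<B>"
    proof
      fix x assume "x \<in> R"
      then obtain \<sigma> where \<sigma>: "\<sigma> \<in> S" "x \<in> std_simplex \<sigma>" by (auto simp: geometric_realization_def)
      obtain H where H: "H \<in> S" "\<sigma> \<subseteq> H" "card H = ?d + 1" using exists_facet[OF \<sigma>(1)] by auto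
      then have "H \<in> \<A> \<union> \<B>" using cover by blast
      moreover have "std_simplex \<sigma> \<subseteq> std_simplex H" using H(2) by (intro hull_mono image_mono)
      ultimately show "x \<in> K \<A> \<union> K \<B>" using \<sigma>(2) unfolding K_def by blast
    qed
    show "K \<A> \<union> K \<B> \<subseteq> R" using simplex_subset_realization AS by (auto simp: K_def)
  qed
  have keysK: "\<exists>H\<in>\<F>. Poly_Mapping.keys x \<subseteq> H" if xF: "x \<in> K \<F>" "\<F> \<subseteq> \<A> \<union> \<B>" for x \<F>
  proof -
    obtain H where H: "H \<in> \<F>" "x \<in> std_simplex H" using xF(1) unfolding K_def by blast
    then have "finite H" using xF(2) finA by blast
    then show ?thesis using H by (auto simp: mem_simplex_iff)
  qed
  have keysR: "Poly_Mapping.keys x \<noteq> {}" if "x \<in> R" for x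
    using that by (auto simp: mem_geometric_realization_iff[OF complex])
  \<comment> \<open>By maximality of \<rho>: the support of a point common to both carriers lies in
    an intersection of facets of different classes, which has at most \<open>card \<rho>\<close>
    vertices.\<close>
  have inter: "Poly_Mapping.keys x = \<rho>" if x: "x \<in> K \<A>" "x \<in> K \<B>" "\<rho> \<subseteq> Poly_Mapping.keys x" for x
  proof -
    obtain F' G' where H: "F' \<in> \<A>" "Poly_Mapping.keys x \<subseteq> F'" "G' \<in> \<B>" "Poly_Mapping.keys x \<subseteq> G'"
      using keysK[OF x(1)] keysK[OF x(2)] by blast
    have "card (Poly_Mapping.keys x) \<le> card (F' \<inter> G')"
      using H finA by (intro card_mono) auto
    also have "\<dots> \<le> card \<rho>" using max H by blast
    finally show ?thesis using x(3) card_seteq[OF finite_keys, of \<rho> x] by simp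
  qed
  \<comment> \<open>An empty \<rho> would make the two closed carriers disjoint and so split the
    connected realization.\<close>
  have \<rho>ne: "\<rho> \<noteq> {}"
  proof
    assume \<rho>0: "\<rho> = {}"
    have "K \<A> \<inter> K \<B> \<inter> R = {}"
      using inter[unfolded \<rho>0] keysR by blast
    moreover have "F \<noteq> {}" "G \<noteq> {}" using cardA FG(1,2) by force+
    then have "barycentre F \<in> K \<A>" "barycentre G \<in> K \<B>"
      unfolding K_def using barycentre_in_simplex finA FG(1,2) by blast+
    then have "K \<A> \<inter> R \<noteq> {}" "K \<B> \<inter> R \<noteq> {}" using RK by auto
    ultimately show False
      using connected closedK RK unfolding connected_closed by blast
  qed
  let ?y = "barycentre \<rho>"
  have y: "?y \<in> R" using barycentre_in_simplex[OF fin\<rho> \<rho>ne] simplex_subset_realization[OF \<rho>S] by blast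
  then obtain X and \<theta> :: "(nat \<Rightarrow>\<^sub>0 real) \<Rightarrow> 'e" and \<psi> where X: "?y \<in> X" "openin (top_of_set R) X"
    "homeomorphism X (\<theta> ` X) \<theta> \<psi>" "open (\<theta> ` X)" "PL_on X \<theta>"
    by (rule chartE)
  from X(5,1) obtain \<P> N where P: "finite \<P>" "\<forall>P\<in>\<P>. polytope P \<and> P \<subseteq> X \<and> affine_map_on P \<theta>"
    "openin (top_of_set X) N" "?y \<in> N" "N \<subseteq> \<Union>\<P>"
    by (rule PL_onE)
  have inv: "\<psi> (\<theta> x) = x" if "x \<in> X" for x using X(3) that by (simp add: homeomorphism_def)
  define D0 where "D0 = N \<inter> {x \<in> R. \<forall>v\<in>\<rho>. 0 < Poly_Mapping.lookup x v}"
  have NX: "N \<subseteq> X" using openin_imp_subset[OF P(3)] .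
  have XR: "X \<subseteq> R" using openin_imp_subset[OF X(2)] .
  have "openin (top_of_set R) D0"
    unfolding D0_def using openin_trans[OF P(3) X(2)] openin_open_star[OF fin\<rho>] by blast
  have y_star: "\<forall>v\<in>\<rho>. 0 < Poly_Mapping.lookup ?y v"
    using fin\<rho> by (auto simp: lookup_barycentre card_gt_0_iff)
  have "?y \<in> D0" using P y y_star by (auto simp: D0_def)
  have "open (\<theta> ` D0)"
    by (rule chart_open_image[OF X(2-4) \<open>openin (top_of_set R) D0\<close>]) (use NX in \<open>auto simp: D0_def\<close>)
  then obtain r where r: "r > 0" "ball (\<theta> ?y) r \<subseteq> \<theta> ` D0"
    using \<open>?y \<in> D0\<close> openE by blast
  let ?ball = "ball (\<theta> ?y) r"
  \<comment> \<open>The neighbourhood is cut down until its chart image is exactly a ball; it stays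
    in the open star of \<rho> and in the region covered by \<open>\<P>\<close>.\<close>
  define D where "D = D0 \<inter> (X \<inter> \<theta> -` ?ball)"
  have "openin (top_of_set X) (X \<inter> \<theta> -` ?ball)"
    by (rule continuous_openin_preimage_gen[OF homeomorphism_cont1[OF X(3)] open_ball])
  then have D: "openin (top_of_set R) D"
    unfolding D_def using openin_trans[OF _ X(2)] \<open>openin (top_of_set R) D0\<close> by blast
  have yD: "?y \<in> D" using \<open>?y \<in> D0\<close> X(1) r by (auto simp: D_def)
  have DX: "D \<subseteq> X" by (auto simp: D_def)
  have DN: "D \<subseteq> N" by (auto simp: D_def D0_def)
  have D_star: "\<rho> \<subseteq> Poly_Mapping.keys x" if "x \<in> D" for x
    using that by (auto simp: D_def D0_def in_keys_iff dest!: bspec)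
  have \<theta>D: "\<theta> ` D = ?ball"
  proof
    show "?ball \<subseteq> \<theta> ` D"
    proof
      fix z assume z: "z \<in> ?ball"
      then obtain x where "x \<in> D0" "z = \<theta> x" using r(2) by blast
      then have "x \<in> D" using z NX unfolding D_def D0_def by blast
      then show "z \<in> \<theta> ` D" using \<open>z = \<theta> x\<close> by blast
    qed
  qed (auto simp: D_def)
  \<comment> \<open>The chart image of \<rho> is only piecewise flat. Each piece spans an affine
    subspace of dimension at most \<open>card \<rho> - 1\<close>, and
    \<open>card \<rho> < DIM('e)\<close> gives codimension at least 2.\<close>
  define \<L> where "\<L> = (\<lambda>P. affine hull (\<theta> ` (P \<inter> std_simplex \<rho>))) ` \<P>"
  have L: "affine L \<and> aff_dim L \<le> int ?d - 2" if "L \<in> \<L>" for L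
  proof -
    obtain P' where P': "P' \<in> \<P>" "L = affine hull (\<theta> ` (P' \<inter> std_simplex \<rho>))"
      using \<open>L \<in> \<L>\<close> by (auto simp: \<L>_def)
    have "aff_dim (\<theta> ` (P' \<inter> std_simplex \<rho>)) \<le> int (card \<rho>) - 1"
      using P(2) P'(1)
      by (intro aff_dim_affine_image_le fin\<rho> convex_Int) (auto intro: polytope_imp_convex affine_map_on_subset)
    then show ?thesis using P' card_\<rho> by simp
  qed
  have finL: "finite \<L>" using P(1) by (simp add: \<L>_def)
  have conn: "Topological_Spaces.connected (?ball - \<Union>\<L>)"
    by (rule connected_ball_diff_affine[OF finL L])
  have "closed (\<Union>\<L>) \<and> interior (\<Union>\<L>) = {}"
    by (rule interior_finite_Union_eq_empty[OF finL]) (use L interior_low_aff_dim in \<open>force simp: \<L>_def\<close>)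
  then have intL: "\<not> U \<subseteq> \<Union>\<L>" if "open U" "U \<noteq> {}" for U
    using that interior_maximal[of U "\<Union>\<L>"] by auto
  have open_piece: "open (\<theta> ` (D - K \<F>))" if "closed (K \<F>)" for \<F>
  proof (rule chart_open_image[OF X(2-4)])
    show "openin (top_of_set R) (D - K \<F>)"
      unfolding Diff_eq using that by (intro openin_Int_open D open_Compl)
    show "D - K \<F> \<subseteq> X" using DX by auto
  qed
  \<comment> \<open>A short step from the barycentre of \<rho> towards that of a facet
    \<open>H\<close> gives a point of \<open>D\<close> with support \<open>H\<close>, which no other
    facet carries.\<close>
  have meets: "\<theta> ` (D - K \<F>) \<noteq> {}" if H: "H \<in> \<A> \<union> \<B>" "\<rho> \<subseteq> H" "\<F> \<subseteq> \<A> \<union> \<B>" "H \<notin> \<F>" for H \<F>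
  proof -
    obtain O' where O': "open O'" "D = R \<inter> O'" using D by (auto simp: openin_open)
    then have "?y \<in> O'" using yD by auto
    obtain t where t: "0 < t" "t \<le> 1" "?y + t *\<^sub>R (barycentre H - ?y) \<in> O'"
      by (rule open_contains_short_step[OF O'(1) \<open>?y \<in> O'\<close>])
    note st = step_to_barycentre[OF finA[OF H(1)] H(2) \<rho>ne t(1,2)]
    have "?y + t *\<^sub>R (barycentre H - ?y) \<in> D"
      using st(1) t(3) O'(2) H(1) AS simplex_subset_realization by blast
    moreover have "?y + t *\<^sub>R (barycentre H - ?y) \<notin> K \<F>"
    proof
      assume "?y + t *\<^sub>R (barycentre H - ?y) \<in> K \<F>"
      then obtain H' where H': "H' \<in> \<F>" "H \<subseteq> H'" using keysK[OF _ H(3)] st(2) by blast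
      then have "H = H'" using card_subset_eq[of H' H] finA cardA H by auto
      then show False using H' H(4) by simp
    qed
    ultimately show ?thesis by blast
  qed
  let ?UA = "\<theta> ` (D - K \<B>)" and ?UB = "\<theta> ` (D - K \<A>)"
  have UAB: "?UA \<inter> ?UB \<inter> (?ball - \<Union>\<L>) = {}"
  proof -
    have False if "x \<in> D - K \<B>" "x' \<in> D - K \<A>" "\<theta> x = \<theta> x'" for x x'
    proof -
      have "x = x'" using inv[of x] inv[of x'] that DX by auto
      then show False using that RK DX XR by blast
    qed
    then show ?thesis by blast
  qed
  have cover_ball: "?ball - \<Union>\<L> \<subseteq> ?UA \<union> ?UB"
  proof
    fix z assume z: "z \<in> ?ball - \<Union>\<L>"
    then obtain x where x: "x \<in> D" "z = \<theta> x" using \<theta>D by blast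
    have "\<not> (x \<in> K \<A> \<and> x \<in> K \<B>)"
    proof
      assume "x \<in> K \<A> \<and> x \<in> K \<B>"
      then have "Poly_Mapping.keys x = \<rho>" using inter D_star[OF x(1)] by blast
      moreover have "x \<in> R" using x DX XR by blast
      ultimately have "x \<in> std_simplex \<rho>"
        by (auto simp: mem_geometric_realization_iff[OF complex] mem_simplex_iff)
      moreover obtain P' where "P' \<in> \<P>" "x \<in> P'" using P(5) DN x(1) by blast
      ultimately have "z \<in> \<Union>\<L>" unfolding \<L>_def x(2) by (blast intro: hull_inc)
      then show False using z by blast
    qed
    then show "z \<in> ?UA \<union> ?UB" using x by blast
  qed
  have "?UA \<inter> (?ball - \<Union>\<L>) \<noteq> {}"
  proof -
    have "?UA \<noteq> {}" by (rule meets[of F]) (use FG(1,2) disj in \<open>auto simp: \<rho>_def\<close>)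
    then have "\<not> ?UA \<subseteq> \<Union>\<L>" using intL open_piece closedK by blast
    moreover have "?UA \<subseteq> ?ball" using \<theta>D by blast
    ultimately show ?thesis by blast
  qed
  moreover have "?UB \<inter> (?ball - \<Union>\<L>) \<noteq> {}"
  proof -
    have "?UB \<noteq> {}" by (rule meets[of G]) (use FG(1,2) disj in \<open>auto simp: \<rho>_def\<close>)
    then have "\<not> ?UB \<subseteq> \<Union>\<L>" using intL open_piece closedK by blast
    moreover have "?UB \<subseteq> ?ball" using \<theta>D by blast
    ultimately show ?thesis by blast
  qed
  ultimately show False
    using connectedD[OF conn open_piece[OF closedK(2)] open_piece[OF closedK(1)] UAB cover_ball]
    by blast
qed

lemma closed_pseudomanifold: "closed_pseudomanifold (DIM('e)) S"
proof
  show "simplicial_complex S" by (rule complex)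
  show "\<exists>F\<in>S. \<sigma> \<subseteq> F \<and> card F = DIM('e) + 1" if "\<sigma> \<in> S" for \<sigma> using exists_facet that .
  show "card \<sigma> \<le> DIM('e) + 1" if "\<sigma> \<in> S" for \<sigma> using card_simplex_le that .
  show "\<exists>a b. a \<noteq> b \<and> link S \<tau> = {{}, {a}, {b}}" if "\<tau> \<in> S" "card \<tau> = DIM('e)" for \<tau>
    using link_ridge that .
  fix F G and P :: "nat set \<Rightarrow> bool"
  assume F: "F \<in> S" "card F = DIM('e) + 1" "P F"
    and step: "\<And>G H. G \<in> S \<Longrightarrow> card G = DIM('e) + 1 \<Longrightarrow> H \<in> S \<Longrightarrow> card H = DIM('e) + 1 \<Longrightarrow>
        card (G \<inter> H) = DIM('e) \<Longrightarrow> P G \<Longrightarrow> P H"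
    and G: "G \<in> S" "card G = DIM('e) + 1"
  show "P G"
  proof (rule ccontr)
    assume nP: "\<not> P G"
    \<comment> \<open>The facets are divided according to \<open>P\<close>; a ridge between the two
      classes contradicts \<open>step\<close>.\<close>
    have "\<exists>F\<in>{F \<in> S. card F = DIM('e) + 1 \<and> P F}. \<exists>G\<in>{F \<in> S. card F = DIM('e) + 1 \<and> \<not> P F}.
        card (F \<inter> G) = DIM('e)"
      by (rule facets_connected) (use F G nP in auto)
    then show False using step by blast
  qed
qed

end

lemma PL_euclidean_complex_of_triangulation:
  fixes M :: "('m, 'e::euclidean_space) charted_space"
  assumes M: "closed_connected_PL_manifold d M" and S: "triangulates M S"
  shows "PL_euclidean_complex TYPE('e) S"
proof
  let ?R = "geometric_realization S"
  obtain h where h: "homeomorphic_map (top_of_set ?R) (underlying M) h"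
    and PL: "\<And>U \<phi>. (U, \<phi>) \<in> charts M \<Longrightarrow> PL_on {x \<in> ?R. h x \<in> U} (\<phi> \<circ> h)"
    using S by (auto simp: triangulates_def PL_homeomorphism_def)
  have PLM: "PL_manifold d M" using M by (simp add: closed_connected_PL_manifold_def)
  have hR: "h ` ?R = topspace (underlying M)"
    using homeomorphic_imp_surjective_map[OF h] by simp
  show "simplicial_complex S" using S by (simp add: triangulates_def)
  have "topspace (underlying M) \<noteq> {}" using M unfolding closed_connected_PL_manifold_def by blast
  then show "?R \<noteq> {}" using hR by (metis image_empty)
  have "connected_space (underlying M)" using M unfolding closed_connected_PL_manifold_def by blast
  then have "connected_space (top_of_set ?R)"
    using homeomorphic_connected_space[OF homeomorphic_map_imp_homeomorphic_space[OF h]] by blast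
  then have "connectedin euclidean ?R" by (simp add: connectedin_def)
  then show "Topological_Spaces.connected ?R" by simp
  fix x assume x: "x \<in> ?R"
  then have "h x \<in> topspace (underlying M)" using hR by blast
  then have "h x \<in> \<Union>(fst ` charts M)" using PLM by (simp add: PL_manifold_def)
  then obtain U \<phi> where U: "(U, \<phi>) \<in> charts M" "h x \<in> U" by auto
  have Uo: "openin (underlying M) U" "open (\<phi> ` U)"
    "homeomorphic_map (subtopology (underlying M) U) (top_of_set (\<phi> ` U)) \<phi>"
    using PLM U(1) by (auto simp: PL_manifold_def)
  have UM: "U \<subseteq> topspace (underlying M)" using openin_subset[OF Uo(1)] .
  let ?X = "{x \<in> ?R. h x \<in> U}"
  obtain h' where h': "homeomorphic_maps (top_of_set ?R) (underlying M) h h'"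
    using h by (auto simp: homeomorphic_map_maps)
  obtain \<psi> where \<psi>: "homeomorphic_maps (subtopology (underlying M) U) (top_of_set (\<phi> ` U)) \<phi> \<psi>"
    using Uo(3) by (auto simp: homeomorphic_map_maps)
  have hX: "h ` ?X = U"
  proof
    show "U \<subseteq> h ` ?X"
    proof
      fix u assume u: "u \<in> U"
      then have "u \<in> h ` ?R" using UM unfolding hR by blast
      then show "u \<in> h ` ?X" using u by auto
    qed
  qed auto
  have "h ` (topspace (top_of_set ?R) \<inter> ?X) = topspace (underlying M) \<inter> U"
    using hX UM by (simp add: Int_absorb1 Int_absorb2)
  then have "homeomorphic_maps (subtopology (top_of_set ?R) ?X) (subtopology (underlying M) U) h h'"
    using homeomorphic_maps_subtopologies[OF h'] by blast
  moreover have "subtopology (top_of_set ?R) ?X = top_of_set ?X"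
    unfolding subtopology_subtopology by (rule arg_cong[of _ _ top_of_set]) auto
  ultimately have "homeomorphic_maps (top_of_set ?X) (top_of_set (\<phi> ` U)) (\<phi> \<circ> h) (h' \<circ> \<psi>)"
    using \<psi> by (auto intro: homeomorphic_maps_compose)
  moreover have im: "(\<phi> \<circ> h) ` ?X = \<phi> ` U" using hX by (metis image_comp)
  ultimately have "homeomorphism ?X ((\<phi> \<circ> h) ` ?X) (\<phi> \<circ> h) (h' \<circ> \<psi>)"
    unfolding homeomorphic_maps_def im
    by (intro homeomorphismI) (auto simp: continuous_map_iff_continuous2 image_subset_iff_funcset)
  moreover have "openin (top_of_set ?R) ?X"
    using openin_continuous_map_preimage[OF homeomorphic_imp_continuous_map[OF h] Uo(1)] by simp
  ultimately show "\<exists>X (\<theta> :: (nat \<Rightarrow>\<^sub>0 real) \<Rightarrow> 'e) \<psi>. x \<in> X \<and> openin (top_of_set ?R) X \<and>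
      homeomorphism X (\<theta> ` X) \<theta> \<psi> \<and> open (\<theta> ` X) \<and> PL_on X \<theta>"
    using x U PL[OF U(1)] Uo(2) im by (intro exI[of _ ?X] exI[of _ "\<phi> \<circ> h"] exI[of _ "h' \<circ> \<psi>"]) simp
qed

lemma closed_pseudomanifold_of_triangulation:
  fixes M :: "('m, 'e::euclidean_space) charted_space"
  assumes "closed_connected_PL_manifold d M" and "triangulates M S"
  shows "closed_pseudomanifold d S"
proof -
  have "DIM('e) = d" using assms(1) by (simp add: closed_connected_PL_manifold_def PL_manifold_def)
  then show ?thesis
    using PL_euclidean_complex.closed_pseudomanifold[OF PL_euclidean_complex_of_triangulation[OF assms]]
    by simp
qed

section \<open>Relabelling the vertices\<close>

lemma isomorphic_refl: "isomorphic S S"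
  unfolding isomorphic_def by (intro exI[of _ id]) auto

lemma isomorphic_sym:
  assumes "isomorphic S T" shows "isomorphic T S"
proof -
  obtain f where f: "bij_betw f (vertices S) (vertices T)" "T = (`) f ` S"
    using assms by (auto simp: isomorphic_def)
  let ?g = "inv_into (vertices S) f"
  have "?g ` f ` \<sigma> = \<sigma>" if "\<sigma> \<in> S" for \<sigma>
    using that bij_betw_imp_inj_on[OF f(1)] by (intro inv_into_image_cancel) auto
  then have "(`) ?g ` T = S" unfolding f(2) by (auto simp: image_image)
  then show ?thesis
    unfolding isomorphic_def using bij_betw_inv_into[OF f(1)] by metis
qed

lemma isomorphic_trans:
  assumes "isomorphic S T" "isomorphic T U" shows "isomorphic S U"
proof -
  obtain f g where "bij_betw f (vertices S) (vertices T)" "T = (`) f ` S"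
    "bij_betw g (vertices T) (vertices U)" "U = (`) g ` T"
    using assms unfolding isomorphic_def by metis
  then show ?thesis
    unfolding isomorphic_def
    by (intro exI[of _ "g \<circ> f"] conjI) (auto simp: image_image image_comp intro: bij_betw_trans)
qed

lemma iso_class_eq_iff: "iso_class S = iso_class T \<longleftrightarrow> isomorphic S T"
  unfolding iso_class_def using isomorphic_refl isomorphic_sym isomorphic_trans by blast

lemma isomorphic_relabel:
  assumes "bij f" shows "isomorphic S ((`) f ` S)"
  unfolding isomorphic_def
  by (intro exI[of _ f] conjI)
    (use assms in \<open>auto simp: bij_betw_def image_Union intro: inj_on_subset[OF bij_is_inj]\<close>)

text \<open>Finite vertex sets have infinite complements in \<open>nat\<close>, so a vertex
  bijection extends to all labels. Moves may use a label outside \<open>S\<close>, on which a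
  bijection of the vertices alone has no meaningful value.\<close>

lemma isomorphic_imp_relabel:
  assumes "finite (vertices S)" "isomorphic S T"
  obtains f where "bij f" "T = (`) f ` S"
proof -
  obtain f where f: "bij_betw f (vertices S) (vertices T)" "T = (`) f ` S"
    using assms(2) by (auto simp: isomorphic_def)
  have "finite (vertices T)" using assms(1) f(1) bij_betw_finite by blast
  then have "infinite (- vertices S)" "infinite (- vertices T)"
    using assms(1) by (simp_all add: Compl_eq_Diff_UNIV Diff_infinite_finite)
  then have "bij_betw (from_nat_into (- vertices S)) UNIV (- vertices S)"
    "bij_betw (from_nat_into (- vertices T)) UNIV (- vertices T)"
    by (simp_all add: bij_betw_from_nat_into)
  then obtain h where h: "bij_betw h (- vertices S) (- vertices T)"
    using bij_betw_trans bij_betw_inv_into by blast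
  define g where "g x = (if x \<in> vertices S then f x else h x)" for x
  have "bij_betw g (vertices S \<union> - vertices S) (vertices T \<union> - vertices T)"
    unfolding g_def by (rule bij_betw_disjoint_Un[OF f(1) h]) auto
  then have "bij g" by simp
  moreover have gf: "g ` \<sigma> = f ` \<sigma>" if "\<sigma> \<in> S" for \<sigma>
    using that by (intro image_cong) (auto simp: g_def)
  have "(`) g ` S = (`) f ` S" by (rule image_cong[OF refl gf])
  ultimately show thesis using that[of g] f(2) by simp
qed

lemma relabel_inv:
  assumes "bij f" shows "(`) (inv f) ` (`) f ` S = S"
  by (simp add: image_image inv_f_f[OF bij_is_inj[OF assms]])

lemma inj_image_map: "inj f \<Longrightarrow> inj ((`) f)"
  by (rule injI) (simp add: inj_image_eq_iff)

lemma boundary_relabel: "inj f \<Longrightarrow> boundary (f ` \<alpha>) = (`) f ` boundary \<alpha>"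
proof -
  assume f: "inj f"
  show ?thesis
  proof (intro equalityI subsetI)
    fix \<tau> assume "\<tau> \<in> boundary (f ` \<alpha>)"
    then have "\<tau> \<subset> f ` \<alpha>" by (simp add: boundary_def)
    then obtain \<sigma> where "\<sigma> \<subseteq> \<alpha>" "\<tau> = f ` \<sigma>" "\<sigma> \<noteq> \<alpha>" by (metis order.strict_iff_order subset_imageE)
    then show "\<tau> \<in> (`) f ` boundary \<alpha>" by (auto simp: boundary_def)
  qed (auto simp: boundary_def psubset_eq inj_image_eq_iff[OF f])
qed

lemma link_relabel:
  assumes f: "inj f" shows "link ((`) f ` S) (f ` \<alpha>) = (`) f ` link S \<alpha>"
proof -
  have "f ` \<gamma> \<in> link ((`) f ` S) (f ` \<alpha>) \<longleftrightarrow> \<gamma> \<in> link S \<alpha>" for \<gamma>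
    unfolding link_def
    by (auto simp: inj_image_mem_iff[OF inj_image_map[OF f]] simp flip: image_Int[OF f] image_Un)
  moreover have "link ((`) f ` S) (f ` \<alpha>) \<subseteq> (`) f ` S" by (auto simp: link_def)
  moreover have "link S \<alpha> \<subseteq> S" by (auto simp: link_def)
  ultimately show ?thesis by blast
qed

lemma join_relabel: "join ((`) f ` A) ((`) f ` B) = (`) f ` join A B"
proof (intro equalityI subsetI)
  fix x assume "x \<in> join ((`) f ` A) ((`) f ` B)"
  then obtain \<sigma> \<tau> where "\<sigma> \<in> A" "\<tau> \<in> B" "x = f ` (\<sigma> \<union> \<tau>)" by (auto simp: join_def image_Un)
  then show "x \<in> (`) f ` join A B" unfolding join_def by blast
next
  fix x assume "x \<in> (`) f ` join A B"
  then obtain \<sigma> \<tau> where "\<sigma> \<in> A" "\<tau> \<in> B" "x = f ` \<sigma> \<union> f ` \<tau>" by (auto simp: join_def image_Un)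
  then show "x \<in> join ((`) f ` A) ((`) f ` B)" unfolding join_def by blast
qed

lemma flip_relabel:
  assumes f: "inj f" shows "flip (f ` \<alpha>) (f ` \<beta>) ((`) f ` S) = (`) f ` flip \<alpha> \<beta> S"
proof -
  have P: "Pow (f ` \<gamma>) = (`) f ` Pow \<gamma>" for \<gamma> by (simp add: image_Pow_surj)
  show ?thesis
    unfolding flip_def P boundary_relabel[OF f] join_relabel
    by (simp add: image_Un image_set_diff[OF inj_image_map[OF f]])
qed

lemma bistellar_move_relabel:
  assumes f: "bij f" and move: "bistellar_move d p q S T"
  shows "bistellar_move d p q ((`) f ` S) ((`) f ` T)"
proof -
  note inj = bij_is_inj[OF f]
  obtain \<alpha> \<beta> where m: "\<alpha> \<in> S" "\<beta> \<notin> S" "\<alpha> \<noteq> {}" "\<beta> \<noteq> {}" "\<alpha> \<inter> \<beta> = {}"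
    "card \<beta> = p" "card \<alpha> = q" "p + q = d + 2" "link S \<alpha> = boundary \<beta>" "T = flip \<alpha> \<beta> S"
    using move unfolding bistellar_move_def flip_def by (elim exE conjE) metis
  have card: "card (f ` \<gamma>) = card \<gamma>" for \<gamma>
    by (rule card_image) (rule inj_on_subset[OF inj], simp)
  show ?thesis
    unfolding bistellar_move_def
  proof (rule exI[of _ "f ` \<alpha>"], rule exI[of _ "f ` \<beta>"], intro conjI)
    show "f ` \<alpha> \<in> (`) f ` S" using m by blast
    show "f ` \<beta> \<notin> (`) f ` S" using m by (simp add: inj_image_mem_iff[OF inj_image_map[OF inj]])
    show "f ` \<alpha> \<inter> f ` \<beta> = {}" using m(5) by (metis image_Int[OF inj] image_empty)
    show "link ((`) f ` S) (f ` \<alpha>) = boundary (f ` \<beta>)"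
      by (simp add: link_relabel[OF inj] boundary_relabel[OF inj] m)
    show "(`) f ` T = ((`) f ` S - join (Pow (f ` \<alpha>)) (boundary (f ` \<beta>)))
        \<union> join (boundary (f ` \<alpha>)) (Pow (f ` \<beta>))"
      using flip_relabel[OF inj, of \<alpha> \<beta> S] by (simp add: m(10) flip_def)
  qed (use m card in auto)
qed

lemma simplicial_complex_relabel:
  assumes "simplicial_complex S" shows "simplicial_complex ((`) f ` S)"
proof -
  have "\<tau> \<in> (`) f ` S" if "\<sigma> \<in> S" "\<tau> \<subseteq> f ` \<sigma>" for \<sigma> \<tau>
  proof -
    obtain \<rho> where "\<rho> \<subseteq> \<sigma>" "\<tau> = f ` \<rho>" using \<open>\<tau> \<subseteq> f ` \<sigma>\<close> by (rule subset_imageE)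
    then show ?thesis using simplicial_complexD(4)[OF assms \<open>\<sigma> \<in> S\<close>] by blast
  qed
  then show ?thesis using assms by (auto simp: simplicial_complex_def)
qed

lemma isomorphic_imp_simplicial_complex:
  "simplicial_complex S \<Longrightarrow> isomorphic S T \<Longrightarrow> simplicial_complex T"
  by (auto simp: isomorphic_def simplicial_complex_relabel)

lemma isomorphic_card_vertices: "isomorphic S T \<Longrightarrow> card (vertices S) = card (vertices T)"
  by (auto simp: isomorphic_def bij_betw_same_card)

text \<open>Relabelling backwards carries a move between arbitrary members of two classes to a
  representative of the first that was chosen beforehand.\<close>

lemma bistellar_move_isomorphic:
  assumes "simplicial_complex S" "isomorphic S S'" "bistellar_move d p q S' T'"
  obtains T where "bistellar_move d p q S T" "isomorphic T T'"
proof -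
  obtain f where f: "bij f" "S' = (`) f ` S"
    using isomorphic_imp_relabel[OF finite_vertices[OF assms(1)] assms(2)] by blast
  have "bistellar_move d p q S ((`) (inv f) ` T')"
    using bistellar_move_relabel[OF bij_imp_bij_inv[OF f(1)] assms(3)]
    unfolding f(2) relabel_inv[OF f(1)] .
  moreover have "isomorphic ((`) (inv f) ` T') T'"
    using isomorphic_sym[OF isomorphic_relabel[OF bij_imp_bij_inv[OF f(1)]]] .
  ultimately show thesis using that by blast
qed

section \<open>Facet subdivisions and proper moves\<close>

lemma bistellar_move_flip:
  assumes "flippable \<alpha> \<beta> S" "card \<alpha> + card \<beta> = d + 2"
  shows "bistellar_move d (card \<beta>) (card \<alpha>) S (flip \<alpha> \<beta> S)"
proof -
  note S = flippableD[OF assms(1)]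
  have "0 < card \<beta>" using S by (simp add: card_gt_0_iff)
  then show ?thesis
    unfolding bistellar_move_iff_flip[OF S(1) \<open>0 < card \<beta>\<close>] using assms by auto
qed

text \<open>Since \<open>p + q = d + 2\<close>, the bound \<open>p \<le> d\<close> is the same as
  \<open>2 \<le> q\<close> and vice versa. The resulting condition is symmetric in \<alpha> and
  \<beta>.\<close>

lemma proper_move_iff_flip:
  assumes "simplicial_complex S"
  shows "proper_move d S T \<longleftrightarrow> (\<exists>\<alpha> \<beta>. flippable \<alpha> \<beta> S \<and> card \<alpha> + card \<beta> = d + 2 \<and>
    2 \<le> card \<alpha> \<and> 2 \<le> card \<beta> \<and> T = flip \<alpha> \<beta> S)"
proof
  assume "proper_move d S T"
  then obtain p q where pq: "p \<in> {2..d}" "q \<in> {2..d}" "bistellar_move d p q S T"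
    unfolding proper_move_def by blast
  then have "0 < p" by simp
  from pq(3)[unfolded bistellar_move_iff_flip[OF assms this]] obtain \<alpha> \<beta> where
    m: "flippable \<alpha> \<beta> S" "card \<beta> = p" "card \<alpha> = q" "p + q = d + 2" "T = flip \<alpha> \<beta> S" by blast
  then show "\<exists>\<alpha> \<beta>. flippable \<alpha> \<beta> S \<and> card \<alpha> + card \<beta> = d + 2 \<and>
    2 \<le> card \<alpha> \<and> 2 \<le> card \<beta> \<and> T = flip \<alpha> \<beta> S"
    using pq(1,2) by - (rule exI[of _ \<alpha>], rule exI[of _ \<beta>], auto)
next
  assume "\<exists>\<alpha> \<beta>. flippable \<alpha> \<beta> S \<and> card \<alpha> + card \<beta> = d + 2 \<and>
    2 \<le> card \<alpha> \<and> 2 \<le> card \<beta> \<and> T = flip \<alpha> \<beta> S"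
  then obtain \<alpha> \<beta> where m: "flippable \<alpha> \<beta> S" "card \<alpha> + card \<beta> = d + 2"
    "2 \<le> card \<alpha>" "2 \<le> card \<beta>" "T = flip \<alpha> \<beta> S" by blast
  then have "card \<alpha> \<in> {2..d}" "card \<beta> \<in> {2..d}" by auto
  then show "proper_move d S T"
    unfolding proper_move_def using bistellar_move_flip[OF m(1,2)] m(5) by blast
qed

lemma proper_move_sym:
  assumes "simplicial_complex S" "proper_move d S T"
  shows "simplicial_complex T" "proper_move d T S" "vertices T = vertices S"
proof -
  obtain \<alpha> \<beta> where m: "flippable \<alpha> \<beta> S" "card \<alpha> + card \<beta> = d + 2"
    "2 \<le> card \<alpha>" "2 \<le> card \<beta>" "T = flip \<alpha> \<beta> S"
    using assms by (auto simp: proper_move_iff_flip)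
  show T: "simplicial_complex T" using simplicial_complex_flip[OF m(1)] m(5) by simp
  have "flippable \<beta> \<alpha> T" "flip \<beta> \<alpha> T = S"
    using flippable_flip[OF m(1)] flip_flip[OF m(1)] m(5) by simp_all
  then show "proper_move d T S"
    using m unfolding proper_move_iff_flip[OF T]
    by - (rule exI[of _ \<beta>], rule exI[of _ \<alpha>], simp add: add.commute)
  show "vertices T = vertices S" using vertices_flip_eq m by simp
qed

lemma facet_subdivision_iff_flip:
  assumes "simplicial_complex S"
  shows "facet_subdivision d S T \<longleftrightarrow>
    (\<exists>F v. flippable F {v} S \<and> card F = d + 1 \<and> T = flip F {v} S)"
  unfolding facet_subdivision_def bistellar_move_iff_flip[OF assms zero_less_one]
  by (auto simp: card_1_singleton_iff)

lemma vertices_facet_subdivision: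
  assumes "simplicial_complex S" "facet_subdivision d S T" "1 \<le> d"
  shows "card (vertices T) = card (vertices S) + 1"
proof -
  obtain F v where F: "flippable F {v} S" "card F = d + 1" "T = flip F {v} S"
    using assms by (auto simp: facet_subdivision_iff_flip)
  have "v \<notin> vertices S" using flippableD(5)[OF F(1)] vertex_iff[OF assms(1)] by simp
  moreover have "vertices T = vertices S \<union> {v}" using vertices_flip[OF F(1)] F assms(3) by simp
  ultimately show ?thesis using finite_vertices[OF assms(1)] by simp
qed

context closed_pseudomanifold
begin

lemmas finite_simplex = simplicial_complexD(3)[OF complex]
lemmas subset_mem = simplicial_complexD(4)[OF complex]

lemma facet_maximal:
  assumes "F \<in> S" "card F = d + 1" "\<sigma> \<in> S" "F \<subseteq> \<sigma>"
  shows "\<sigma> = F"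
  using card_seteq[OF finite_simplex[OF assms(3)] assms(4)] card_le[OF assms(3)] assms(2) by simp

lemma flippable_facet:
  assumes F: "F \<in> S" "card F = d + 1" and v: "v \<notin> vertices S"
  shows "flippable F {v} S"
proof -
  have "link S F = {{}}"
  proof -
    have "\<gamma> = {}" if "\<gamma> \<in> link S F" for \<gamma>
      using that facet_maximal[OF F, of "\<gamma> \<union> F"] by (auto simp: link_def)
    moreover have "{} \<in> link S F"
      using F(1) subset_mem[OF F(1), of "{}"] by (simp add: link_def)
    ultimately show ?thesis by blast
  qed
  moreover have "boundary {v} = {{}}" by (auto simp: boundary_def)
  moreover have "v \<notin> F" "{v} \<notin> S" "F \<noteq> {}" using v F by auto
  ultimately show ?thesis
    unfolding flippable_def using complex F(1) by simp
qed

text \<open>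
  Both subdivisions become the cone from the new vertex over the boundary of \<open>F \<union> G\<close> after a
  2-d move at the common ridge.
\<close>

lemma subdivisions_of_adjacent_facets:
  assumes F: "F \<in> S" "card F = d + 1" and G: "G \<in> S" "card G = d + 1"
    and ridge_FG: "card (F \<inter> G) = d" and v: "v \<notin> vertices S" and d: "2 \<le> d"
  obtains T where "proper_move d (flip F {v} S) T" "proper_move d (flip G {v} S) T"
proof -
  define \<tau> where "\<tau> = F \<inter> G"
  have \<tau>: "\<tau> \<in> S" "card \<tau> = d" using subset_mem[OF F(1), of \<tau>] ridge_FG by (simp_all add: \<tau>_def)
  have fin: "finite F" "finite G" "finite \<tau>" using finite_simplex F G \<tau> by auto
  have ex: "\<exists>a. a \<notin> \<tau> \<and> H = insert a \<tau>" if "\<tau> \<subseteq> H" "card H = d + 1" "finite H" for H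
  proof -
    have "card (H - \<tau>) = 1" using that fin \<tau> by (simp add: card_Diff_subset)
    then obtain a where "H - \<tau> = {a}" by (auto simp: card_1_singleton_iff)
    then show ?thesis using \<open>\<tau> \<subseteq> H\<close> by blast
  qed
  have "\<tau> \<subseteq> F" "\<tau> \<subseteq> G" by (simp_all add: \<tau>_def)
  then obtain a b where a: "a \<notin> \<tau>" "F = insert a \<tau>" and b: "b \<notin> \<tau>" "G = insert b \<tau>"
    using ex[OF _ F(2) fin(1)] ex[OF _ G(2) fin(2)] by blast
  have ab: "a \<noteq> b" using a b ridge_FG F(2) by auto
  have va: "v \<noteq> a" "v \<noteq> b" "v \<notin> \<tau>" using v F G \<tau> a b by auto
  have vS: "v \<notin> \<sigma>" if "\<sigma> \<in> S" for \<sigma> using v that by blast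
  have link\<tau>: "\<gamma> \<in> {{}, {a}, {b}}" if "\<gamma> \<inter> \<tau> = {}" "\<gamma> \<union> \<tau> \<in> S" for \<gamma>
  proof -
    obtain a' b' where l: "link S \<tau> = {{}, {a'}, {b'}}" using ridge[OF \<tau>] by blast
    have "{a} \<in> link S \<tau>" "{b} \<in> link S \<tau>"
      using a b F G subset_mem[OF F(1), of "{a}"] subset_mem[OF G(1), of "{b}"] by (auto simp: link_def)
    then have "{{}, {a'}, {b'}} = {{}, {a}, {b}}" using ab unfolding l by auto
    moreover have "\<gamma> \<in> link S \<tau>" using that subset_mem[OF that(2), of \<gamma>] by (auto simp: link_def)
    ultimately show ?thesis using l by simp
  qed
  \<comment> \<open>This description is symmetric in \<open>a\<close> and \<open>b\<close>, so the
    single computation \<open>move\<close> serves both facets.\<close>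
  define T where "T = {\<sigma>. \<not> \<tau> \<subseteq> \<sigma> \<and> (\<sigma> \<in> S \<or> \<sigma> \<subseteq> insert a (insert v \<tau>) \<or> \<sigma> \<subseteq> insert b (insert v \<tau>))}"
  have move: "proper_move d (flip H {v} S) T"
    if H: "H \<in> S" "card H = d + 1" "H = insert x \<tau>" and x: "x \<noteq> y" "x \<notin> \<tau>" "y \<notin> \<tau>" "v \<noteq> x" "v \<noteq> y"
      and y: "insert y \<tau> \<in> S" and l: "\<And>\<gamma>. \<gamma> \<inter> \<tau> = {} \<Longrightarrow> \<gamma> \<union> \<tau> \<in> S \<Longrightarrow> \<gamma> \<in> {{}, {x}, {y}}"
      and T: "T = {\<sigma>. \<not> \<tau> \<subseteq> \<sigma> \<and> (\<sigma> \<in> S \<or> \<sigma> \<subseteq> insert x (insert v \<tau>) \<or> \<sigma> \<subseteq> insert y (insert v \<tau>))}"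
    for H x y
  proof -
    note fH = flippable_facet[OF H(1,2) v]
    let ?U = "flip H {v} S"
    have U: "\<sigma> \<in> ?U \<longleftrightarrow> \<not> H \<subseteq> \<sigma> \<and> (\<sigma> \<in> S \<or> \<sigma> \<subseteq> insert v H)" for \<sigma>
      using mem_flip_iff[OF fH, of \<sigma>] by simp
    have yH: "y \<notin> H" using x H by auto
    \<comment> \<open>Subdividing \<open>H\<close> replaces \<open>x\<close> by \<open>v\<close> as
      a neighbour of the ridge, so that the link consists of the two points \<open>v\<close> and
      \<open>y\<close>.\<close>
    have "\<gamma> \<in> link ?U \<tau> \<longleftrightarrow> \<gamma> \<in> boundary {v, y}" for \<gamma>
    proof
      assume "\<gamma> \<in> link ?U \<tau>"
      then have \<gamma>: "\<gamma> \<inter> \<tau> = {}" "\<gamma> \<union> \<tau> \<in> ?U" by (auto simp: link_def)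
      then have "x \<notin> \<gamma>" "\<gamma> \<union> \<tau> \<in> S \<or> \<gamma> \<union> \<tau> \<subseteq> insert v H" using U H(3) by auto
      moreover have "\<gamma> \<in> {{}, {x}, {y}}" if "\<gamma> \<union> \<tau> \<in> S" using l \<gamma>(1) that .
      moreover have "\<gamma> \<subseteq> {v}" if "\<gamma> \<union> \<tau> \<subseteq> insert v H" using that \<gamma>(1) \<open>x \<notin> \<gamma>\<close> H(3) by auto
      ultimately have "\<gamma> = {} \<or> \<gamma> = {y} \<or> \<gamma> = {v}" by blast
      then show "\<gamma> \<in> boundary {v, y}" using x by (auto simp: boundary_def)
    next
      assume "\<gamma> \<in> boundary {v, y}"
      then have \<gamma>: "\<gamma> = {} \<or> \<gamma> = {y} \<or> \<gamma> = {v}" by (auto simp: boundary_def)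
      have "{} \<in> S" "{y} \<in> S" "\<tau> \<in> S"
        using subset_mem[OF y, of "{}"] subset_mem[OF y, of "{y}"] \<tau>(1) by simp_all
      with \<gamma> y have "\<gamma> \<in> S \<or> \<gamma> \<subseteq> insert v H" "\<gamma> \<union> \<tau> \<in> S \<or> \<gamma> \<union> \<tau> \<subseteq> insert v H"
        unfolding H(3) by (elim disjE; simp; blast)+
      moreover have "\<gamma> \<inter> \<tau> = {}" "x \<notin> \<gamma>" using \<gamma> x va(3) by (elim disjE; simp)+
      moreover have "\<not> H \<subseteq> \<gamma>" "\<not> H \<subseteq> \<gamma> \<union> \<tau>"
        using \<open>x \<notin> \<gamma>\<close> x(2) unfolding H(3) by blast+
      ultimately show "\<gamma> \<in> link ?U \<tau>" by (simp add: link_def U)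
    qed
    then have link: "link ?U \<tau> = boundary {v, y}" by blast
    have "{v, y} \<notin> S" using vS[of "{v, y}"] by blast
    then have "{v, y} \<notin> ?U" using yH x(5) by (simp add: U)
    moreover have "\<tau> \<in> ?U" using \<tau>(1) x(2) H(3) U by blast
    moreover have "\<tau> \<noteq> {}" using \<tau>(2) d by auto
    ultimately have fl: "flippable \<tau> {v, y} ?U"
      unfolding flippable_def using simplicial_complex_flip[OF fH] link va x(3) by simp
    have "flip \<tau> {v, y} ?U = T"
    proof (rule set_eqI)
      fix \<sigma>
      show "\<sigma> \<in> flip \<tau> {v, y} ?U \<longleftrightarrow> \<sigma> \<in> T"
        using H(3) unfolding mem_flip_iff[OF fl] U T mem_Collect_eq by blast
    qed
    moreover have "card {v, y} = 2" using x by simp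
    ultimately show ?thesis
      unfolding proper_move_iff_flip[OF simplicial_complex_flip[OF fH]]
      using fl \<tau>(2) d by - (rule exI[of _ \<tau>], rule exI[of _ "{v, y}"], simp)
  qed
  have "proper_move d (flip F {v} S) T"
    by (rule move[of F a b]) (use F a b ab va G link\<tau> in \<open>auto simp: T_def\<close>)
  moreover have "proper_move d (flip G {v} S) T"
    by (rule move[of G b a]) (use F a b ab va G link\<tau> in \<open>auto simp: T_def\<close>)
  ultimately show thesis by (rule that)
qed

text \<open>In a facet above \<alpha>, a vertex of \<alpha> is exchanged for the other neighbour of
  the opposite ridge.\<close>

lemma exists_facet_not_containing:
  assumes "\<alpha> \<in> S" "\<alpha> \<noteq> {}"
  obtains G where "G \<in> S" "card G = d + 1" "\<not> \<alpha> \<subseteq> G"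
proof -
  obtain H where H: "H \<in> S" "\<alpha> \<subseteq> H" "card H = d + 1" using extend_to_facet[OF assms(1)] by blast
  obtain a where a: "a \<in> \<alpha>" using assms(2) by blast
  let ?\<tau> = "H - {a}"
  have \<tau>: "?\<tau> \<in> S" "card ?\<tau> = d"
    using H a subset_mem[OF H(1), of ?\<tau>] by (auto simp: card_Diff_singleton subset_iff)
  obtain b c where bc: "b \<noteq> c" "link S ?\<tau> = {{}, {b}, {c}}" using ridge[OF \<tau>] by blast
  then obtain x where "x \<noteq> a" "{x} \<in> link S ?\<tau>" by (cases "b = a") auto
  then have x: "x \<noteq> a" "x \<notin> ?\<tau>" "insert x ?\<tau> \<in> S" by (auto simp: link_def)
  have "card (insert x ?\<tau>) = d + 1" using x \<tau> finite_simplex[OF \<tau>(1)] by simp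
  moreover have "\<not> \<alpha> \<subseteq> insert x ?\<tau>" using a x(1) by blast
  ultimately show thesis using that x(3) by blast
qed

text \<open>A facet \<open>F\<close> not containing \<alpha> survives the move, and subdividing it
  leaves the link of \<alpha> unchanged, so both orders give the same complex. A single such facet
  is enough because the subdivisions of one triangulation are connected among themselves.\<close>

lemma proper_move_of_subdivisions:
  assumes fl: "flippable \<alpha> \<beta> S" "card \<alpha> + card \<beta> = d + 2" "2 \<le> card \<alpha>" "2 \<le> card \<beta>"
    and S': "closed_pseudomanifold d (flip \<alpha> \<beta> S)"
  obtains T T' where "facet_subdivision d S T" "facet_subdivision d (flip \<alpha> \<beta> S) T'" "proper_move d T T'"
proof -
  let ?S' = "flip \<alpha> \<beta> S"
  note D = flippableD[OF fl(1)]
  obtain F where F: "F \<in> S" "card F = d + 1" "\<not> \<alpha> \<subseteq> F"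
    using exists_facet_not_containing[OF D(4,6)] by blast
  have F': "F \<in> ?S'" using F by (simp add: mem_flip_iff[OF fl(1)])
  obtain v where v: "v \<notin> vertices S" using finite_vertices[OF complex] ex_new_if_finite[OF infinite_UNIV_nat] by blast
  have vert: "vertices ?S' = vertices S" using vertices_flip_eq[OF fl(1,3,4)] .
  then have v': "v \<notin> vertices ?S'" using v by simp
  have "\<beta> \<subseteq> vertices S"
    using flippableD(4)[OF flippable_flip[OF fl(1)]] vert by blast
  then have v\<alpha>\<beta>: "v \<notin> \<alpha>" "v \<notin> \<beta>" using v D(4) by blast+
  have f: "flippable F {v} S" using flippable_facet[OF F(1,2) v] .
  have f': "flippable F {v} ?S'" using closed_pseudomanifold.flippable_facet[OF S' F' F(2) v'] .
  have \<alpha>F: "\<not> F \<subseteq> \<alpha>" using card_mono[OF D(2), of F] F(2) fl by auto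
  have \<beta>F: "\<not> \<beta> \<subseteq> F" using flippable_not_subset[OF fl(1) F(1)] .
  \<comment> \<open>\<open>F\<close> misses a vertex of \<alpha> and one of \<beta>, so only
    \<open>d\<close> of the \<open>d + 2\<close> vertices of \<alpha> \<union> \<beta> would be left
    for it. If \<open>F\<close> were inside, the flip would put back the facet that the subdivision
    removed.\<close>
  have F\<alpha>\<beta>: "\<not> F \<subseteq> \<alpha> \<union> \<beta>"
  proof
    assume sub: "F \<subseteq> \<alpha> \<union> \<beta>"
    obtain x y where xy: "x \<in> \<alpha>" "x \<notin> F" "y \<in> \<beta>" "y \<notin> F" using F(3) \<beta>F by blast
    have "card F \<le> card (\<alpha> \<union> \<beta> - {x, y})"
      using sub xy D by (intro card_mono) auto
    also have "\<dots> = card (\<alpha> \<union> \<beta>) - card {x, y}"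
      using xy D by (intro card_Diff_subset) auto
    also have "x \<noteq> y" using xy D(8) by blast
    then have "card (\<alpha> \<union> \<beta>) - card {x, y} = d"
      using D(2,3,8) fl(2) by (simp add: card_Un_disjoint)
    finally show False using F by simp
  qed
  let ?T = "flip F {v} S"
  have U: "\<sigma> \<in> ?T \<longleftrightarrow> \<not> F \<subseteq> \<sigma> \<and> (\<sigma> \<in> S \<or> \<sigma> \<subseteq> insert v F)" for \<sigma>
    using mem_flip_iff[OF f, of \<sigma>] by simp
  have not_sub: "\<not> \<alpha> \<subseteq> insert v F" "\<not> \<beta> \<subseteq> insert v F" using F(3) \<beta>F v\<alpha>\<beta> by auto
  have "\<gamma> \<in> link ?T \<alpha> \<longleftrightarrow> \<gamma> \<in> link S \<alpha>" for \<gamma>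
  proof
    assume "\<gamma> \<in> link ?T \<alpha>"
    then have "\<gamma> \<inter> \<alpha> = {}" "\<gamma> \<union> \<alpha> \<in> S" using not_sub by (auto simp: link_def U)
    then show "\<gamma> \<in> link S \<alpha>" using subset_mem[of "\<gamma> \<union> \<alpha>" \<gamma>] by (auto simp: link_def)
  next
    assume \<gamma>: "\<gamma> \<in> link S \<alpha>"
    then have "\<not> F \<subseteq> \<gamma> \<union> \<alpha>" using facet_maximal[OF F(1,2), of "\<gamma> \<union> \<alpha>"] F(3) by (auto simp: link_def)
    then show "\<gamma> \<in> link ?T \<alpha>" using \<gamma> by (auto simp: link_def U)
  qed
  then have "link ?T \<alpha> = boundary \<beta>" using D(9) by blast
  then have fT: "flippable \<alpha> \<beta> ?T"
    using D \<alpha>F not_sub simplicial_complex_flip[OF f] by (auto simp: flippable_def U)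
  have "flip \<alpha> \<beta> ?T = flip F {v} ?S'"
  proof (rule set_eqI)
    fix \<sigma>
    show "\<sigma> \<in> flip \<alpha> \<beta> ?T \<longleftrightarrow> \<sigma> \<in> flip F {v} ?S'"
      unfolding mem_flip_iff[OF fT] U mem_flip_iff[OF f'] mem_flip_iff[OF fl(1)]
      using F\<alpha>\<beta> not_sub by auto
  qed
  then have "proper_move d ?T (flip F {v} ?S')"
    unfolding proper_move_iff_flip[OF simplicial_complex_flip[OF f]] using fT fl by metis
  moreover have "facet_subdivision d S ?T"
    unfolding facet_subdivision_iff_flip[OF complex] using f F by blast
  moreover have "facet_subdivision d ?S' (flip F {v} ?S')"
    unfolding facet_subdivision_iff_flip[OF simplicial_complex_flip[OF fl(1)]] using f' F by blast
  ultimately show thesis using that by blast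
qed

text \<open>The transposition of \<open>v\<close> and \<open>w\<close> fixes every simplex of
  \<open>S\<close> and exchanges the two new vertices.\<close>

lemma subdivision_new_vertex_irrelevant:
  assumes F: "F \<in> S" "card F = d + 1" and v: "v \<notin> vertices S" "w \<notin> vertices S"
  shows "isomorphic (flip F {v} S) (flip F {w} S)"
proof -
  let ?f = "Transposition.transpose v w"
  have fixed: "?f ` \<sigma> = \<sigma>" if "\<sigma> \<in> S" for \<sigma>
  proof -
    have "?f x = x" if "x \<in> \<sigma>" for x
      using v \<open>\<sigma> \<in> S\<close> that by (intro transpose_apply_other) auto
    then show ?thesis by simp
  qed
  then have "(`) ?f ` S = S" by simp
  moreover have "?f ` F = F" using fixed F by simp
  ultimately have "(`) ?f ` flip F {v} S = flip F {w} S"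
    using flip_relabel[of ?f F "{v}" S] by (simp add: bij_is_inj)
  then show ?thesis using isomorphic_relabel[of ?f "flip F {v} S"] by simp
qed

lemma exists_facet_subdivision: "\<exists>T. facet_subdivision d S T"
proof -
  obtain F where F: "F \<in> S" "card F = d + 1"
    using extend_to_facet[OF simplicial_complexD(2)[OF complex]] by blast
  obtain v where v: "v \<notin> vertices S"
    using finite_vertices[OF complex] ex_new_if_finite[OF infinite_UNIV_nat] by blast
  show ?thesis
    unfolding facet_subdivision_iff_flip[OF complex] using flippable_facet[OF F v] F by blast
qed

end

section \<open>Components of the flip graph\<close>

locale closed_PL_manifold =
  fixes d :: nat and M :: "('m, 'e::euclidean_space) charted_space"
  assumes d: "2 \<le> d" and closed_connected: "closed_connected_PL_manifold d M"
begin

abbreviation "G \<equiv> flip_graph d M"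

lemma PL_manifold: "PL_manifold d M"
  using closed_connected by (simp add: closed_connected_PL_manifold_def)

lemma pseudomanifold: "triangulates M S \<Longrightarrow> closed_pseudomanifold d S"
  by (rule closed_pseudomanifold_of_triangulation[OF closed_connected])

lemma complex: "triangulates M S \<Longrightarrow> simplicial_complex S"
  by (simp add: triangulates_def)

lemma triangulates_move:
  assumes "triangulates M S" "bistellar_move d p q S T" "0 < p"
  shows "triangulates M T"
  using assms(2) triangulates_flip[OF PL_manifold assms(1)]
  unfolding bistellar_move_iff_flip[OF complex[OF assms(1)] assms(3)] by blast

lemma triangulates_proper_move:
  assumes "triangulates M S" "proper_move d S T" shows "triangulates M T"
proof -
  obtain p q where "p \<in> {2..d}" "bistellar_move d p q S T"
    using assms(2) unfolding proper_move_def by blast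
  then show ?thesis using triangulates_move[OF assms(1), of p q T] by simp
qed

lemma triangulates_subdivision:
  assumes "triangulates M S" "facet_subdivision d S T"
  shows "triangulates M T" "card (vertices T) = card (vertices S) + 1"
  using triangulates_move[OF assms(1), of 1] assms(2) vertices_facet_subdivision[OF complex[OF assms(1)] assms(2)] d
  by (simp_all add: facet_subdivision_def)

lemma vertsG: "verts (G n) = {iso_class T |T. triangulates M T \<and> card (vertices T) = n}"
  by (simp add: flip_graph_def Let_def)

lemma arcsG: "A \<rightarrow>\<^bsub>G n\<^esub> B \<longleftrightarrow> A \<in> verts (G n) \<and> B \<in> verts (G n) \<and>
    (\<exists>S\<in>A. \<exists>T\<in>B. proper_move d S T \<or> proper_move d T S)"
  by (simp add: flip_graph_def Let_def)

lemma wf: "wf_digraph (G n)"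
  by unfold_locales (auto simp: flip_graph_def Let_def)

lemma symmetric: "symmetric (G n)"
  unfolding symmetric_def by (rule symI) (auto simp: arcsG)

lemmas reach_refl = wf_digraph.reachable_refl[OF wf]
  and reach_trans = wf_digraph.reachable_trans[OF wf]
  and reach_adj = wf_digraph.reachable_adjI[OF wf]
  and reach_sym = symmetric_reachable[OF symmetric]

lemma iso_class_in_verts:
  "triangulates M S \<Longrightarrow> card (vertices S) = n \<Longrightarrow> iso_class S \<in> verts (G n)"
  by (auto simp: vertsG)

lemma mem_iso_class: "S \<in> iso_class S"
  by (simp add: iso_class_def isomorphic_refl)

lemma reach_proper_move:
  assumes "triangulates M S" "card (vertices S) = n" "proper_move d S T"
  shows "iso_class S \<rightarrow>\<^sup>*\<^bsub>G n\<^esub> iso_class T"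
proof (rule reach_adj)
  have "triangulates M T" "card (vertices T) = n"
    using triangulates_proper_move assms proper_move_sym(3)[OF complex[OF assms(1)] assms(3)] by auto
  then show "iso_class S \<rightarrow>\<^bsub>G n\<^esub> iso_class T"
    unfolding arcsG using assms iso_class_in_verts mem_iso_class by blast
qed

lemma move_on_representative:
  assumes "triangulates M S" "isomorphic S S'" "bistellar_move d p q S' T'"
  obtains T where "bistellar_move d p q S T" "iso_class T = iso_class T'"
  using bistellar_move_isomorphic[OF complex[OF assms(1)] assms(2,3)] by (metis iso_class_eq_iff)

lemma proper_move_on_representative:
  assumes "triangulates M S" "isomorphic S S'" "proper_move d S' T'"
  obtains T where "proper_move d S T" "iso_class T = iso_class T'"
proof -
  obtain p q where pq: "p \<in> {2..d}" "q \<in> {2..d}" "bistellar_move d p q S' T'"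
    using assms(3) unfolding proper_move_def by blast
  obtain T where "bistellar_move d p q S T" "iso_class T = iso_class T'"
    using move_on_representative[OF assms(1,2) pq(3)] by blast
  then show thesis using that pq unfolding proper_move_def by blast
qed

text \<open>An arc only provides some members of the two classes and a move in one of the two
  directions; reversibility fixes the direction, and relabelling the starting point.\<close>

lemma arc_on_representative:
  assumes S: "triangulates M S" and arc: "iso_class S \<rightarrow>\<^bsub>G n\<^esub> B"
  obtains T where "proper_move d S T" "B = iso_class T"
proof -
  obtain S' T' where m: "S' \<in> iso_class S" "T' \<in> B" "proper_move d S' T' \<or> proper_move d T' S'"
    using arc unfolding arcsG by blast
  obtain T0 where T0: "triangulates M T0" "B = iso_class T0"
    using arc unfolding arcsG vertsG by blast
  have iso: "isomorphic S S'" "isomorphic T0 T'" using m T0 by (auto simp: iso_class_def)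
  have "simplicial_complex T'"
    using isomorphic_imp_simplicial_complex[OF complex[OF T0(1)] iso(2)] .
  then have "proper_move d S' T'" using m(3) proper_move_sym(2) by blast
  then obtain T where "proper_move d S T" "iso_class T = iso_class T'"
    using proper_move_on_representative[OF S iso(1)] by blast
  moreover have "iso_class T' = B" using iso(2) T0(2) iso_class_eq_iff by blast
  ultimately show thesis using that by simp
qed

text \<open>The new vertex \<open>v\<close> is kept while the subdivided facet runs through a chain
  from \<open>F\<close> to \<open>H\<close>; subdivisions of adjacent facets have a common neighbour
  in the flip graph. Only at the end is \<open>v\<close> exchanged for \<open>w\<close>.\<close>

lemma subdivisions_of_same:
  assumes S: "triangulates M S" "card (vertices S) = n"
    and T: "facet_subdivision d S T" and T': "facet_subdivision d S T'"
  shows "iso_class T \<rightarrow>\<^sup>*\<^bsub>G (n + 1)\<^esub> iso_class T'"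
proof -
  interpret closed_pseudomanifold d S using pseudomanifold[OF S(1)] .
  obtain F v where F: "flippable F {v} S" "card F = d + 1" "T = flip F {v} S"
    using T by (auto simp: facet_subdivision_iff_flip[OF complex])
  obtain H w where H: "flippable H {w} S" "card H = d + 1" "T' = flip H {w} S"
    using T' by (auto simp: facet_subdivision_iff_flip[OF complex])
  have FS: "F \<in> S" "H \<in> S" using flippableD(4) F(1) H(1) by blast+
  have v: "v \<notin> vertices S" "w \<notin> vertices S"
    using flippableD(5)[OF F(1)] flippableD(5)[OF H(1)] by (simp_all add: vertex_iff[OF complex] del: Union_iff)
  have sub: "triangulates M (flip K {v} S)" "card (vertices (flip K {v} S)) = n + 1"
    if "K \<in> S" "card K = d + 1" for K
  proof -
    have "facet_subdivision d S (flip K {v} S)"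
      unfolding facet_subdivision_iff_flip[OF complex] using flippable_facet[OF that v(1)] that by blast
    from triangulates_subdivision[OF S(1) this] show
      "triangulates M (flip K {v} S)" "card (vertices (flip K {v} S)) = n + 1"
      using S(2) by simp_all
  qed
  have "iso_class T \<rightarrow>\<^sup>*\<^bsub>G (n + 1)\<^esub> iso_class (flip H {v} S)"
  proof (rule facet_induct[where P = "\<lambda>K. iso_class T \<rightarrow>\<^sup>*\<^bsub>G (n + 1)\<^esub> iso_class (flip K {v} S)"])
    show "F \<in> S" "card F = d + 1" "H \<in> S" "card H = d + 1" using FS F H by auto
    show "iso_class T \<rightarrow>\<^sup>*\<^bsub>G (n + 1)\<^esub> iso_class (flip F {v} S)"
      unfolding F(3) by (rule reach_refl[OF iso_class_in_verts[OF sub[OF FS(1) F(2)]]])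
    fix K L
    assume K: "K \<in> S" "card K = d + 1" and L: "L \<in> S" "card L = d + 1" and KL: "card (K \<inter> L) = d"
      and IH: "iso_class T \<rightarrow>\<^sup>*\<^bsub>G (n + 1)\<^esub> iso_class (flip K {v} S)"
    obtain U where U: "proper_move d (flip K {v} S) U" "proper_move d (flip L {v} S) U"
      using subdivisions_of_adjacent_facets[OF K L KL v(1) d] by blast
    show "iso_class T \<rightarrow>\<^sup>*\<^bsub>G (n + 1)\<^esub> iso_class (flip L {v} S)"
      using reach_trans[OF reach_trans[OF IH reach_proper_move[OF sub[OF K] U(1)]]
          reach_sym[OF reach_proper_move[OF sub[OF L] U(2)]]] .
  qed
  moreover have "iso_class (flip H {v} S) = iso_class T'"
    unfolding iso_class_eq_iff H(3) by (rule subdivision_new_vertex_irrelevant[OF FS(2) H(2) v])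
  ultimately show ?thesis by simp
qed

lemma subdivisions_of_isomorphic:
  assumes S: "triangulates M S" "card (vertices S) = n" and iso: "isomorphic S S'"
    and T: "facet_subdivision d S T" and T': "facet_subdivision d S' T'"
  shows "iso_class T \<rightarrow>\<^sup>*\<^bsub>G (n + 1)\<^esub> iso_class T'"
proof -
  obtain U where "facet_subdivision d S U" "iso_class U = iso_class T'"
    using move_on_representative[OF S(1) iso T'[unfolded facet_subdivision_def]]
    unfolding facet_subdivision_def by blast
  then show ?thesis using subdivisions_of_same[OF S T] by metis
qed

text \<open>This makes the stabilization of a component well defined. Along a proper move it
  suffices to connect one subdivision of each end.\<close>

lemma subdivisions_reachable:
  assumes S: "triangulates M S" "card (vertices S) = n" and T: "facet_subdivision d S T"
    and reach: "iso_class S \<rightarrow>\<^sup>*\<^bsub>G n\<^esub> B"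
    and S': "S' \<in> B" "facet_subdivision d S' T'"
  shows "iso_class T \<rightarrow>\<^sup>*\<^bsub>G (n + 1)\<^esub> iso_class T'"
proof -
  \<comment> \<open>The induction covers all members of the class and all their subdivisions,
    because the next move may single out another representative and another facet.\<close>
  have "\<forall>S' T'. S' \<in> B \<longrightarrow> facet_subdivision d S' T' \<longrightarrow> iso_class T \<rightarrow>\<^sup>*\<^bsub>G (n + 1)\<^esub> iso_class T'"
    using reach
  proof (induction rule: wf_digraph.reachable_induct[OF wf, consumes 1, case_names base step])
    case base
    then show ?case using subdivisions_of_isomorphic[OF S _ T] by (auto simp: iso_class_def)
  next
    case (step B C)
    show ?case
    proof (intro allI impI)
      fix Q' Z assume Q': "Q' \<in> C" "facet_subdivision d Q' Z"
      obtain P where P: "triangulates M P" "card (vertices P) = n" "B = iso_class P"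
        using step.hyps(2) unfolding arcsG vertsG by blast
      then obtain Q where Q: "proper_move d P Q" "C = iso_class Q"
        using arc_on_representative[OF P(1)] step.hyps(2) by blast
      have tQ: "triangulates M Q" "card (vertices Q) = n"
        using triangulates_proper_move[OF P(1) Q(1)] proper_move_sym(3)[OF complex[OF P(1)] Q(1)] P(2)
        by simp_all
      obtain \<alpha> \<beta> where m: "flippable \<alpha> \<beta> P" "card \<alpha> + card \<beta> = d + 2"
        "2 \<le> card \<alpha>" "2 \<le> card \<beta>" "Q = flip \<alpha> \<beta> P"
        using Q(1) by (auto simp: proper_move_iff_flip[OF complex[OF P(1)]])
      obtain X Y where XY: "facet_subdivision d P X" "facet_subdivision d Q Y" "proper_move d X Y"
        using closed_pseudomanifold.proper_move_of_subdivisions[OF pseudomanifold[OF P(1)] m(1-4)]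
          pseudomanifold[OF tQ(1)] unfolding m(5) by blast
      have "iso_class T \<rightarrow>\<^sup>*\<^bsub>G (n + 1)\<^esub> iso_class X"
        using step.IH XY(1) P(3) mem_iso_class by blast
      moreover have "iso_class X \<rightarrow>\<^sup>*\<^bsub>G (n + 1)\<^esub> iso_class Y"
        using reach_proper_move[OF triangulates_subdivision[OF P(1) XY(1)] XY(3)] P(2) by simp
      moreover have "iso_class Y \<rightarrow>\<^sup>*\<^bsub>G (n + 1)\<^esub> iso_class Z"
        using subdivisions_of_isomorphic[OF tQ _ XY(2) Q'(2)] Q'(1) Q(2) by (simp add: iso_class_def)
      ultimately show "iso_class T \<rightarrow>\<^sup>*\<^bsub>G (n + 1)\<^esub> iso_class Z"
        using reach_trans by blast
    qed
  qed
  then show ?thesis using S' by blast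
qed

end

section \<open>Levels of the monotone closure\<close>

primrec iterated_subdivision :: "nat \<Rightarrow> scomplex \<Rightarrow> nat \<Rightarrow> scomplex" where
  "iterated_subdivision d R 0 = R"
| "iterated_subdivision d R (Suc k) = (SOME T. facet_subdivision d (iterated_subdivision d R k) T)"

lemma monotone_closure_refl: "iso_class R \<in> monotone_closure d R"
  by (simp add: monotone_closure_def)

lemma monotone_closure_step:
  assumes "iso_class S \<in> monotone_closure d R" "proper_move d S T \<or> facet_subdivision d S T"
  shows "iso_class T \<in> monotone_closure d R"
  using assms unfolding monotone_closure_def by (auto intro: rtrancl_into_rtrancl)

locale triangulated_PL_manifold = closed_PL_manifold d M
  for d :: nat and M :: "('m, 'e::euclidean_space) charted_space" +
  fixes R :: scomplex and n0 :: nat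
  assumes R: "triangulates M R" "card (vertices R) = n0"
begin

abbreviation "Ref \<equiv> iterated_subdivision d R"

text \<open>\<open>Ref k\<close> is the base point of the level with \<open>n0 + k\<close> vertices.
  An arbitrary choice of subdivisions suffices, and one always exists because every triangulation
  has a facet.\<close>

lemma Ref:
  "triangulates M (Ref k) \<and> card (vertices (Ref k)) = n0 + k \<and> iso_class (Ref k) \<in> monotone_closure d R"
proof (induction k)
  case 0
  then show ?case using R monotone_closure_refl by simp
next
  case (Suc k)
  have sub: "facet_subdivision d (Ref k) (Ref (Suc k))"
    using closed_pseudomanifold.exists_facet_subdivision[OF pseudomanifold] Suc.IH
    by (simp add: someI_ex)
  then show ?case
    using triangulates_subdivision[OF _ sub] monotone_closure_step[of "Ref k" d R "Ref (Suc k)"] Suc.IH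
    by simp
qed

lemma Ref_Suc: "facet_subdivision d (Ref k) (Ref (Suc k))"
  using closed_pseudomanifold.exists_facet_subdivision[OF pseudomanifold] Ref[of k]
  by (simp add: someI_ex)

text \<open>Along a path of the closure, a proper move is an arc of the current level. A subdivision
  passes to the next level, whose base point \<open>Ref (Suc k)\<close> is itself a subdivision of
  the previous one and therefore connected to it.\<close>

lemma monotone_closure_reach:
  assumes "A \<in> monotone_closure d R"
  shows "\<exists>k. iso_class (Ref k) \<rightarrow>\<^sup>*\<^bsub>G (n0 + k)\<^esub> A"
proof -
  have "(iso_class R, A) \<in>
      {(iso_class S, iso_class T) |S T. proper_move d S T \<or> facet_subdivision d S T}\<^sup>*"
    using assms by (simp add: monotone_closure_def)
  then show ?thesis
  proof (induction rule: rtrancl_induct)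
    case base
    show ?case using reach_refl[OF iso_class_in_verts[OF R]] by (intro exI[of _ 0]) simp
  next
    case (step B C)
    obtain k where k: "iso_class (Ref k) \<rightarrow>\<^sup>*\<^bsub>G (n0 + k)\<^esub> B" using step.IH by blast
    obtain S T where ST: "B = iso_class S" "C = iso_class T" "proper_move d S T \<or> facet_subdivision d S T"
      using step.hyps(2) by blast
    have "B \<in> verts (G (n0 + k))" using wf_digraph.reachable_in_verts(2)[OF wf k] .
    then obtain P where P: "triangulates M P" "card (vertices P) = n0 + k" "B = iso_class P"
      by (auto simp: vertsG)
    have iso: "isomorphic P S" using P(3) ST(1) iso_class_eq_iff by metis
    from ST(3) show ?case
    proof
      assume "proper_move d S T"
      then obtain Q where Q: "proper_move d P Q" "iso_class Q = iso_class T"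
        using proper_move_on_representative[OF P(1) iso] by blast
      have "iso_class P \<rightarrow>\<^sup>*\<^bsub>G (n0 + k)\<^esub> C"
        using reach_proper_move[OF P(1,2) Q(1)] Q(2) ST(2) by simp
      then show ?case using reach_trans[OF k] P(3) by auto
    next
      assume "facet_subdivision d S T"
      moreover have "S \<in> B" using ST(1) mem_iso_class by simp
      ultimately have "iso_class (Ref (Suc k)) \<rightarrow>\<^sup>*\<^bsub>G (n0 + k + 1)\<^esub> iso_class T"
        using subdivisions_reachable[OF _ _ Ref_Suc k] Ref[of k] by blast
      then show ?case using ST(2) by (intro exI[of _ "Suc k"]) simp
    qed
  qed
qed

lemma reach_in_monotone_closure:
  assumes "A \<in> monotone_closure d R" "A \<rightarrow>\<^sup>*\<^bsub>G n\<^esub> B"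
  shows "B \<in> monotone_closure d R"
  using assms(2,1)
proof (induction rule: wf_digraph.reachable_induct[OF wf, consumes 1, case_names base step])
  case (step B C)
  obtain S where S: "triangulates M S" "B = iso_class S"
    using step.hyps(2) unfolding arcsG vertsG by blast
  then obtain T where "proper_move d S T" "C = iso_class T"
    using arc_on_representative[OF S(1)] step.hyps(2) by blast
  then show ?case using monotone_closure_step step.IH step.prems S(2) by blast
qed

lemma monotone_vertices:
  "monotone_closure d R \<inter> verts (G (n0 + k)) = {A. iso_class (Ref k) \<rightarrow>\<^sup>*\<^bsub>G (n0 + k)\<^esub> A}"
proof (intro equalityI subsetI)
  fix A assume A: "A \<in> monotone_closure d R \<inter> verts (G (n0 + k))"
  then obtain l where l: "iso_class (Ref l) \<rightarrow>\<^sup>*\<^bsub>G (n0 + l)\<^esub> A" using monotone_closure_reach by blast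
  then have "A \<in> verts (G (n0 + l))" using wf_digraph.reachable_in_verts(2)[OF wf] by blast
  \<comment> \<open>A class determines its level, since isomorphic complexes have equally many
    vertices.\<close>
  then have "k = l" using A isomorphic_card_vertices by (auto simp: vertsG iso_class_eq_iff)
  then show "A \<in> {A. iso_class (Ref k) \<rightarrow>\<^sup>*\<^bsub>G (n0 + k)\<^esub> A}" using l by simp
next
  fix A assume "A \<in> {A. iso_class (Ref k) \<rightarrow>\<^sup>*\<^bsub>G (n0 + k)\<^esub> A}"
  then have A: "iso_class (Ref k) \<rightarrow>\<^sup>*\<^bsub>G (n0 + k)\<^esub> A" by simp
  show "A \<in> monotone_closure d R \<inter> verts (G (n0 + k))"
    using reach_in_monotone_closure[OF _ A] Ref[of k] wf_digraph.reachable_in_verts(2)[OF wf A] by blast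
qed

lemma monotone_vertices_scc: "monotone_closure d R \<inter> verts (G (n0 + k)) \<in> pre_digraph.sccs_verts (G (n0 + k))"
  unfolding pre_digraph.sccs_verts_def monotone_vertices
proof (intro CollectI conjI ballI allI impI)
  show "{A. iso_class (Ref k) \<rightarrow>\<^sup>*\<^bsub>G (n0 + k)\<^esub> A} \<noteq> {}"
    using reach_refl[OF iso_class_in_verts] Ref[of k] by blast
qed (use reach_trans reach_sym in blast)+

lemma monotone_graph_component: "monotone_graph d M R (n0 + k) \<in> flip_components d M (n0 + k)"
  unfolding monotone_graph_def flip_components_def
  using wf_digraph.in_verts_sccsD_sccs[OF wf monotone_vertices_scc] .

text \<open>For the definite description, existence comes from
  \<open>subdivisions_reachable\<close>. Uniqueness holds because every candidate \<open>W\<close>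
  contains the class of \<open>Ref (Suc k)\<close> and distinct components have disjoint vertex
  sets.\<close>

lemma stabilization_monotone_graph:
  "stabilization d M (n0 + k) (monotone_graph d M R (n0 + k)) = monotone_graph d M R (n0 + Suc k)"
  unfolding stabilization_def
proof (rule the_equality)
  let ?C = "\<lambda>k. monotone_closure d R \<inter> verts (G (n0 + k))"
  have verts: "verts (monotone_graph d M R (n0 + k)) = ?C k" for k
    by (simp add: monotone_graph_def)
  have sub: "iso_class T \<in> ?C (Suc k)" if S: "iso_class S \<in> ?C k" and T: "facet_subdivision d S T" for S T
  proof -
    have "iso_class (Ref k) \<rightarrow>\<^sup>*\<^bsub>G (n0 + k)\<^esub> iso_class S" using S unfolding monotone_vertices by simp
    then have "iso_class (Ref (Suc k)) \<rightarrow>\<^sup>*\<^bsub>G (n0 + k + 1)\<^esub> iso_class T"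
      using subdivisions_reachable[OF _ _ Ref_Suc _ mem_iso_class T] Ref[of k] by blast
    then show ?thesis unfolding monotone_vertices by simp
  qed
  show "monotone_graph d M R (n0 + Suc k) \<in> flip_components d M (n0 + k + 1) \<and>
    (\<forall>S T. iso_class S \<in> verts (monotone_graph d M R (n0 + k)) \<longrightarrow> facet_subdivision d S T \<longrightarrow>
      iso_class T \<in> verts (monotone_graph d M R (n0 + Suc k)))"
    using monotone_graph_component[of "Suc k"] sub unfolding verts by simp
  fix W assume W: "W \<in> flip_components d M (n0 + k + 1) \<and>
    (\<forall>S T. iso_class S \<in> verts (monotone_graph d M R (n0 + k)) \<longrightarrow> facet_subdivision d S T \<longrightarrow>
      iso_class T \<in> verts W)"
  have k: "iso_class (Ref k) \<in> ?C k" using Ref[of k] iso_class_in_verts by blast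
  then have "iso_class (Ref (Suc k)) \<in> verts W" using W Ref_Suc unfolding verts by blast
  moreover have "iso_class (Ref (Suc k)) \<in> ?C (Suc k)" using sub[OF k Ref_Suc] .
  moreover obtain C where C: "C \<in> pre_digraph.sccs_verts (G (n0 + Suc k))" "W = G (n0 + Suc k) \<restriction> C"
    using W unfolding flip_components_def wf_digraph.sccs_conv_sccs_verts[OF wf] by auto
  ultimately have "C = ?C (Suc k)"
    using wf_digraph.sccs_verts_disjoint[OF wf C(1) monotone_vertices_scc[of "Suc k"]] by fastforce
  then show "W = monotone_graph d M R (n0 + Suc k)"
    using C(2) by (simp add: monotone_graph_def)
qed

lemma iterated_stabilization_monotone_graph:
  "iterated_stabilization d M n0 k (flip_component_of d M n0 R) = monotone_graph d M R (n0 + k)"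
proof (induction k)
  case 0
  \<comment> \<open>\<open>Ref 0\<close> is \<open>R\<close>, and as arcs are symmetric, the mutual
    reachability in \<open>scc_of\<close> is the same as reachability.\<close>
  have "pre_digraph.scc_of (G n0) (iso_class R) = monotone_closure d R \<inter> verts (G n0)"
    using monotone_vertices[of 0] reach_sym by (auto simp: pre_digraph.scc_of_def)
  then show ?case by (simp add: flip_component_of_def monotone_graph_def)
next
  case (Suc k)
  then show ?case using stabilization_monotone_graph[of k] by simp
qed

end

theorem corollary12:
  fixes M :: "('m, 'e::euclidean_space) charted_space"
    and R :: "nat set set"
    and d n\<^sub>0 n :: nat
  assumes "2 \<le> d"
    and "closed_connected_PL_manifold d M"
    and "triangulates M R"
    and "card (vertices R) = n\<^sub>0"
    and "n\<^sub>0 \<le> n"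
  shows "monotone_graph d M R n \<in> flip_components d M n \<and>
    monotone_graph d M R n =
      iterated_stabilization d M n\<^sub>0 (n - n\<^sub>0) (flip_component_of d M n\<^sub>0 R)"
proof -
  interpret triangulated_PL_manifold d M R "n\<^sub>0"
    using assms by unfold_locales
  show ?thesis
    using monotone_graph_component[of "n - n\<^sub>0"] iterated_stabilization_monotone_graph[of "n - n\<^sub>0"]
      assms(5) by simp
qed

end
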